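(* Let $n\ge3$ be an integer, $s\in(0,1)$ and $q>1$. Let $u$ be a nonnegative distributional supersolution of $-\Delta u+(-\Delta)^s u=u^q$ in $\mathbb R^n$. Then $$u(x)\ge\int_{\mathbb R^n}\Gamma(x-y)\,u^q(y)\,dy\quad\text{for a.e. }x\in\mathbb R^n,$$ where $$\Gamma(x)=\int_0^\infty H(x,t)\,dt,\qquad H(x,t)=\frac{1}{(2\pi)^n}\int_{\mathbb R^n}e^{-t(|\xi|^2+|\xi|^{2s})+ix\cdot\xi}\,d\xi\quad(x\in\mathbb R^n,\ t>0).$$
   Context: The fractional Laplacian is $$(-\Delta)^s u(x)=C_{n,s}\lim_{\varepsilon\searrow 0}\int_{\mathbb R^n\setminus B_\varepsilon(x)}\frac{u(x)-u(y)}{|x-y|^{n+2s}}\,dy,\qquad C_{n,s}=\frac{2^{2s}\Gamma_E(s+n/2)}{\pi^{n/2}|\Gamma_E(-s)|},$$ with $\Gamma_E$ the Euler Gamma function, and $$\mathcal L^{2s}(\mathbb R^n)=\Big\{u\in L^1_{loc}(\mathbb R^n):\int_{\mathbb R^n}\frac{|u(x)|}{1+|x|^{n+2s}}\,dx<\infty\Big\}.$$ A nonnegative distributional supersolution of $-\Delta u+(-\Delta)^s u=u^q$ in $\mathbb R^n$ is a function $u\in\mathcal L^{2s}(\mathbb R^n)\cap L^q_{loc}(\mathbb R^n)$ with $u\ge0$ a.e. such that for every $\phi\in C_c^\infty(\mathbb R^n)$ with $\phi\ge0$, $$\int_{\mathbb R^n}u\,[(-\Delta)\phi+(-\Delta)^s\phi]\,dx\ge\int_{\mathbb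 R^n}u^q\phi\,dx.$$ $H$ is the heat kernel of $-\Delta+(-\Delta)^s$ (the operator with Fourier multiplier $|\xi|^2+|\xi|^{2s}$). *)

theory Defs
  imports "HOL-Analysis.Analysis"
begin

text \<open>
  The Euclidean space of dimension n is a type \<open>'a::euclidean_space\<close>, with n = \<open>DIM('a)\<close>.
\<close>

definition partial_deriv :: "'a::euclidean_space \<Rightarrow> ('a \<Rightarrow> real) \<Rightarrow> 'a \<Rightarrow> real" where
  "partial_deriv b f x = frechet_derivative f (at x) b"

fun C_k :: "nat \<Rightarrow> ('a::euclidean_space \<Rightarrow> real) \<Rightarrow> bool" where
  "C_k 0 f \<longleftrightarrow> continuous_on UNIV f"
| "C_k (Suc k) f \<longleftrightarrow>
     (\<forall>x. f differentiable (at x)) \<and> (\<forall>b\<in>Basis. C_k k (partial_deriv b f))"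

definition test_function :: "('a::euclidean_space \<Rightarrow> real) \<Rightarrow> bool" where
  "test_function \<phi> \<longleftrightarrow> (\<forall>k. C_k k \<phi>) \<and> compact (closure {x. \<phi> x \<noteq> 0})"

definition laplacian :: "('a::euclidean_space \<Rightarrow> real) \<Rightarrow> 'a \<Rightarrow> real" where
  "laplacian f x = (\<Sum>b\<in>Basis. partial_deriv b (partial_deriv b f) x)"

definition frac_const :: "'a::euclidean_space itself \<Rightarrow> real \<Rightarrow> real" where
  "frac_const _ s =
     2 powr (2 * s) * Gamma (s + real DIM('a) / 2) /
     (pi powr (real DIM('a) / 2) * \<bar>Gamma (- s)\<bar>)"

text \<open>
  The limit exists for every x when u is a test function and s lies in (0,1); this is the
  only case in which the operator is used below.
\<close>

definition frac_laplacian :: "real \<Rightarrow> ('a::euclidean_space \<Rightarrow> real) \<Rightarrow> 'a \<Rightarrow> real" where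
  "frac_laplacian s u x =
     frac_const TYPE('a) s *
     Lim (at_right 0) (\<lambda>\<epsilon>. LINT y:- ball x \<epsilon>|lebesgue.
        (u x - u y) / norm (x - y) powr (real DIM('a) + 2 * s))"

definition L1_loc :: "('a::euclidean_space \<Rightarrow> real) \<Rightarrow> bool" where
  "L1_loc u \<longleftrightarrow> (\<forall>K. compact K \<longrightarrow> set_integrable lebesgue K u)"

definition L_2s :: "real \<Rightarrow> ('a::euclidean_space \<Rightarrow> real) \<Rightarrow> bool" where
  "L_2s s u \<longleftrightarrow> L1_loc u \<and>
     integrable lebesgue (\<lambda>x. \<bar>u x\<bar> / (1 + norm x powr (real DIM('a) + 2 * s)))"

definition Lq_loc :: "real \<Rightarrow> ('a::euclidean_space \<Rightarrow> real) \<Rightarrow> bool" where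
  "Lq_loc q u \<longleftrightarrow> u \<in> borel_measurable lebesgue \<and> L1_loc (\<lambda>x. \<bar>u x\<bar> powr q)"

text \<open>
  Both integrals in the inequality converge absolutely: for a test function the integrand on
  the left is bounded by a multiple of \<open>\<bar>u x\<bar> / (1 + norm x powr (n + 2 * s))\<close>, and on the right
  u is locally in \<open>L\<^sup>q\<close>. Hence neither takes the default value 0 of the Bochner integral.
\<close>

definition nonneg_distr_supersolution ::
    "real \<Rightarrow> real \<Rightarrow> ('a::euclidean_space \<Rightarrow> real) \<Rightarrow> bool" where
  "nonneg_distr_supersolution s q u \<longleftrightarrow>
     L_2s s u \<and> Lq_loc q u \<and> (AE x in lebesgue. u x \<ge> 0) \<and>
     (\<forall>\<phi>. test_function \<phi> \<and> (\<forall>x. \<phi> x \<ge> 0) \<longrightarrow>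
        (LINT x|lebesgue. u x * (- laplacian \<phi> x + frac_laplacian s \<phi> x))
          \<ge> (LINT x|lebesgue. u x powr q * \<phi> x))"

text \<open>
  The Fourier integral is complex-valued; it is real because the multiplier is even in \<open>\<xi>\<close>,
  so taking the real part discards nothing.
\<close>

definition heat_kernel :: "real \<Rightarrow> 'a::euclidean_space \<Rightarrow> real \<Rightarrow> real" where
  "heat_kernel s x t =
     Re (1 / (2 * complex_of_real pi) ^ DIM('a) *
         (LINT \<xi>|lebesgue.
            exp (complex_of_real (- t * ((norm \<xi>)\<^sup>2 + norm \<xi> powr (2 * s)))
                 + \<i> * complex_of_real (x \<bullet> \<xi>))))"

text \<open>
  The kernel takes values in \<open>[0,\<infinity>]\<close> (it is infinite at the origin when n \<open>\<ge>\<close> 2). The embedding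
  \<open>ennreal\<close> truncates negative reals, but the heat kernel is nonnegative for s in (0,1).
\<close>

definition fundamental_kernel :: "real \<Rightarrow> 'a::euclidean_space \<Rightarrow> ennreal" where
  "fundamental_kernel s x = (\<integral>\<^sup>+t\<in>{0<..}. ennreal (heat_kernel s x t) \<partial>lebesgue)"

end

theory Submission
  imports Defs "HOL-Probability.Characteristic_Functions"
begin

text \<open>
  Formally the estimate is one line. Let \<open>P\<^sub>t\<close> be the heat semigroup of
  \<open>L = -\<Delta> + (-\<Delta>)\<^sup>s\<close> and let \<open>\<eta> \<ge> 0\<close>. The function \<open>\<phi> = \<integral>\<^sub>0\<^sup>T P\<^sub>t \<eta> dt\<close> is nonnegative and
  \<open>L \<phi> = \<eta> - P\<^sub>T \<eta> \<le> \<eta>\<close>, so testing the inequality for u with \<open>\<phi>\<close> and using \<open>u \<ge> 0\<close> gives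
  \<open>\<integral> u\<^sup>q \<phi> \<le> \<integral> u \<eta>\<close>. Letting T tend to infinity and \<open>\<eta>\<close> to a point mass at x yields the claim.

  Since the heat kernel is given by its Fourier transform, everything is carried out on the Fourier
  side. The point mass is replaced by a Gaussian \<open>heat_gaussian \<delta>\<close>, so that \<open>\<phi>\<close> and all
  intermediate functions are cosine transforms (\<open>wave\<close>) of explicit rapidly decreasing symbols:
  they are smooth, the Laplacian acts on them by multiplication with \<open>-\<bar>\<xi>\<bar>\<^sup>2\<close>, and the fractional
  Laplacian by \<open>\<bar>\<xi>\<bar>\<^sup>2\<^sup>s\<close>. The last fact is where the value of the normalising constant enters; it
  follows from \<open>nn_integral_jump_kernel_symbol\<close>, a computation with Gamma integrals.

  Two properties of \<open>\<phi>\<close> cannot be read off its symbol: nonnegativity, and decay of \<open>\<phi>\<close> and of its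
  first two derivatives like \<open>\<bar>x\<bar>\<close> to the power \<open>-(n+2s)\<close>, which is the rate that pairs with the
  integrability condition on u. Both come from \<open>wave_evolution_le\<close>: if a wave is bounded above by
  \<open>M \<ge> 0\<close> times the weight \<open>tail_weight s\<close>, then so is its evolution under the fractional
  heat flow, with M replaced by \<open>M * exp (K * t)\<close>. When jumps shorter than \<open>\<epsilon>\<close> are discarded, the
  generator is a convolution with a finite positive kernel minus its mass, the flow is an exponential
  series of convolutions, and the bound holds term by term with K independent of \<open>\<epsilon>\<close>
  (\<open>trunc_kernel_weight\<close>); the symbols converge as \<open>\<epsilon>\<close> tends to 0. The choice \<open>M = 0\<close>, applied to
  the negative of a nonnegative wave, is the preservation of positivity.

  The function \<open>\<phi>\<close> does not have compact support. The decay makes it an admissible test function all the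
  same: multiply by smooth cutoffs and pass to the limit, the integrands being dominated by a
  multiple of u times the weight (\<open>supersolution_test_decaying\<close>). The outcome is
  \<open>supersolution_potential_le\<close>, the regularised form of the claim. In the final limit
  \<open>\<delta> = 1/(k+1)\<close> and \<open>T = k\<close>; Fatou's lemma handles the potential, and integration over an arbitrary
  compact set K handles the Gaussian averages of u, whose limit superior is at most the integral of
  u over K. Inequality of the integrals over all compact sets implies the inequality almost everywhere.
\<close>

section \<open>Gaussian integrals\<close>

text \<open>
  This is the characteristic function of the standard normal law, rescaled by the square root of 2a.
\<close>

lemma has_bochner_integral_gaussian_cis:
  fixes a x :: real
  assumes a: "a > 0"
  shows "has_bochner_integral lborel (\<lambda>y. complex_of_real (exp (- a * y\<^sup>2)) * cis (x * y))
           (complex_of_real (sqrt (pi / a) * exp (- x\<^sup>2 / (4 * a))))"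
proof -
  define r where "r = sqrt (2 * a)"
  have r: "r > 0" "r\<^sup>2 = 2 * a" using a by (auto simp: r_def)
  have ch: "char std_normal_distribution (x / r) = complex_of_real (exp (- (x / r)\<^sup>2 / 2))"
    by (simp add: char_std_normal_distribution)
  have int: "integrable std_normal_distribution (\<lambda>z. iexp (x / r * z))"
    using real_dist_normal_dist by (intro prob_space.integrable_iexp) (auto simp: real_distribution_def)
  have 1: "has_bochner_integral lborel (\<lambda>z. std_normal_density z *\<^sub>R iexp (x / r * z))
             (complex_of_real (exp (- (x / r)\<^sup>2 / 2)))"
    using int ch unfolding char_def
    by (subst (asm) integrable_density, simp, simp, simp)
       (subst (asm) integral_density, simp, simp, simp, simp add: has_bochner_integral_iff)
  have 2: "has_bochner_integral lborel (\<lambda>y. std_normal_density (0 + r * y) *\<^sub>R iexp (x / r * (0 + r * y)))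
             (complex_of_real (exp (- (x / r)\<^sup>2 / 2)) /\<^sub>R \<bar>r\<bar>)"
    using r by (intro lborel_has_bochner_integral_real_affine_iff[THEN iffD1, OF _ 1]) auto
  have 3: "has_bochner_integral lborel (\<lambda>y. complex_of_real (sqrt (2 * pi)) * (std_normal_density (0 + r * y) *\<^sub>R iexp (x / r * (0 + r * y))))
             (complex_of_real (sqrt (2 * pi)) * (complex_of_real (exp (- (x / r)\<^sup>2 / 2)) /\<^sub>R \<bar>r\<bar>))"
    by (intro has_bochner_integral_mult_right 2)
  have sq: "sqrt (2 * pi) / r = sqrt (pi / a)"
    unfolding r_def by (simp flip: real_sqrt_divide)
  have e4: "x\<^sup>2 / (r\<^sup>2 * 2) = x\<^sup>2 / (4 * a)" by (simp add: r(2))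
  have f: "complex_of_real (sqrt (2 * pi)) * (std_normal_density (0 + r * y) *\<^sub>R iexp (x / r * (0 + r * y)))
         = complex_of_real (exp (- a * y\<^sup>2)) * cis (x * y)" for y
    using r by (simp add: std_normal_density_def cis_conv_exp power_mult_distrib scaleR_conv_of_real)
  have v: "complex_of_real (sqrt (2 * pi)) * (complex_of_real (exp (- (x / r)\<^sup>2 / 2)) /\<^sub>R \<bar>r\<bar>)
     = complex_of_real (sqrt (pi / a) * exp (- x\<^sup>2 / (4 * a)))"
    using r e4 by (simp add: scaleR_conv_of_real power_divide flip: sq) (simp add: field_simps)
  show ?thesis using 3 unfolding f v .
qed

lemma has_bochner_integral_lborel_prod:
  fixes f :: "'a::euclidean_space \<Rightarrow> real \<Rightarrow> complex"
  assumes "\<And>b. b \<in> Basis \<Longrightarrow> has_bochner_integral lborel (f b) (I b)"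
  shows "has_bochner_integral lborel (\<lambda>y. \<Prod>b\<in>Basis. f b (y \<bullet> b)) (\<Prod>b\<in>Basis. I b)"
proof -
  interpret product_sigma_finite "\<lambda>_::'a. lborel :: real measure" ..
  have int: "integrable lborel (f b)" "integral\<^sup>L lborel (f b) = I b" if "b \<in> Basis" for b
    using assms[OF that] by (auto simp: has_bochner_integral_iff)
  have [measurable]: "f b \<in> borel_measurable borel" if "b \<in> Basis" for b
    using int(1)[OF that] by auto
  have "has_bochner_integral (Pi\<^sub>M Basis (\<lambda>_. lborel)) (\<lambda>x. \<Prod>b\<in>Basis. f b (x b)) (\<Prod>b\<in>Basis. I b)"
    using product_integrable_prod[of "Basis::'a set" f] product_integral_prod[of "Basis::'a set" f] int
    by (simp add: has_bochner_integral_iff)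
  moreover have "(\<Prod>b\<in>Basis. f b ((\<Sum>c\<in>Basis. x c *\<^sub>R c) \<bullet> b)) = (\<Prod>b\<in>Basis. f b (x b))" for x
    by (intro prod.cong refl) simp
  ultimately show ?thesis
    by (subst lborel_eq) (simp add: has_bochner_integral_distr)
qed

text \<open>
  The Gaussian and the character are both products over the coordinates, which reduces the integral to
  dimension one.
\<close>

lemma gaussian_fourier:
  fixes x :: "'a::euclidean_space"
  assumes a: "a > 0"
  shows "integrable lborel (\<lambda>y. exp (- a * (norm y)\<^sup>2) * cos (x \<bullet> y))"
    and "(LINT y|lborel. exp (- a * (norm y)\<^sup>2) * cos (x \<bullet> y))
           = (pi / a) powr (real DIM('a) / 2) * exp (- (norm x)\<^sup>2 / (4 * a))"
proof -
  have nb: "(norm z)\<^sup>2 = (\<Sum>b\<in>Basis. (z \<bullet> b)\<^sup>2)" for z :: 'a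
    unfolding power2_norm_eq_inner by (subst euclidean_inner) (simp add: power2_eq_square)
  have f: "(\<Prod>b\<in>Basis. complex_of_real (exp (- a * (y \<bullet> b)\<^sup>2)) * cis ((x \<bullet> b) * (y \<bullet> b)))
          = complex_of_real (exp (- a * (norm y)\<^sup>2)) * cis (x \<bullet> y)" for y :: 'a
  proof -
    have "(\<Prod>b\<in>Basis. cis ((x \<bullet> b) * (y \<bullet> b))) = cis (x \<bullet> y)"
      unfolding euclidean_inner[of x y] by (simp add: cis_conv_exp exp_sum sum_distrib_left)
    moreover have "(\<Prod>b\<in>Basis. exp (- a * (y \<bullet> b)\<^sup>2)) = exp (- a * (norm y)\<^sup>2)"
      by (simp add: nb exp_sum sum_distrib_left flip: sum_negf)
    ultimately show ?thesis by (simp add: prod.distrib flip: of_real_prod)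
  qed
  have v: "(\<Prod>b\<in>(Basis::'a set). complex_of_real (sqrt (pi / a) * exp (- (x \<bullet> b)\<^sup>2 / (4 * a))))
     = complex_of_real ((pi / a) powr (real DIM('a) / 2) * exp (- (norm x)\<^sup>2 / (4 * a)))"
  proof -
    have "(\<Prod>b\<in>(Basis::'a set). exp (- (x \<bullet> b)\<^sup>2 / (4 * a))) = exp (- (norm x)\<^sup>2 / (4 * a))"
      by (simp add: nb exp_sum sum_divide_distrib flip: sum_negf)
    moreover have "(\<Prod>b\<in>(Basis::'a set). sqrt (pi / a)) = (pi / a) powr (real DIM('a) / 2)"
      using a by (simp add: powr_half_sqrt[symmetric] powr_powr powr_realpow[symmetric])
    ultimately show ?thesis by (simp add: prod.distrib flip: of_real_prod of_real_power)
  qed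
  have H: "has_bochner_integral lborel (\<lambda>y. complex_of_real (exp (- a * (norm y)\<^sup>2)) * cis (x \<bullet> y))
      (complex_of_real ((pi / a) powr (real DIM('a) / 2) * exp (- (norm x)\<^sup>2 / (4 * a))))"
    using has_bochner_integral_lborel_prod[of "\<lambda>b y. complex_of_real (exp (- a * y\<^sup>2)) * cis ((x \<bullet> b) * y)", OF has_bochner_integral_gaussian_cis[OF a]]
    unfolding f v .
  have H': "has_bochner_integral lborel (\<lambda>y. exp (- a * (norm y)\<^sup>2) * cos (x \<bullet> y))
           ((pi / a) powr (real DIM('a) / 2) * exp (- (norm x)\<^sup>2 / (4 * a)))"
    using has_bochner_integral_bounded_linear[OF bounded_linear_Re H] by (simp add: Re_complex_of_real)
  show "integrable lborel (\<lambda>y. exp (- a * (norm y)\<^sup>2) * cos (x \<bullet> y))"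
    "(LINT y|lborel. exp (- a * (norm y)\<^sup>2) * cos (x \<bullet> y))
           = (pi / a) powr (real DIM('a) / 2) * exp (- (norm x)\<^sup>2 / (4 * a))"
    using H' by (auto simp: has_bochner_integral_iff)
qed

text \<open>
  For an integer \<open>k \<ge> m\<close> one has \<open>exp (c v) = exp (c v / k) ^ k \<ge> (c v / k) ^ k\<close>.
\<close>

lemma powr_mult_exp_bounded:
  fixes c m :: real
  assumes "c > 0"
  shows "\<exists>M>0. \<forall>v\<ge>1. v powr m * exp (- c * v) \<le> M"
proof -
  obtain k' :: nat where "m \<le> real k'" using real_arch_simple by blast
  then obtain k :: nat where k: "m \<le> real k" "k > 0" by (intro that[of "Suc k'"]) auto
  have "v powr m * exp (- c * v) \<le> (k / c) ^ k" if "v \<ge> 1" for v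
  proof -
    have "v powr m \<le> v powr real k" using k that by (intro powr_mono) auto
    also have "\<dots> = v ^ k" using that by (simp add: powr_realpow)
    finally have 1: "v powr m \<le> v ^ k" .
    have "c * v / k \<le> exp (c * v / k)" using exp_ge_add_one_self[of "c * v / k"] by linarith
    hence "(c * v / k) ^ k \<le> exp (c * v / k) ^ k"
      using assms that by (intro power_mono) auto
    also have "\<dots> = exp (c * v)" using k by (simp flip: exp_of_nat_mult)
    finally have "(c / k) ^ k * v ^ k \<le> exp (c * v)"
      by (simp flip: power_mult_distrib)
    hence "v ^ k * exp (- c * v) \<le> (k / c) ^ k"
      using assms k by (simp add: exp_minus field_simps power_divide)
    thus ?thesis using 1 by (meson exp_ge_zero mult_right_mono order_trans)
  qed
  thus ?thesis using assms k by (intro exI[of _ "(k / c) ^ k"]) auto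
qed

section \<open>The symbol of the fractional Laplacian\<close>

lemma nn_integral_powr_exp:
  fixes a b :: real
  assumes a: "a > 0" and b: "b > 0"
  shows "(\<integral>\<^sup>+t. ennreal (indicator {0<..} t * (t powr (b - 1) * exp (- a * t))) \<partial>lborel)
          = ennreal (Gamma b * a powr (- b))"
proof -
  have 1: "ennreal (Gamma b) = (\<integral>\<^sup>+t. ennreal (indicator {0<..} t * (t powr (b - 1) * exp (- t))) \<partial>lborel)"
    unfolding Gamma_conv_nn_integral_real[OF b]
    by (intro nn_integral_cong) (auto simp: indicator_def exp_minus field_simps)
  also have "\<dots> = ennreal \<bar>a\<bar> * (\<integral>\<^sup>+t. ennreal (indicator {0<..} (0 + a * t) * ((0 + a * t) powr (b - 1) * exp (- (0 + a * t)))) \<partial>lborel)"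
    using a by (intro nn_integral_real_affine) auto
  also have "\<dots> = ennreal \<bar>a\<bar> * (\<integral>\<^sup>+t. ennreal (a powr (b - 1)) * ennreal (indicator {0<..} t * (t powr (b - 1) * exp (- a * t))) \<partial>lborel)"
    using a by (intro arg_cong2[of _ _ _ _ "(*)"] nn_integral_cong)
      (auto simp: indicator_def powr_mult zero_less_mult_iff simp flip: ennreal_mult)
  also have "\<dots> = ennreal (a powr b) * (\<integral>\<^sup>+t. ennreal (indicator {0<..} t * (t powr (b - 1) * exp (- a * t))) \<partial>lborel)"
  proof -
    have "\<bar>a\<bar> * a powr (b - 1) = a powr b" using a by (simp add: powr_diff)
    thus ?thesis by (subst nn_integral_cmult) (auto simp: mult.assoc[symmetric] simp flip: ennreal_mult)
  qed
  finally have "ennreal (a powr (- b)) * ennreal (Gamma b) = ennreal (a powr (- b)) * (ennreal (a powr b) * 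
      (\<integral>\<^sup>+t. ennreal (indicator {0<..} t * (t powr (b - 1) * exp (- a * t))) \<partial>lborel))" by simp
  moreover have "a powr (- b) * a powr b = 1" using a by (simp flip: powr_add)
  ultimately show ?thesis using b a
    by (simp add: mult.assoc[symmetric] mult.commute[of "Gamma b"] Gamma_real_pos less_imp_le flip: ennreal_mult)
qed

text \<open>
  The substitution \<open>t \<mapsto> 1/t\<close> turns this into a Gamma integral.
\<close>

lemma nn_integral_powr_exp_inverse:
  fixes s v :: real
  assumes s: "s < 1" and v: "v > 0"
  shows "(\<integral>\<^sup>+t. ennreal (indicator {0<..} t * (t powr (s - 2) * exp (- v / t))) \<partial>lborel)
          = ennreal (Gamma (1 - s) * v powr (s - 1))"
proof -
  let ?f = "\<lambda>r::real. r powr (- s) * exp (- v * r)"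
  have f: "has_bochner_integral lborel (\<lambda>t. indicator {0<..} t * ?f t) (Gamma (1 - s) * v powr (s - 1))"
    using nn_integral_powr_exp[of v "1 - s"] s v
    by (intro has_bochner_integral_nn_integral) (auto simp: indicator_def Gamma_real_pos less_imp_le)
  have f1: "?f absolutely_integrable_on {0<..}"
    using f unfolding has_bochner_integral_iff set_integrable_def
    by (auto simp: integrable_completion)
  have f2: "integral {0<..} ?f = Gamma (1 - s) * v powr (s - 1)"
    using f set_lebesgue_integral_eq_integral(2)[OF f1] unfolding has_bochner_integral_iff set_lebesgue_integral_def
    by (simp add: integral_completion)
  have im: "inverse ` {0::real<..} = {0<..}"
    by (auto simp: image_iff intro!: bexI[of _ "inverse _"])
  have "(\<lambda>x. abs (- (inverse x ^ Suc (Suc 0))) * ?f (inverse x)) absolutely_integrable_on {0<..} \<and>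
     integral {0<..} (\<lambda>x. abs (- (inverse x ^ Suc (Suc 0))) * ?f (inverse x)) = Gamma (1 - s) * v powr (s - 1)"
  proof -
    have der: "(inverse has_field_derivative - (inverse x ^ Suc (Suc 0))) (at x within {0<..})" if "x \<in> {0<..}" for x :: real
      using that by (intro DERIV_inverse) auto
    have S: "{0::real<..} \<in> sets lebesgue" by simp
    have inj: "inj_on inverse {0::real<..}" by (auto intro!: inj_onI)
    show ?thesis
      using has_absolute_integral_change_of_variables_1'[OF S der inj, where f = ?f] f1 f2 unfolding im by blast
  qed
  moreover have e: "abs (- (inverse x ^ Suc (Suc 0))) * ?f (inverse x) = x powr (s - 2) * exp (- v / x)" if "x \<in> {0<..}" for x
    using that by (simp add: powr_diff powr_minus field_simps powr_divide power2_eq_square powr_numeral inverse_powr)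
  moreover have "set_integrable lebesgue {0<..} (\<lambda>x. abs (- (inverse x ^ Suc (Suc 0))) * ?f (inverse x))
      = set_integrable lebesgue {0<..} (\<lambda>x. x powr (s - 2) * exp (- v / x))"
    by (intro set_integrable_cong refl e)
  moreover have "integral {0<..} (\<lambda>x. abs (- (inverse x ^ Suc (Suc 0))) * ?f (inverse x))
      = integral {0<..} (\<lambda>x. x powr (s - 2) * exp (- v / x))"
    by (intro Henstock_Kurzweil_Integration.integral_cong e)
  ultimately have g: "(\<lambda>x. x powr (s - 2) * exp (- v / x)) absolutely_integrable_on {0<..}"
      "integral {0<..} (\<lambda>x. x powr (s - 2) * exp (- v / x)) = Gamma (1 - s) * v powr (s - 1)"
    by (simp_all only:)
  have "((\<lambda>x. x powr (s - 2) * exp (- v / x)) has_integral Gamma (1 - s) * v powr (s - 1)) {0<..}"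
    using g set_lebesgue_integral_eq_integral(1)[OF g(1)] by (simp add: has_integral_integrable_integral)
  from nn_integral_has_integral_lebesgue[OF _ this] show ?thesis by simp
qed

text \<open>
  Write \<open>1 - exp (-b/t)\<close> as the integral of \<open>exp (-v/t) / t\<close> over v in \<open>[0,b]\<close> and exchange the
  order of integration.
\<close>

lemma nn_integral_powr_one_minus_exp:
  fixes s b :: real
  assumes s: "0 < s" "s < 1" and b: "b \<ge> 0"
  shows "(\<integral>\<^sup>+t. ennreal (indicator {0<..} t * (t powr (s - 1) * (1 - exp (- b / t)))) \<partial>lborel)
          = ennreal (Gamma (1 - s) * b powr s / s)"
proof -
  have 1: "ennreal (1 - exp (- b / t)) = (\<integral>\<^sup>+v. ennreal (indicator {0..b} v * (exp (- v / t) / t)) \<partial>lborel)"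
    if t: "t > 0" for t
  proof -
    have "(\<integral>\<^sup>+v. ennreal (exp (- v / t) / t) * indicator {0..b} v \<partial>lborel) = ennreal (- exp (- b / t) - - exp (- 0 / t))"
      using t b by (intro nn_integral_FTC_Icc) (auto intro!: derivative_eq_intros)
    moreover have "ennreal (indicator {0..b} v * (exp (- v / t) / t)) = ennreal (exp (- v / t) / t) * indicator {0..b} v" for v
      by (simp add: indicator_def)
    ultimately show ?thesis by simp
  qed
  have "(\<integral>\<^sup>+t. ennreal (indicator {0<..} t * (t powr (s - 1) * (1 - exp (- b / t)))) \<partial>lborel)
     = (\<integral>\<^sup>+t. (\<integral>\<^sup>+v. ennreal (indicator {0<..} t * t powr (s - 1)) * ennreal (indicator {0..b} v * (exp (- v / t) / t)) \<partial>lborel) \<partial>lborel)"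
  proof (intro nn_integral_cong)
    fix t :: real
    show "ennreal (indicator {0<..} t * (t powr (s - 1) * (1 - exp (- b / t))))
      = (\<integral>\<^sup>+v. ennreal (indicator {0<..} t * t powr (s - 1)) * ennreal (indicator {0..b} v * (exp (- v / t) / t)) \<partial>lborel)"
      using 1[of t] by (subst nn_integral_cmult) (auto simp: indicator_def[of "{0<..}"] ennreal_mult' simp del: minus_divide_left)
  qed
  also have "\<dots> = (\<integral>\<^sup>+v. (\<integral>\<^sup>+t. ennreal (indicator {0<..} t * t powr (s - 1)) * ennreal (indicator {0..b} v * (exp (- v / t) / t)) \<partial>lborel) \<partial>lborel)"
    by (rule lborel_pair.Fubini') simp
  also have "\<dots> = (\<integral>\<^sup>+v. (\<integral>\<^sup>+t. ennreal (indicator {0..b} v) * ennreal (indicator {0<..} t * (t powr (s - 2) * exp (- v / t))) \<partial>lborel) \<partial>lborel)"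
    by (intro nn_integral_cong) (auto simp: indicator_def powr_diff powr_numeral power2_eq_square simp flip: ennreal_mult)
  also have "\<dots> = (\<integral>\<^sup>+v. ennreal (indicator {0..b} v) * (\<integral>\<^sup>+t. ennreal (indicator {0<..} t * (t powr (s - 2) * exp (- v / t))) \<partial>lborel) \<partial>lborel)"
    by (intro nn_integral_cong nn_integral_cmult) auto
  also have "\<dots> = (\<integral>\<^sup>+v. ennreal (indicator {0..b} v) * ennreal (Gamma (1 - s) * v powr (s - 1)) \<partial>lborel)"
  proof (intro nn_integral_cong_AE, rule AE_mp[OF AE_lborel_singleton[of "0::real"]], intro AE_I2 impI)
    fix v :: real assume "v \<noteq> 0"
    show "ennreal (indicator {0..b} v) * (\<integral>\<^sup>+t. ennreal (indicator {0<..} t * (t powr (s - 2) * exp (- v / t))) \<partial>lborel)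
        = ennreal (indicator {0..b} v) * ennreal (Gamma (1 - s) * v powr (s - 1))"
    proof (cases "v > 0")
      case True
      show ?thesis unfolding nn_integral_powr_exp_inverse[OF s(2) True] ..
    qed (use \<open>v \<noteq> 0\<close> in auto)
  qed
  also have "\<dots> = (\<integral>\<^sup>+v. ennreal (Gamma (1 - s)) * ennreal (indicator {0..b} v * v powr (s - 1)) \<partial>lborel)"
    using s by (intro nn_integral_cong) (auto simp: indicator_def ennreal_mult)
  also have "\<dots> = ennreal (Gamma (1 - s)) * ennreal (b powr s / s)"
    using nn_integral_has_integral_lebesgue[OF _ has_integral_powr_from_0[of "s - 1" b]] s b
    by (subst nn_integral_cmult) auto
  finally show ?thesis using s by (simp add: ennreal_mult'[symmetric] Gamma_real_pos less_imp_le)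
qed

text \<open>
  The integral kernel of the fractional Laplacian including its normalising constant; as the intensity
  of jumps by y it is the Levy density of the associated stable process.
\<close>

definition jump_kernel :: "real \<Rightarrow> 'a::euclidean_space \<Rightarrow> real" where
  "jump_kernel s y = frac_const TYPE('a) s / norm y powr (real DIM('a) + 2 * s)"

lemma minus_unit_not_nonpos_Int:
  fixes s :: real
  assumes "0 < s" "s < 1"
  shows "- s \<notin> \<int>\<^sub>\<le>\<^sub>0"
proof
  assume "- s \<in> \<int>\<^sub>\<le>\<^sub>0"
  then obtain k :: int where "- s = of_int k" by (auto elim: nonpos_Ints_cases)
  hence "real_of_int k < 0" "real_of_int k > - 1" using assms by linarith+
  hence "k < 0" "k > - 1" by linarith+
  thus False by simp
qed

lemma frac_const_pos:
  assumes s: "0 < s" "s < 1"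
  shows "frac_const TYPE('a::euclidean_space) s > 0"
proof -
  have "Gamma (- s) \<noteq> 0"
    using minus_unit_not_nonpos_Int[OF s] by (simp add: Gamma_eq_zero_iff)
  thus ?thesis using s unfolding frac_const_def
    by (intro divide_pos_pos mult_pos_pos Gamma_real_pos) auto
qed

lemma jump_kernel_nonneg [simp]: "0 < s \<Longrightarrow> s < 1 \<Longrightarrow> jump_kernel s (y::'a::euclidean_space) \<ge> 0"
  using frac_const_pos[of s, where 'a='a] by (auto simp: jump_kernel_def less_imp_le)

lemma jump_kernel_minus [simp]: "jump_kernel s (- y) = jump_kernel s y"
  by (simp add: jump_kernel_def)

lemma jump_kernel_measurable [measurable]: "jump_kernel s \<in> borel_measurable borel"
  unfolding jump_kernel_def[abs_def] by measurable

text \<open>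
  The symbol of the fractional Laplacian is \<open>\<bar>\<xi>\<bar>\<^sup>2\<^sup>s\<close>. With \<open>P = n/2 + s\<close>, the power
  \<open>\<bar>y\<bar> powr (-2 P)\<close> is a mixture of Gaussians, \<open>\<Gamma>(P)\<close> times it being the integral of
  \<open>t powr (P-1) * exp (-t \<bar>y\<bar>\<^sup>2)\<close>. The y-integral of \<open>1 - cos (\<xi> \<bullet> y)\<close> against each Gaussian
  is explicit, and what remains is a Gamma integral in t.
\<close>

lemma nn_integral_jump_kernel_symbol:
  fixes \<xi> :: "'a::euclidean_space"
  assumes s: "0 < s" "s < 1"
  shows "(\<integral>\<^sup>+y. ennreal ((1 - cos (\<xi> \<bullet> y)) * jump_kernel s y) \<partial>lborel) = ennreal (norm \<xi> powr (2 * s))"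
proof -
  define P where "P = real DIM('a) / 2 + s"
  define C where "C = frac_const TYPE('a) s"
  have P: "P > 0" using s by (simp add: P_def)
  have C: "C > 0" unfolding C_def by (rule frac_const_pos[OF s])
  have GP: "Gamma P > 0" using P by (rule Gamma_real_pos)
  have gs: "\<bar>Gamma (- s)\<bar> = Gamma (1 - s) / s"
  proof -
    have "Gamma (- s + 1) = (- s) * Gamma (- s)"
      using minus_unit_not_nonpos_Int[OF s] by (intro Gamma_plus1)
    moreover have "Gamma (1 - s) > 0" using s by (intro Gamma_real_pos) auto
    ultimately have "Gamma (1 - s) / s = - Gamma (- s)" and "Gamma (- s) < 0"
      using s by (simp_all add: mult_less_0_iff)
    thus ?thesis by linarith
  qed
  have 1: "ennreal (Gamma P * ((1 - cos (\<xi> \<bullet> y)) / norm y powr (2 * P)))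
      = (\<integral>\<^sup>+t. ennreal ((1 - cos (\<xi> \<bullet> y)) * (indicator {0<..} t * (t powr (P - 1) * exp (- (norm y)\<^sup>2 * t)))) \<partial>lborel)" for y
  proof (cases "y = 0")
    case False
    have "(\<integral>\<^sup>+t. ennreal ((1 - cos (\<xi> \<bullet> y)) * (indicator {0<..} t * (t powr (P - 1) * exp (- (norm y)\<^sup>2 * t)))) \<partial>lborel)
       = ennreal (1 - cos (\<xi> \<bullet> y)) * ennreal (Gamma P * (norm y)\<^sup>2 powr (- P))"
      using False P by (subst nn_integral_powr_exp[symmetric]) (auto simp: ennreal_mult' nn_integral_cmult)
    also have "(norm y)\<^sup>2 powr (- P) = 1 / norm y powr (2 * P)"
      using False by (simp add: powr_powr powr_minus divide_simps flip: powr_numeral)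
    finally show ?thesis using GP by (simp add: ennreal_mult'[symmetric] mult_ac)
  qed simp
  have 2: "(\<integral>\<^sup>+y. ennreal ((1 - cos (\<xi> \<bullet> y)) * (indicator {0<..} t * (t powr (P - 1) * exp (- (norm y)\<^sup>2 * t)))) \<partial>lborel)
     = ennreal (pi powr (real DIM('a) / 2)) * ennreal (indicator {0<..} t * (t powr (s - 1) * (1 - exp (- ((norm \<xi>)\<^sup>2 / 4) / t))))" for t
  proof (cases "t > 0")
    case True
    have i0: "integrable lborel (\<lambda>y::'a. exp (- t * (norm y)\<^sup>2))"
      and v0: "(LINT y|lborel. exp (- t * (norm (y::'a))\<^sup>2)) = (pi / t) powr (real DIM('a) / 2)"
      using gaussian_fourier[OF True, of "0::'a"] True by auto
    have hb: "has_bochner_integral lborel (\<lambda>y. exp (- t * (norm y)\<^sup>2) - exp (- t * (norm y)\<^sup>2) * cos (\<xi> \<bullet> y))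
       ((pi / t) powr (real DIM('a) / 2) - (pi / t) powr (real DIM('a) / 2) * exp (- (norm \<xi>)\<^sup>2 / (4 * t)))"
      using i0 v0 gaussian_fourier[OF True, of \<xi>] by (intro has_bochner_integral_diff) (auto simp: has_bochner_integral_iff)
    have "(\<integral>\<^sup>+y. ennreal (exp (- t * (norm y)\<^sup>2) - exp (- t * (norm y)\<^sup>2) * cos (\<xi> \<bullet> y)) \<partial>lborel)
      = ennreal ((pi / t) powr (real DIM('a) / 2) - (pi / t) powr (real DIM('a) / 2) * exp (- (norm \<xi>)\<^sup>2 / (4 * t)))"
      using hb by (subst nn_integral_eq_integral) (auto simp: has_bochner_integral_iff mult_left_le)
    hence "(\<integral>\<^sup>+y. ennreal (t powr (P - 1)) * ennreal (exp (- t * (norm y)\<^sup>2) - exp (- t * (norm y)\<^sup>2) * cos (\<xi> \<bullet> y)) \<partial>lborel)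
      = ennreal (t powr (P - 1) * ((pi / t) powr (real DIM('a) / 2) - (pi / t) powr (real DIM('a) / 2) * exp (- (norm \<xi>)\<^sup>2 / (4 * t))))"
      by (subst nn_integral_cmult) (auto simp: ennreal_mult')
    moreover have "t powr (P - 1) * ((pi / t) powr (real DIM('a) / 2) - (pi / t) powr (real DIM('a) / 2) * exp (- (norm \<xi>)\<^sup>2 / (4 * t)))
       = pi powr (real DIM('a) / 2) * (t powr (s - 1) * (1 - exp (- ((norm \<xi>)\<^sup>2 / 4) / t)))"
    proof -
      have "t powr (P - 1) = t powr (s - 1) * t powr (real DIM('a) / 2)"
        unfolding P_def powr_add[symmetric] by (simp add: algebra_simps)
      hence "t powr (P - 1) * (pi / t) powr (real DIM('a) / 2) = pi powr (real DIM('a) / 2) * t powr (s - 1)"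
        using True by (simp add: powr_divide)
      thus ?thesis by (simp add: right_diff_distrib mult.assoc[symmetric])
    qed
    ultimately show ?thesis using True
      by (simp add: algebra_simps flip: ennreal_mult')
  qed simp
  have "ennreal (Gamma P) * (\<integral>\<^sup>+y. ennreal ((1 - cos (\<xi> \<bullet> y)) / norm y powr (2 * P)) \<partial>lborel)
     = (\<integral>\<^sup>+y. (\<integral>\<^sup>+t. ennreal ((1 - cos (\<xi> \<bullet> y)) * (indicator {0<..} t * (t powr (P - 1) * exp (- (norm y)\<^sup>2 * t)))) \<partial>lborel) \<partial>lborel)"
    using GP unfolding 1[symmetric]
    by (subst nn_integral_cmult[symmetric]) (auto simp: less_imp_le simp flip: ennreal_mult')
  also have "\<dots> = (\<integral>\<^sup>+t. (\<integral>\<^sup>+y. ennreal ((1 - cos (\<xi> \<bullet> y)) * (indicator {0<..} t * (t powr (P - 1) * exp (- (norm y)\<^sup>2 * t)))) \<partial>lborel) \<partial>lborel)"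
    by (rule lborel_pair.Fubini') simp
  also have "\<dots> = ennreal (pi powr (real DIM('a) / 2)) * ennreal (Gamma (1 - s) * ((norm \<xi>)\<^sup>2 / 4) powr s / s)"
    unfolding 2 by (subst nn_integral_cmult, simp, subst nn_integral_powr_one_minus_exp[OF s]) auto
  also have "\<dots> = ennreal (pi powr (real DIM('a) / 2) * (Gamma (1 - s) * ((norm \<xi>)\<^sup>2 / 4) powr s / s))"
    by (rule ennreal_mult'[symmetric]) simp
  finally have 3: "ennreal (Gamma P) * (\<integral>\<^sup>+y. ennreal ((1 - cos (\<xi> \<bullet> y)) / norm y powr (2 * P)) \<partial>lborel) = \<dots>" .
  have "(\<integral>\<^sup>+y. ennreal ((1 - cos (\<xi> \<bullet> y)) * jump_kernel s y) \<partial>lborel)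
     = (\<integral>\<^sup>+y. ennreal (C / Gamma P) * (ennreal (Gamma P) * ennreal ((1 - cos (\<xi> \<bullet> y)) / norm y powr (2 * P))) \<partial>lborel)"
  proof (intro nn_integral_cong)
    fix y :: 'a
    have "C / Gamma P * (Gamma P * ((1 - cos (\<xi> \<bullet> y)) / norm y powr (2 * P))) = (1 - cos (\<xi> \<bullet> y)) * jump_kernel s y"
      using GP by (simp add: jump_kernel_def C_def P_def)
    thus "ennreal ((1 - cos (\<xi> \<bullet> y)) * jump_kernel s y)
        = ennreal (C / Gamma P) * (ennreal (Gamma P) * ennreal ((1 - cos (\<xi> \<bullet> y)) / norm y powr (2 * P)))"
      using GP C by (simp only: ennreal_mult'[symmetric] less_imp_le divide_nonneg_nonneg)
  qed
  also have "\<dots> = ennreal (C / Gamma P) * (ennreal (Gamma P) * (\<integral>\<^sup>+y. ennreal ((1 - cos (\<xi> \<bullet> y)) / norm y powr (2 * P)) \<partial>lborel))"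
    by (subst nn_integral_cmult, simp, subst nn_integral_cmult) auto
  also have "\<dots> = ennreal (C / Gamma P * (pi powr (real DIM('a) / 2) * (Gamma (1 - s) * ((norm \<xi>)\<^sup>2 / 4) powr s / s)))"
    unfolding 3 using C GP by (intro ennreal_mult'[symmetric]) auto
  also have "C / Gamma P * (pi powr (real DIM('a) / 2) * (Gamma (1 - s) * ((norm \<xi>)\<^sup>2 / 4) powr s / s)) = norm \<xi> powr (2 * s)"
  proof -
    have G1: "Gamma (1 - s) > 0" using s by (intro Gamma_real_pos) auto
    have e: "2 powr (2 * s) * ((norm \<xi>)\<^sup>2 / 4) powr s = norm \<xi> powr (2 * s)"
    proof (cases "\<xi> = 0")
      case False
      have "(2::real) powr (2 * s) = 4 powr s" by (subst powr_powr[symmetric]) simp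
      moreover have "(norm \<xi>)\<^sup>2 powr s = norm \<xi> powr (2 * s)" using False by (subst powr_powr[symmetric]) simp
      ultimately show ?thesis by (simp add: powr_divide)
    qed simp
    have "C = 2 powr (2 * s) * Gamma P / (pi powr (real DIM('a) / 2) * (Gamma (1 - s) / s))"
      by (simp add: C_def frac_const_def gs P_def add.commute)
    hence "C / Gamma P * (pi powr (real DIM('a) / 2) * (Gamma (1 - s) * X / s)) = 2 powr (2 * s) * X" for X
      using GP less_imp_neq[OF G1] s by auto
    thus ?thesis by (simp only: e)
  qed
  finally show ?thesis .
qed

section \<open>A tail weight adapted to the jump kernel\<close>

lemma nn_integral_lborel_translate:
  fixes a :: "'a::euclidean_space"
  assumes [measurable]: "f \<in> borel_measurable borel"
  shows "(\<integral>\<^sup>+y. f (a + y) \<partial>lborel) = (\<integral>\<^sup>+y. f y \<partial>lborel)"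
  using nn_integral_distr[of "(+) a" lborel borel f] by (simp add: lborel_distr_plus)

lemma lborel_distr_minus: "distr lborel borel uminus = (lborel :: 'a::euclidean_space measure)"
  using lborel_affine[of "-1" "0::'a"] by (simp add: density_1)

lemma nn_integral_lborel_minus:
  fixes f :: "'a::euclidean_space \<Rightarrow> ennreal"
  assumes [measurable]: "f \<in> borel_measurable borel"
  shows "(\<integral>\<^sup>+y. f (- y) \<partial>lborel) = (\<integral>\<^sup>+y. f y \<partial>lborel)"
  using nn_integral_distr[of uminus lborel borel f] by (simp add: lborel_distr_minus)

lemma integral_lborel_minus:
  fixes f :: "'a::euclidean_space \<Rightarrow> real"
  assumes [measurable]: "f \<in> borel_measurable borel"
  shows "(LINT y|lborel. f (- y)) = (LINT y|lborel. f y)"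
  using integral_distr[of uminus lborel borel f] by (simp add: lborel_distr_minus)

lemma integrable_lborel_minus:
  fixes f :: "'a::euclidean_space \<Rightarrow> real"
  assumes f: "integrable lborel f"
  shows "integrable lborel (\<lambda>y. f (- y))"
  using integrable_distr_eq[of uminus lborel borel f] f by (simp add: lborel_distr_minus)

lemma integrable_norm_power_gaussian:
  fixes a :: real
  assumes a: "a > 0"
  shows "integrable lborel (\<lambda>\<xi>::'a::euclidean_space. norm \<xi> ^ k * exp (- a * (norm \<xi>)\<^sup>2))"
proof -
  obtain M where M: "M > 0" "\<forall>v\<ge>1. v powr real k * exp (- (a / 2) * v) \<le> M"
    using powr_mult_exp_bounded[of "a / 2" "real k"] a by auto
  have "integrable lborel (\<lambda>\<xi>::'a. M * exp (a / 2) * exp (- (a / 2) * (norm \<xi>)\<^sup>2))"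
    using gaussian_fourier(1)[of "a / 2" "0::'a"] a by (intro integrable_mult_right) simp
  thus ?thesis
  proof (rule Bochner_Integration.integrable_bound)
    show "AE \<xi> in lborel. norm (norm (\<xi>::'a) ^ k * exp (- a * (norm \<xi>)\<^sup>2)) \<le> norm (M * exp (a / 2) * exp (- (a / 2) * (norm \<xi>)\<^sup>2))"
    proof (intro AE_I2)
      fix \<xi> :: 'a
      define r where "r = norm \<xi>"
      have r: "r \<ge> 0" by (simp add: r_def)
      have "r \<le> 1 + r\<^sup>2" using zero_le_power2[of "r - 1/2"] by (simp add: power2_eq_square algebra_simps)
      hence 1: "r ^ k \<le> (1 + r\<^sup>2) powr real k"
        using r by (subst powr_realpow) (auto intro!: power_mono add_pos_nonneg)
      have "r ^ k * exp (- (a / 2) * (1 + r\<^sup>2)) \<le> (1 + r\<^sup>2) powr real k * exp (- (a / 2) * (1 + r\<^sup>2))"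
        using 1 by (intro mult_right_mono) auto
      also have "\<dots> \<le> M" using M by simp
      finally have 2: "r ^ k * exp (- (a / 2) * (1 + r\<^sup>2)) \<le> M" .
      have "r ^ k * exp (- a * r\<^sup>2) = (r ^ k * exp (- (a / 2) * (1 + r\<^sup>2))) * exp (a / 2) * exp (- (a / 2) * r\<^sup>2)"
        by (simp add: mult.assoc flip: exp_add) (simp add: algebra_simps)
      also have "\<dots> \<le> M * exp (a / 2) * exp (- (a / 2) * r\<^sup>2)"
        using 2 by (intro mult_right_mono) auto
      finally show "norm (norm \<xi> ^ k * exp (- a * (norm \<xi>)\<^sup>2)) \<le> norm (M * exp (a / 2) * exp (- (a / 2) * (norm \<xi>)\<^sup>2))"
        using M r by (simp add: r_def)
    qed
  qed simp
qed

lemma powr_two_s_le: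
  fixes s r :: real
  assumes "0 < s" "s < 1" "r \<ge> 0"
  shows "r powr (2 * s) \<le> 1 + r\<^sup>2"
proof (cases "r \<le> 1")
  case True
  hence "r powr (2 * s) \<le> 1" using assms by (intro powr_le1) auto
  thus ?thesis by (simp add: add_increasing2)
next
  case False
  hence "r powr (2 * s) \<le> r powr 2" using assms by (intro powr_mono) auto
  thus ?thesis using False by (simp add: powr_numeral)
qed

text \<open>
  Averaging the formula for the symbol over a Gaussian in \<open>\<xi>\<close> turns \<open>1 - cos (\<xi> \<bullet> y)\<close> into a multiple of
  \<open>1 - exp (-\<bar>y\<bar>\<^sup>2/4)\<close>, which is comparable to \<open>min 1 \<bar>y\<bar>\<^sup>2\<close>, while the average of
  \<open>\<bar>\<xi>\<bar>\<^sup>2\<^sup>s\<close> is finite.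
\<close>

lemma integrable_jump_kernel_levy:
  assumes s: "0 < s" "s < 1"
  shows "integrable lborel (\<lambda>y::'a::euclidean_space. min 1 ((norm y)\<^sup>2) * jump_kernel s y)"
proof -
  define c where "c = pi powr (real DIM('a) / 2)"
  have c: "c > 0" by (simp add: c_def)
  have i0: "integrable lborel (\<lambda>y::'a. exp (- 1 * (norm y)\<^sup>2))"
    and v0: "(LINT y|lborel. exp (- 1 * (norm (y::'a))\<^sup>2)) = c"
    using gaussian_fourier[of 1 "0::'a"] by (auto simp: c_def)
  have inner: "(\<integral>\<^sup>+\<xi>. ennreal (exp (- 1 * (norm \<xi>)\<^sup>2) * (1 - cos (\<xi> \<bullet> y))) \<partial>lborel) = ennreal (c * (1 - exp (- (norm y)\<^sup>2 / 4)))"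
    for y :: 'a
  proof -
    have hb: "has_bochner_integral lborel (\<lambda>\<xi>. exp (- 1 * (norm \<xi>)\<^sup>2) - exp (- 1 * (norm \<xi>)\<^sup>2) * cos (y \<bullet> \<xi>))
       (c - c * exp (- (norm y)\<^sup>2 / 4))"
      using i0 v0 gaussian_fourier[of 1 y] by (intro has_bochner_integral_diff) (auto simp: has_bochner_integral_iff c_def)
    have "(\<integral>\<^sup>+\<xi>. ennreal (exp (- 1 * (norm \<xi>)\<^sup>2) - exp (- 1 * (norm \<xi>)\<^sup>2) * cos (y \<bullet> \<xi>)) \<partial>lborel)
      = ennreal (c - c * exp (- (norm y)\<^sup>2 / 4))"
      using hb by (subst nn_integral_eq_integral) (auto simp: has_bochner_integral_iff mult_left_le)
    thus ?thesis by (simp add: right_diff_distrib inner_commute)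
  qed
  have "(\<integral>\<^sup>+y. ennreal (c * (1 - exp (- (norm y)\<^sup>2 / 4)) * jump_kernel s (y::'a)) \<partial>lborel)
     = (\<integral>\<^sup>+y. \<integral>\<^sup>+\<xi>. ennreal (exp (- 1 * (norm \<xi>)\<^sup>2) * (1 - cos (\<xi> \<bullet> y)) * jump_kernel s (y::'a)) \<partial>lborel \<partial>lborel)"
  proof (intro nn_integral_cong)
    fix y :: 'a
    have "(\<integral>\<^sup>+\<xi>. ennreal (exp (- 1 * (norm \<xi>)\<^sup>2) * (1 - cos (\<xi> \<bullet> y)) * jump_kernel s y) \<partial>lborel)
        = (\<integral>\<^sup>+\<xi>. ennreal (exp (- 1 * (norm \<xi>)\<^sup>2) * (1 - cos (\<xi> \<bullet> y))) * ennreal (jump_kernel s y) \<partial>lborel)"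
      using s by (intro nn_integral_cong ennreal_mult'') simp
    also have "\<dots> = ennreal (c * (1 - exp (- (norm y)\<^sup>2 / 4))) * ennreal (jump_kernel s y)"
      by (subst nn_integral_multc, measurable, subst inner, rule refl)
    finally show "ennreal (c * (1 - exp (- (norm y)\<^sup>2 / 4)) * jump_kernel s y)
        = (\<integral>\<^sup>+\<xi>. ennreal (exp (- 1 * (norm \<xi>)\<^sup>2) * (1 - cos (\<xi> \<bullet> y)) * jump_kernel s y) \<partial>lborel)"
      using s by (simp only: ennreal_mult''[OF jump_kernel_nonneg[OF s]])
  qed
  also have "\<dots> = (\<integral>\<^sup>+\<xi>. \<integral>\<^sup>+y. ennreal (exp (- 1 * (norm \<xi>)\<^sup>2) * (1 - cos (\<xi> \<bullet> y)) * jump_kernel s (y::'a)) \<partial>lborel \<partial>lborel)"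
    by (rule lborel_pair.Fubini') simp
  also have "\<dots> = (\<integral>\<^sup>+\<xi>. ennreal (exp (- 1 * (norm \<xi>)\<^sup>2)) * (\<integral>\<^sup>+y. ennreal ((1 - cos (\<xi> \<bullet> y)) * jump_kernel s (y::'a)) \<partial>lborel) \<partial>lborel)"
    by (intro nn_integral_cong, subst nn_integral_cmult[symmetric]) (auto simp: mult.assoc simp flip: ennreal_mult')
  also have "\<dots> = (\<integral>\<^sup>+\<xi>. ennreal (exp (- 1 * (norm \<xi>)\<^sup>2) * norm (\<xi>::'a) powr (2 * s)) \<partial>lborel)"
    by (simp only: nn_integral_jump_kernel_symbol[OF s] ennreal_mult'[OF exp_ge_zero])
  also have "\<dots> \<le> (\<integral>\<^sup>+\<xi>. ennreal (norm (\<xi>::'a) ^ 0 * exp (- 1 * (norm \<xi>)\<^sup>2) + norm \<xi> ^ 2 * exp (- 1 * (norm \<xi>)\<^sup>2)) \<partial>lborel)"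
  proof (intro nn_integral_mono ennreal_leI)
    fix \<xi> :: 'a
    show "exp (- 1 * (norm \<xi>)\<^sup>2) * norm \<xi> powr (2 * s) \<le> norm \<xi> ^ 0 * exp (- 1 * (norm \<xi>)\<^sup>2) + norm \<xi> ^ 2 * exp (- 1 * (norm \<xi>)\<^sup>2)"
      using mult_left_mono[OF powr_two_s_le[OF s, of "norm \<xi>"], of "exp (- 1 * (norm \<xi>)\<^sup>2)"]
      by (simp add: algebra_simps)
  qed
  also have "\<dots> < \<infinity>"
  proof -
    have i2: "integrable lborel (\<lambda>\<xi>. norm (\<xi>::'a) ^ 0 * exp (- 1 * (norm \<xi>)\<^sup>2) + norm \<xi> ^ 2 * exp (- 1 * (norm \<xi>)\<^sup>2))"
      by (intro Bochner_Integration.integrable_add integrable_norm_power_gaussian) auto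
    show ?thesis by (subst nn_integral_eq_integral[OF i2]) auto
  qed
  finally have fin: "(\<integral>\<^sup>+y. ennreal (c * (1 - exp (- (norm y)\<^sup>2 / 4)) * jump_kernel s (y::'a)) \<partial>lborel) < \<infinity>" .
  have I: "integrable lborel (\<lambda>y::'a. c * (1 - exp (- (norm y)\<^sup>2 / 4)) * jump_kernel s y)"
    using fin s c by (intro integrableI_nonneg) (auto intro!: AE_I2 mult_nonneg_nonneg)
  have "integrable lborel (\<lambda>y::'a. 5 / c * (c * (1 - exp (- (norm y)\<^sup>2 / 4)) * jump_kernel s y))"
    by (intro integrable_mult_right I)
  thus ?thesis
  proof (rule Bochner_Integration.integrable_bound)
    show "AE y in lborel. norm (min 1 ((norm y)\<^sup>2) * jump_kernel s (y::'a)) \<le> norm (5 / c * (c * (1 - exp (- (norm y)\<^sup>2 / 4)) * jump_kernel s y))"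
    proof (intro AE_I2)
      fix y :: 'a
      define v where "v = (norm y)\<^sup>2 / 4"
      have v: "v \<ge> 0" by (simp add: v_def)
      have "exp v \<ge> 1 + v" by (rule exp_ge_add_one_self)
      hence "exp (- v) \<le> 1 / (1 + v)" using v by (simp add: exp_minus divide_simps)
      hence A: "v / (1 + v) \<le> 1 - exp (- v)" using v by (simp add: field_simps)
      \<comment> \<open>At the corner \<open>v = 1/4\<close> of the minimum both sides are equal to 1.\<close>
      have B: "min 1 (4 * v) \<le> 5 * (v / (1 + v))"
      proof (cases "4 * v \<le> 1")
        case True
        have "4 * v * v \<le> v" using True v mult_right_mono[of "4 * v" 1 v] by simp
        thus ?thesis using v True by (simp add: field_simps)
      qed (use v in \<open>simp add: field_simps\<close>)
      have "min 1 (4 * v) \<le> 5 * (1 - exp (- v))"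
        by (rule order_trans[OF B mult_left_mono[OF A]]) simp
      hence "min 1 ((norm y)\<^sup>2) \<le> 5 * (1 - exp (- (norm y)\<^sup>2 / 4))" by (simp add: v_def)
      hence "min 1 ((norm y)\<^sup>2) * jump_kernel s y \<le> 5 * (1 - exp (- (norm y)\<^sup>2 / 4)) * jump_kernel s y"
        by (rule mult_right_mono) (use s in auto)
      moreover have "5 * (1 - exp (- (norm y)\<^sup>2 / 4)) * jump_kernel s y = 5 / c * (c * (1 - exp (- (norm y)\<^sup>2 / 4)) * jump_kernel s y)"
        using c by simp
      moreover have "min 1 ((norm y)\<^sup>2) * jump_kernel s y \<ge> 0" using s by simp
      ultimately show "norm (min 1 ((norm y)\<^sup>2) * jump_kernel s (y::'a)) \<le> norm (5 / c * (c * (1 - exp (- (norm y)\<^sup>2 / 4)) * jump_kernel s y))"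
        by simp
    qed
  qed simp
qed

text \<open>
  A smooth positive function with the decay of \<open>\<bar>x\<bar>\<close> to the power \<open>-p\<close>.
\<close>

definition weight :: "real \<Rightarrow> 'a::euclidean_space \<Rightarrow> real" where
  "weight p x = (4 + (norm x)\<^sup>2) powr (- p / 2)"

lemma weight_base_pos [simp]: "4 + (norm x)\<^sup>2 > 0"
  by (simp add: add_pos_nonneg)

lemma weight_base_nonzero [simp]: "4 + (norm x)\<^sup>2 \<noteq> 0"
  using weight_base_pos[of x] by linarith

lemma weight_pos [simp]: "weight p x > 0"
  unfolding weight_def using weight_base_pos[of x] by simp

lemma weight_nonneg [simp]: "weight p x \<ge> 0"
  by (rule less_imp_le[OF weight_pos])

lemma weight_measurable [measurable]: "weight p \<in> borel_measurable borel"
  unfolding weight_def[abs_def] by measurable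

lemma weight_le_one:
  assumes "p \<ge> 0"
  shows "weight p x \<le> 1"
proof -
  have "(4 + (norm x)\<^sup>2) powr (- p / 2) \<le> (4 + (norm x)\<^sup>2) powr 0"
    using assms by (intro powr_mono) auto
  thus ?thesis unfolding weight_def by (simp only: powr_zero_eq_one weight_base_nonzero if_False)
qed

lemma weight_comparison:
  assumes p: "p \<ge> 0" and K: "K > 0" and le: "4 + (norm x)\<^sup>2 \<le> K * (4 + (norm z)\<^sup>2)"
  shows "weight p z \<le> K powr (p / 2) * weight p x"
proof -
  have "(K * (4 + (norm z)\<^sup>2)) powr (- p / 2) \<le> (4 + (norm x)\<^sup>2) powr (- p / 2)"
    using p by (intro powr_mono2' le) auto
  hence "K powr (- p / 2) * weight p z \<le> weight p x"
    using K by (simp add: powr_mult weight_def)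
  hence "K powr (p / 2) * (K powr (- p / 2) * weight p z) \<le> K powr (p / 2) * weight p x"
    by (intro mult_left_mono) auto
  thus ?thesis using K by (simp add: mult.assoc[symmetric] flip: powr_add)
qed

lemma norm_add_square_le: "(norm (x + y))\<^sup>2 \<le> 2 * (norm x)\<^sup>2 + 2 * (norm (y::'a::real_inner))\<^sup>2"
proof -
  have "(norm (x + y))\<^sup>2 + (norm (x - y))\<^sup>2 = 2 * (norm x)\<^sup>2 + 2 * (norm y)\<^sup>2"
    by (simp add: power2_norm_eq_inner algebra_simps)
  thus ?thesis using zero_le_power2[of "norm (x - y)"] by linarith
qed

lemma weight_shift:
  assumes p: "p \<ge> 0" and y: "(norm y)\<^sup>2 \<le> r" 
  shows "weight p (x + y) \<le> (2 + r) powr (p / 2) * weight p x"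
proof (rule weight_comparison[OF p])
  have r: "r \<ge> 0" using order_trans[OF zero_le_power2 y] .
  show "2 + r > 0" using r by simp
  have "(norm x)\<^sup>2 \<le> 2 * (norm (x + y))\<^sup>2 + 2 * (norm y)\<^sup>2"
    using norm_add_square_le[of "x + y" "- y"] by simp
  moreover have "r * (norm (x + y))\<^sup>2 \<ge> 0" using r by simp
  ultimately show "4 + (norm x)\<^sup>2 \<le> (2 + r) * (4 + (norm (x + y))\<^sup>2)"
    using y r unfolding distrib_left distrib_right by linarith
qed

text \<open>
  Taylor's formula of order two at 0, evaluated at 1 and at \<open>-1\<close>.
\<close>

lemma second_difference_bound:
  fixes g g' g'' :: "real \<Rightarrow> real"
  assumes g: "\<And>t. (g has_real_derivative g' t) (at t)"
    and g': "\<And>t. (g' has_real_derivative g'' t) (at t)"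
    and B: "\<And>t. \<bar>t\<bar> \<le> 1 \<Longrightarrow> \<bar>g'' t\<bar> \<le> B"
  shows "\<bar>g 1 + g (- 1) - 2 * g 0\<bar> \<le> B"
proof -
  \<comment> \<open>Taylor's theorem takes the derivatives as one sequence, here continued by a constant after order two.\<close>
  define diff where "diff = (\<lambda>m::nat. if m = 0 then g else if m = 1 then g' else g'')"
  have d0: "diff 0 = g" by (simp add: diff_def)
  have d: "\<forall>m t. m < 2 \<and> a \<le> t \<and> t \<le> b \<longrightarrow> DERIV (diff m) t :> diff (Suc m) t" for a b
    using g g' by (auto simp: diff_def less_2_cases_iff)
  obtain t1 where t1: "0 < t1" "t1 < 1" "g 1 = (\<Sum>m<2. (diff m 0 / fact m) * (1 - 0) ^ m) + (diff 2 t1 / fact 2) * (1 - 0)\<^sup>2"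
    using Taylor_up[of 2 diff g 0 1 0, OF _ d0 d] by auto
  obtain t2 where t2: "-1 < t2" "t2 < 0" "g (-1) = (\<Sum>m<2. (diff m 0 / fact m) * (-1 - 0) ^ m) + (diff 2 t2 / fact 2) * (-1 - 0)\<^sup>2"
    using Taylor_down[of 2 diff g "-1" 0 0, OF _ d0 d] by auto
  have "g 1 + g (- 1) - 2 * g 0 = g'' t1 / 2 + g'' t2 / 2"
    using t1(3) t2(3) by (simp add: diff_def numeral_2_eq_2)
  moreover have "\<bar>g'' t1\<bar> \<le> B" "\<bar>g'' t2\<bar> \<le> B" using t1 t2 by (auto intro!: B)
  ultimately show ?thesis by linarith
qed

text \<open>
  The second derivative of the weight along y is at most a constant times \<open>\<bar>y\<bar>\<^sup>2\<close> times the weight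
  at the same point, and within distance 1 the weight varies only by a bounded factor.
\<close>

lemma weight_second_difference:
  fixes x y :: "'a::euclidean_space"
  assumes p: "p \<ge> 0" and y: "norm y \<le> 1"
  shows "\<bar>weight p (x + y) + weight p (x - y) - 2 * weight p x\<bar>
           \<le> (p + p * (p + 2)) * 3 powr (p / 2) * (norm y)\<^sup>2 * weight p x"
proof -
  define N where "N = (\<lambda>t. 4 + (norm (x + t *\<^sub>R y))\<^sup>2)"
  define N' where "N' = (\<lambda>t. 2 * ((x + t *\<^sub>R y) \<bullet> y))"
  have Npos: "N t > 0" for t by (simp add: N_def)
  have dN: "(N has_real_derivative N' t) (at t)" for t
    unfolding N_def N'_def power2_norm_eq_inner
    by (auto simp: has_field_derivative_def inner_commute algebra_simps fun_eq_iff intro!: derivative_eq_intros)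
  have dN': "(N' has_real_derivative 2 * (norm y)\<^sup>2) (at t)" for t
    unfolding N'_def power2_norm_eq_inner
    by (auto simp: has_field_derivative_def inner_commute algebra_simps fun_eq_iff intro!: derivative_eq_intros)
  define g where "g = (\<lambda>t. N t powr (- p / 2))"
  define g' where "g' = (\<lambda>t. (- p / 2) * N t powr (- p / 2 - 1) * N' t)"
  define g'' where "g'' = (\<lambda>t. (- p / 2) * ((- p / 2 - 1) * N t powr (- p / 2 - 1 - 1) * N' t * N' t + N t powr (- p / 2 - 1) * (2 * (norm y)\<^sup>2)))"
  have dg: "(g has_real_derivative g' t) (at t)" for t
    unfolding g_def g'_def using Npos[of t] by (auto intro!: derivative_eq_intros dN)
  have dg': "(g' has_real_derivative g'' t) (at t)" for t
    unfolding g'_def g''_def using Npos[of t]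
    by (auto intro!: derivative_eq_intros dN dN' simp: field_simps)
  have gt: "g t = weight p (x + t *\<^sub>R y)" for t by (simp add: g_def N_def weight_def)
  have "\<bar>g'' t\<bar> \<le> (p + p * (p + 2)) * 3 powr (p / 2) * (norm y)\<^sup>2 * weight p x" if t: "\<bar>t\<bar> \<le> 1" for t
  proof -
    have p1: "N t powr (- p / 2 - 1) = g t / N t"
      using Npos[of t] by (simp add: g_def powr_diff)
    have p2: "N t powr (- p / 2 - 1 - 1) = g t / N t / N t"
      using Npos[of t] unfolding p1[symmetric] by (subst powr_diff) simp
    have "(N' t)\<^sup>2 \<le> 4 * ((norm (x + t *\<^sub>R y))\<^sup>2 * (norm y)\<^sup>2)"
      unfolding N'_def using Cauchy_Schwarz_ineq[of "x + t *\<^sub>R y" y]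
      by (simp add: power_mult_distrib power2_norm_eq_inner)
    also have "\<dots> \<le> 4 * (N t * (norm y)\<^sup>2)"
      by (intro mult_left_mono mult_right_mono) (auto simp: N_def)
    finally have n2: "(N' t)\<^sup>2 / N t \<le> 4 * (norm y)\<^sup>2" using Npos[of t] by (simp add: field_simps)
    have N1: "1 / N t \<le> 1" using Npos[of t] by (simp add: N_def)
    have gpos: "g t \<ge> 0" by (simp add: gt)
    have "g'' t = g t * (1 / N t) * ((p / 2) * (p / 2 + 1) * ((N' t)\<^sup>2 / N t) - p * (norm y)\<^sup>2)"
      unfolding g''_def p1 p2 using Npos[of t] by (simp add: field_simps power2_eq_square)
    also have "\<bar>\<dots>\<bar> \<le> g t * 1 * ((p / 2) * (p / 2 + 1) * (4 * (norm y)\<^sup>2) + p * (norm y)\<^sup>2)"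
    proof -
      have a: "\<bar>g t * (1 / N t)\<bar> \<le> g t * 1" using mult_left_mono[OF N1 gpos] gpos Npos[of t] by simp
      have b: "\<bar>(p / 2) * (p / 2 + 1) * ((N' t)\<^sup>2 / N t) - p * (norm y)\<^sup>2\<bar> \<le> (p / 2) * (p / 2 + 1) * (4 * (norm y)\<^sup>2) + p * (norm y)\<^sup>2"
      proof -
        have "(p / 2) * (p / 2 + 1) * ((N' t)\<^sup>2 / N t) \<le> (p / 2) * (p / 2 + 1) * (4 * (norm y)\<^sup>2)"
          using p n2 by (intro mult_left_mono) auto
        moreover have "(p / 2) * (p / 2 + 1) * ((N' t)\<^sup>2 / N t) \<ge> 0" "p * (norm y)\<^sup>2 \<ge> 0"
          using p Npos[of t] by (auto intro!: mult_nonneg_nonneg divide_nonneg_pos)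
        ultimately show ?thesis by linarith
      qed
      show ?thesis unfolding abs_mult[of "g t * (1 / N t)"] using gpos by (intro mult_mono a b) auto
    qed
    also have "\<dots> = g t * ((p + p * (p + 2)) * (norm y)\<^sup>2)" by (simp add: algebra_simps)
    also have "\<dots> \<le> (3 powr (p / 2) * weight p x) * ((p + p * (p + 2)) * (norm y)\<^sup>2)"
    proof (intro mult_right_mono)
      have "norm (t *\<^sub>R y) \<le> 1" using t y by (simp add: mult_le_one)
      hence "(norm (t *\<^sub>R y))\<^sup>2 \<le> 1" by (simp add: power_le_one)
      from weight_shift[OF p this] show "g t \<le> 3 powr (p / 2) * weight p x" by (simp add: gt)
    qed (use p in auto)
    finally show ?thesis by (simp add: algebra_simps)
  qed
  from second_difference_bound[OF dg dg' this] show ?thesis by (simp add: gt)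
qed

text \<open>
  The exponent \<open>n + 2s\<close> is the decay rate of the jump kernel, and the one in the definition
  of \<open>L_2s\<close>.
\<close>

abbreviation tail_weight :: "real \<Rightarrow> 'a::euclidean_space \<Rightarrow> real" where
  "tail_weight s x \<equiv> weight (real DIM('a) + 2 * s) x"

lemma integrable_jump_kernel_tail:
  assumes s: "0 < s" "s < 1"
  shows "integrable lborel (\<lambda>y::'a::euclidean_space. indicator {y. norm y > 1} y * jump_kernel s y)"
proof (rule Bochner_Integration.integrable_bound[OF integrable_jump_kernel_levy[OF s]])
  show "AE y::'a in lborel. norm (indicator {y. norm y > 1} y * jump_kernel s y) \<le> norm (min 1 ((norm y)\<^sup>2) * jump_kernel s y)"
  proof (intro AE_I2)
    fix y :: 'a
    have "norm y > 1 \<Longrightarrow> 1 \<le> (norm y)\<^sup>2" by (simp add: one_le_power)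
    thus "norm (indicator {y. norm y > 1} y * jump_kernel s y) \<le> norm (min 1 ((norm y)\<^sup>2) * jump_kernel s y)"
      by (auto simp: indicator_def min_def)
  qed
qed measurable

lemma weight_le_jump_kernel:
  fixes x :: "'a::euclidean_space"
  assumes s: "0 < s" "s < 1" and x: "x \<noteq> 0"
  shows "tail_weight s x \<le> jump_kernel s x / frac_const TYPE('a) s"
proof -
  have "tail_weight s x \<le> ((norm x)\<^sup>2) powr (- (real DIM('a) + 2 * s) / 2)"
    unfolding weight_def using x s by (intro powr_mono2') auto
  also have "\<dots> = (norm x powr 2) powr (- (real DIM('a) + 2 * s) / 2)" using x by (simp add: powr_numeral)
  also have "\<dots> = norm x powr (- (real DIM('a) + 2 * s))"
    unfolding powr_powr by (intro arg_cong2[of _ _ _ _ "(powr)"] refl) (simp add: field_simps)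
  also have "\<dots> = jump_kernel s x / frac_const TYPE('a) s"
    using frac_const_pos[OF s, where 'a='a] unfolding powr_minus_divide jump_kernel_def by simp
  finally show ?thesis .
qed

lemma integrable_tail_weight:
  assumes s: "0 < s" "s < 1"
  shows "integrable lborel (tail_weight s :: 'a::euclidean_space \<Rightarrow> real)"
proof -
  define C where "C = frac_const TYPE('a) s"
  have C: "C > 0" unfolding C_def by (rule frac_const_pos[OF s])
  have "integrable lborel (\<lambda>y::'a. indicator (cball 0 1) y + (indicator {y. norm y > 1} y * jump_kernel s y) / C)"
    by (intro Bochner_Integration.integrable_add integrable_divide integrable_jump_kernel_tail[OF s])
       (auto intro!: integrable_real_indicator emeasure_bounded_finite[simplified])
  thus ?thesis
  proof (rule Bochner_Integration.integrable_bound)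
    show "AE y::'a in lborel. norm (tail_weight s y) \<le> norm (indicator (cball 0 1) y + (indicator {y. norm y > 1} y * jump_kernel s y) / C)"
    proof (intro AE_I2)
      fix y :: 'a
      show "norm (tail_weight s y) \<le> norm (indicator (cball 0 1) y + (indicator {y. norm y > 1} y * jump_kernel s y) / C)"
      proof (cases "norm y > 1")
        case True
        hence "y \<noteq> 0" by auto
        thus ?thesis using weight_le_jump_kernel[OF s, of y] True C s by (auto simp: C_def[symmetric] indicator_def)
      next
        case False
        thus ?thesis using weight_le_one[of "real DIM('a) + 2 * s" y] s by (auto simp: indicator_def)
      qed
    qed
  qed measurable
qed

text \<open>
  At least one of \<open>x + y\<close> and y has size comparable to that of x or larger, so that one of the two
  factors on the left is at most a constant times the weight at x.
\<close>

lemma weight_jump_kernel_product: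
  fixes x y :: "'a::euclidean_space"
  assumes s: "0 < s" "s < 1" and y: "y \<noteq> 0"
  shows "jump_kernel s y * tail_weight s (x + y)
    \<le> 4 powr ((real DIM('a) + 2 * s) / 2) * tail_weight s x * (frac_const TYPE('a) s * tail_weight s (x + y) + jump_kernel s y)"
    (is "?J * ?W \<le> ?K * ?w * (?C * ?W + ?J)")
proof -
  have p: "real DIM('a) + 2 * s \<ge> 0" using s by simp
  have C: "?C > 0" by (rule frac_const_pos[OF s])
  have J: "?J \<ge> 0" using s by simp
  have "(norm x)\<^sup>2 \<le> 2 * (norm (x + y))\<^sup>2 + 2 * (norm y)\<^sup>2"
    using norm_add_square_le[of "x + y" "- y"] by simp
  hence "4 + (norm x)\<^sup>2 \<le> 4 * (4 + (norm (x + y))\<^sup>2) \<or> 4 + (norm x)\<^sup>2 \<le> 4 * (norm y)\<^sup>2"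
    by auto
  thus ?thesis
  proof
    assume "4 + (norm x)\<^sup>2 \<le> 4 * (4 + (norm (x + y))\<^sup>2)"
    hence "?W \<le> ?K * ?w" by (intro weight_comparison p) auto
    hence "?J * ?W \<le> ?J * (?K * ?w)" using J by (intro mult_left_mono)
    also have "\<dots> \<le> ?J * (?K * ?w) + ?K * ?w * (?C * ?W)" using C by simp
    finally show ?thesis by (simp add: algebra_simps)
  next
    assume le: "4 + (norm x)\<^sup>2 \<le> 4 * (norm y)\<^sup>2"
    have "(4 * (norm y)\<^sup>2) powr (- (real DIM('a) + 2 * s) / 2) \<le> ?w"
      unfolding weight_def using p le by (intro powr_mono2') auto
    moreover have "((norm y)\<^sup>2) powr (- (real DIM('a) + 2 * s) / 2) = ?J / ?C"
    proof -
      have "((norm y)\<^sup>2) powr (- (real DIM('a) + 2 * s) / 2) = (norm y powr 2) powr (- (real DIM('a) + 2 * s) / 2)"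
        using y by (simp add: powr_numeral)
      also have "\<dots> = norm y powr (- (real DIM('a) + 2 * s))"
    unfolding powr_powr by (intro arg_cong2[of _ _ _ _ "(powr)"] refl) (simp add: field_simps)
      also have "\<dots> = ?J / ?C" using C unfolding powr_minus_divide jump_kernel_def by simp
      finally show ?thesis .
    qed
    ultimately have "4 powr (- (real DIM('a) + 2 * s) / 2) * (?J / ?C) \<le> ?w"
      by (simp add: powr_mult)
    hence a: "?K * (4 powr (- (real DIM('a) + 2 * s) / 2) * (?J / ?C)) \<le> ?K * ?w"
      by (intro mult_left_mono) auto
    have b: "?K * 4 powr (- (real DIM('a) + 2 * s) / 2) = 1"
      by (simp flip: powr_add add: add_divide_distrib[symmetric])
    have "?J / ?C \<le> ?K * ?w" using a unfolding mult.assoc[symmetric] b by simp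
    hence "?J \<le> ?K * ?w * ?C" using C by (simp add: pos_divide_le_eq)
    hence "?J * ?W \<le> ?K * ?w * ?C * ?W" by (intro mult_right_mono) auto
    also have "\<dots> \<le> ?K * ?w * ?C * ?W + ?K * ?w * ?J" using J by simp
    finally show ?thesis by (simp add: algebra_simps)
  qed
qed

text \<open>
  An upper bound, up to a constant, for the symmetric second difference at x with increment y of a
  function that decays together with its second derivatives like the weight: the second derivative
  is used for short increments, the size of the function for long ones.
\<close>

definition envelope :: "real \<Rightarrow> 'a::euclidean_space \<Rightarrow> 'a \<Rightarrow> real" where
  "envelope s x y = min 1 ((norm y)\<^sup>2) * tail_weight s x +
     indicator {y. norm y > 1} y * (tail_weight s (x + y) + tail_weight s (x - y))"

lemma envelope_nonneg [simp]: "envelope s x y \<ge> 0"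
  by (auto simp: envelope_def intro!: add_nonneg_nonneg mult_nonneg_nonneg)

lemma envelope_measurable [measurable]: "envelope s x \<in> borel_measurable borel"
  unfolding envelope_def[abs_def] by measurable

text \<open>
  The weight is stable under jumps. The short increments contribute the finite constant of
  \<open>integrable_jump_kernel_levy\<close>; for the long ones, \<open>weight_jump_kernel_product\<close> splits off the
  weight at x and leaves two integrable functions.
\<close>

lemma jump_kernel_envelope:
  assumes s: "0 < s" "s < 1"
  shows "\<exists>M>0. \<forall>x::'a::euclidean_space. integrable lborel (\<lambda>y. jump_kernel s y * envelope s x y) \<and>
           (LINT y|lborel. jump_kernel s y * envelope s x y) \<le> M * tail_weight s x"
proof -
  define K where "K = 4 powr ((real DIM('a) + 2 * s) / 2)"
  define C where "C = frac_const TYPE('a) s"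
  have C: "C > 0" unfolding C_def by (rule frac_const_pos[OF s])
  have K: "K > 0" by (simp add: K_def)
  let ?J = "jump_kernel s :: 'a \<Rightarrow> real"
  let ?w = "tail_weight s :: 'a \<Rightarrow> real"
  define I1 where "I1 = (LINT y|lborel. min 1 ((norm y)\<^sup>2) * ?J y)"
  define I2 where "I2 = (LINT y|lborel. indicator {y. norm y > 1} y * ?J y)"
  define I3 where "I3 = integral\<^sup>L lborel ?w"
  have I0: "I1 \<ge> 0" "I2 \<ge> 0" "I3 \<ge> 0"
    unfolding I1_def I2_def I3_def using s by (auto intro!: integral_nonneg mult_nonneg_nonneg)
  have tr: "integrable lborel (\<lambda>y. ?w (x + y))" "(LINT y|lborel. ?w (x + y)) = I3" for x
  proof -
    show "integrable lborel (\<lambda>y. ?w (x + y))"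
      using integrable_distr_eq[of "(+) x" lborel borel ?w] integrable_tail_weight[OF s, where 'a='a]
      by (simp add: lborel_distr_plus)
    show "(LINT y|lborel. ?w (x + y)) = I3"
      using integral_distr[of "(+) x" lborel borel ?w] by (simp add: lborel_distr_plus I3_def)
  qed
  have tr': "integrable lborel (\<lambda>y. ?w (x - y))" "(LINT y|lborel. ?w (x - y)) = I3" for x
    using integrable_lborel_minus[OF tr(1), of x] integral_lborel_minus[of "\<lambda>y. ?w (x + y)"] tr(2)[of x] by auto
  define U where "U = (\<lambda>x y::'a. ?w x * (min 1 ((norm y)\<^sup>2) * ?J y) +
      K * ?w x * (C * ?w (x + y) + C * ?w (x - y) + 2 * (indicator {y. norm y > 1} y * ?J y)))"
  have U: "integrable lborel (U x)" "integral\<^sup>L lborel (U x) = (I1 + K * (2 * C * I3 + 2 * I2)) * ?w x" for x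
  proof -
    have "has_bochner_integral lborel (U x) (?w x * I1 + K * ?w x * (C * I3 + C * I3 + 2 * I2))"
      unfolding U_def I1_def I2_def
      by (intro has_bochner_integral_add has_bochner_integral_mult_right has_bochner_integral_integrable
           integrable_jump_kernel_levy[OF s] integrable_jump_kernel_tail[OF s])
         (auto simp: has_bochner_integral_iff tr tr')
    thus "integrable lborel (U x)" "integral\<^sup>L lborel (U x) = (I1 + K * (2 * C * I3 + 2 * I2)) * ?w x"
      by (auto simp: has_bochner_integral_iff algebra_simps)
  qed
  have le: "?J y * envelope s x y \<le> U x y" for x y
  proof (cases "norm y > 1")
    case True
    hence y: "y \<noteq> 0" by auto
    have "?J y * ?w (x + y) \<le> K * ?w x * (C * ?w (x + y) + ?J y)"
      unfolding K_def C_def by (rule weight_jump_kernel_product[OF s y])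
    moreover have "?J y * ?w (x - y) \<le> K * ?w x * (C * ?w (x - y) + ?J y)"
      unfolding K_def C_def using weight_jump_kernel_product[OF s, of "- y" x] y by simp
    ultimately show ?thesis using True by (simp add: U_def envelope_def algebra_simps)
  next
    case False
    thus ?thesis using K C by (simp add: U_def envelope_def add_nonneg_nonneg)
  qed
  have int: "integrable lborel (\<lambda>y. ?J y * envelope s x y)" for x
    using s by (intro Bochner_Integration.integrable_bound[OF U(1)[of x]])
       (auto intro!: AE_I2 order_trans[OF le] simp: abs_mult)
  have "(LINT y|lborel. ?J y * envelope s x y) \<le> (I1 + K * (2 * C * I3 + 2 * I2)) * ?w x" for x
    unfolding U(2)[symmetric] by (intro integral_mono int U(1) le)
  hence "(LINT y|lborel. ?J y * envelope s x y) \<le> (I1 + K * (2 * C * I3 + 2 * I2) + 1) * ?w x" for x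
    by (rule order_trans) (simp add: mult_right_mono)
  moreover have "I1 + K * (2 * C * I3 + 2 * I2) + 1 > 0" using I0 K C by (simp add: add_nonneg_pos)
  ultimately show ?thesis using int by blast
qed

section \<open>The fractional heat flow on cosine transforms\<close>

text \<open>
  Discarding the jumps shorter than \<open>\<epsilon>\<close> leaves an integrable kernel, hence a bounded operator whose
  semigroup is an exponential series.
\<close>

definition trunc_kernel :: "real \<Rightarrow> real \<Rightarrow> 'a::euclidean_space \<Rightarrow> real" where
  "trunc_kernel s \<epsilon> y = indicator {y. norm y \<ge> \<epsilon>} y * jump_kernel s y"

text \<open>
  The cosine transform of the truncated kernel. Its value at 0 is the total mass.
\<close>

definition trunc_symbol :: "real \<Rightarrow> real \<Rightarrow> 'a::euclidean_space \<Rightarrow> real" where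
  "trunc_symbol s \<epsilon> \<xi> = (LINT y|lborel. trunc_kernel s \<epsilon> y * cos (\<xi> \<bullet> y))"

lemma trunc_kernel_nonneg [simp]: "0 < s \<Longrightarrow> s < 1 \<Longrightarrow> trunc_kernel s \<epsilon> (y::'a::euclidean_space) \<ge> 0"
  by (simp add: trunc_kernel_def)

lemma trunc_kernel_le: "0 < s \<Longrightarrow> s < 1 \<Longrightarrow> trunc_kernel s \<epsilon> (y::'a::euclidean_space) \<le> jump_kernel s y"
  by (simp add: trunc_kernel_def indicator_def)

lemma trunc_kernel_minus [simp]: "trunc_kernel s \<epsilon> (- y) = trunc_kernel s \<epsilon> y"
  by (simp add: trunc_kernel_def indicator_def)

lemma trunc_kernel_measurable [measurable]: "trunc_kernel s \<epsilon> \<in> borel_measurable borel"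
  unfolding trunc_kernel_def[abs_def] by measurable

lemma integrable_trunc_kernel:
  assumes s: "0 < s" "s < 1" and \<epsilon>: "0 < \<epsilon>" "\<epsilon> \<le> 1"
  shows "integrable lborel (trunc_kernel s \<epsilon> :: 'a::euclidean_space \<Rightarrow> real)"
proof (rule Bochner_Integration.integrable_bound)
  show "integrable lborel (\<lambda>y::'a. (1 / \<epsilon>\<^sup>2) * (min 1 ((norm y)\<^sup>2) * jump_kernel s y))"
    by (intro integrable_mult_right integrable_jump_kernel_levy[OF s])
  show "AE y::'a in lborel. norm (trunc_kernel s \<epsilon> y) \<le> norm ((1 / \<epsilon>\<^sup>2) * (min 1 ((norm y)\<^sup>2) * jump_kernel s y))"
  proof (intro AE_I2)
    fix y :: 'a
    show "norm (trunc_kernel s \<epsilon> y) \<le> norm ((1 / \<epsilon>\<^sup>2) * (min 1 ((norm y)\<^sup>2) * jump_kernel s y))"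
    proof (cases "norm y \<ge> \<epsilon>")
      case True
      have "\<epsilon>\<^sup>2 \<le> (norm y)\<^sup>2" using True \<epsilon> by (intro power_mono) auto
      moreover have "\<epsilon>\<^sup>2 \<le> 1" using \<epsilon> by (simp add: power_le_one)
      ultimately have "1 \<le> (1 / \<epsilon>\<^sup>2) * min 1 ((norm y)\<^sup>2)" using \<epsilon> by (simp add: field_simps min_def)
      hence "1 * jump_kernel s y \<le> (1 / \<epsilon>\<^sup>2) * min 1 ((norm y)\<^sup>2) * jump_kernel s y"
        using s by (intro mult_right_mono) auto
      thus ?thesis using True s by (simp add: trunc_kernel_def abs_mult)
    qed (simp add: trunc_kernel_def)
  qed
qed measurable

lemma integrable_trunc_kernel_mult:
  fixes f :: "'a::euclidean_space \<Rightarrow> real"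
  assumes s: "0 < s" "s < 1" and \<epsilon>: "0 < \<epsilon>" "\<epsilon> \<le> 1"
    and [measurable]: "f \<in> borel_measurable borel" and B: "\<And>y. \<bar>f y\<bar> \<le> B"
  shows "integrable lborel (\<lambda>y. trunc_kernel s \<epsilon> y * f y)"
proof (rule Bochner_Integration.integrable_bound)
  show "integrable lborel (\<lambda>y::'a. B * trunc_kernel s \<epsilon> y)"
    by (intro integrable_mult_right integrable_trunc_kernel[OF s \<epsilon>])
  show "AE y::'a in lborel. norm (trunc_kernel s \<epsilon> y * f y) \<le> norm (B * trunc_kernel s \<epsilon> y)"
  proof (intro AE_I2)
    fix y
    have "\<bar>f y\<bar> * \<bar>trunc_kernel s \<epsilon> y\<bar> \<le> \<bar>B\<bar> * \<bar>trunc_kernel s \<epsilon> y\<bar>"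
      using B[of y] by (intro mult_right_mono) auto
    thus "norm (trunc_kernel s \<epsilon> y * f y) \<le> norm (B * trunc_kernel s \<epsilon> y)" by (simp add: abs_mult mult.commute)
  qed
qed measurable

lemma trunc_symbol_measurable [measurable]: "trunc_symbol s \<epsilon> \<in> borel_measurable borel"
  unfolding trunc_symbol_def[abs_def] by measurable

lemma trunc_symbol_bound:
  fixes \<xi> :: "'a::euclidean_space"
  assumes s: "0 < s" "s < 1" and \<epsilon>: "0 < \<epsilon>" "\<epsilon> \<le> 1"
  shows "\<bar>trunc_symbol s \<epsilon> \<xi>\<bar> \<le> trunc_symbol s \<epsilon> (0::'a)"
proof -
  have "norm (trunc_symbol s \<epsilon> \<xi>) \<le> (LINT y|lborel. norm (trunc_kernel s \<epsilon> y * cos (\<xi> \<bullet> y)))"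
    unfolding trunc_symbol_def by (rule integral_norm_bound)
  also have "\<dots> \<le> (LINT y|lborel. trunc_kernel s \<epsilon> (y::'a) * 1)"
    using s by (intro integral_mono integrable_norm integrable_trunc_kernel_mult[OF s \<epsilon>, where B = 1])
               (auto simp: abs_mult mult_left_le)
  finally show ?thesis by (simp add: trunc_symbol_def)
qed

lemma trunc_symbol_tendsto:
  fixes \<xi> :: "'a::euclidean_space"
  assumes s: "0 < s" "s < 1"
  shows "(\<lambda>j. trunc_symbol s (1 / Suc j) (0::'a) - trunc_symbol s (1 / Suc j) \<xi>) \<longlonglongrightarrow> norm \<xi> powr (2 * s)"
proof -
  have int: "integrable lborel (\<lambda>y. (1 - cos (\<xi> \<bullet> y)) * jump_kernel s y)"
    using nn_integral_jump_kernel_symbol[OF s, of \<xi>] s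
    by (intro integrableI_nonneg) (auto intro!: AE_I2)
  have val: "(LINT y|lborel. (1 - cos (\<xi> \<bullet> y)) * jump_kernel s y) = norm \<xi> powr (2 * s)"
    using nn_integral_jump_kernel_symbol[OF s, of \<xi>] s
    by (intro integral_eq_nn_integral[THEN trans]) (auto intro!: AE_I2)
  have eq: "trunc_symbol s (1 / Suc j) (0::'a) - trunc_symbol s (1 / Suc j) \<xi>
      = (LINT y|lborel. trunc_kernel s (1 / Suc j) y * (1 - cos (\<xi> \<bullet> y)))" for j
  proof -
    have "integrable lborel (trunc_kernel s (1 / Suc j) :: 'a \<Rightarrow> real)"
      by (intro integrable_trunc_kernel[OF s]) auto
    moreover have "integrable lborel (\<lambda>y. trunc_kernel s (1 / Suc j) y * cos (\<xi> \<bullet> y))"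
      by (rule integrable_trunc_kernel_mult[OF s, where B = 1]) auto
    ultimately show ?thesis by (simp add: trunc_symbol_def right_diff_distrib)
  qed
  have "(\<lambda>j. LINT y|lborel. trunc_kernel s (1 / Suc j) y * (1 - cos (\<xi> \<bullet> y)))
      \<longlonglongrightarrow> (LINT y|lborel. (1 - cos (\<xi> \<bullet> y)) * jump_kernel s y)"
  proof (rule integral_dominated_convergence[where w = "\<lambda>y. (1 - cos (\<xi> \<bullet> y)) * jump_kernel s y"])
    show "AE y in lborel. (\<lambda>j. trunc_kernel s (1 / Suc j) y * (1 - cos (\<xi> \<bullet> y))) \<longlonglongrightarrow> (1 - cos (\<xi> \<bullet> y)) * jump_kernel s y"
    proof (intro AE_I2)
      fix y :: 'a
      show "(\<lambda>j. trunc_kernel s (1 / Suc j) y * (1 - cos (\<xi> \<bullet> y))) \<longlonglongrightarrow> (1 - cos (\<xi> \<bullet> y)) * jump_kernel s y"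
      proof (cases "y = 0")
        case False
        have "eventually (\<lambda>j. 1 / real (Suc j) < norm y) sequentially"
          using LIMSEQ_inverse_real_of_nat[THEN order_tendstoD(2), of "norm y"] False
          by (simp add: inverse_eq_divide)
        hence "eventually (\<lambda>j. trunc_kernel s (1 / Suc j) y * (1 - cos (\<xi> \<bullet> y)) = (1 - cos (\<xi> \<bullet> y)) * jump_kernel s y) sequentially"
          by eventually_elim (simp add: trunc_kernel_def)
        thus ?thesis by (rule tendsto_eventually)
      qed simp
    qed
    show "AE y in lborel. norm (trunc_kernel s (1 / Suc j) y * (1 - cos (\<xi> \<bullet> y))) \<le> (1 - cos (\<xi> \<bullet> y)) * jump_kernel s y" for j
    proof (intro AE_I2)
      fix y :: 'a
      have "trunc_kernel s (1 / Suc j) y * (1 - cos (\<xi> \<bullet> y)) \<le> jump_kernel s y * (1 - cos (\<xi> \<bullet> y))"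
        by (intro mult_right_mono trunc_kernel_le[OF s]) auto
      thus "norm (trunc_kernel s (1 / Suc j) y * (1 - cos (\<xi> \<bullet> y))) \<le> (1 - cos (\<xi> \<bullet> y)) * jump_kernel s y"
        using s by (simp add: abs_mult mult.commute)
    qed
  qed (use int in auto)
  thus ?thesis unfolding eq val .
qed

text \<open>
  The point is that K does not depend on \<open>\<epsilon>\<close>, although the mass of the kernel is unbounded as \<open>\<epsilon>\<close>
  tends to 0. The kernel being even, the difference \<open>weight (x + y) - weight x\<close> may be replaced by half
  of the symmetric second difference, which the envelope dominates.
\<close>

lemma trunc_kernel_weight:
  assumes s: "0 < s" "s < 1"
  shows "\<exists>K>0. \<forall>\<epsilon> x. 0 < \<epsilon> \<longrightarrow> \<epsilon> \<le> 1 \<longrightarrow>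
    (LINT y|lborel. trunc_kernel s \<epsilon> y * tail_weight s (x + y)) \<le> (trunc_symbol s \<epsilon> (0::'a::euclidean_space) + K) * tail_weight s (x::'a)"
proof -
  define p where "p = real DIM('a) + 2 * s"
  have p: "p \<ge> 0" using s by (simp add: p_def)
  let ?w = "weight p :: 'a \<Rightarrow> real"
  define K1 where "K1 = (p + p * (p + 2)) * 3 powr (p / 2)"
  have K1: "K1 \<ge> 0" using p by (simp add: K1_def)
  obtain M where M: "M > 0" "\<And>x::'a. integrable lborel (\<lambda>y. jump_kernel s y * envelope s x y)"
    "\<And>x::'a. (LINT y|lborel. jump_kernel s y * envelope s x y) \<le> M * tail_weight s x"
    using jump_kernel_envelope[OF s, where 'a='a] by auto
  have le: "?w (x + y) + ?w (x - y) - 2 * ?w x \<le> (K1 + 1) * envelope s x y" for x y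
  proof (cases "norm y \<le> 1")
    case True
    have "?w (x + y) + ?w (x - y) - 2 * ?w x \<le> K1 * (norm y)\<^sup>2 * ?w x"
      using weight_second_difference[OF p True, of x] by (simp add: K1_def)
    also have "\<dots> \<le> (K1 + 1) * (norm y)\<^sup>2 * ?w x" by (intro mult_right_mono) auto
    also have "\<dots> = (K1 + 1) * envelope s x y"
      using True by (simp add: envelope_def p_def min_absorb2 power_le_one)
    finally show ?thesis .
  next
    case False
    have "?w (x + y) + ?w (x - y) - 2 * ?w x \<le> 1 * envelope s x y"
      using False by (simp add: envelope_def p_def add_increasing)
    also have "\<dots> \<le> (K1 + 1) * envelope s x y" using K1 by (intro mult_right_mono) auto
    finally show ?thesis .
  qed
  have "(LINT y|lborel. trunc_kernel s \<epsilon> y * ?w (x + y)) \<le> (trunc_symbol s \<epsilon> (0::'a) + (K1 + 1) * M) * ?w x"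
    if \<epsilon>: "0 < \<epsilon>" "\<epsilon> \<le> 1" for \<epsilon> x
  proof -
    have w1: "\<bar>?w z\<bar> \<le> 1" for z using weight_le_one[OF p, of z] by simp
    have i1: "integrable lborel (\<lambda>y. trunc_kernel s \<epsilon> y * ?w (x + y))"
      and i2: "integrable lborel (\<lambda>y. trunc_kernel s \<epsilon> y * ?w (x - y))"
      by (intro integrable_trunc_kernel_mult[OF s \<epsilon>, where B = 1] w1; measurable)+
    have i3: "integrable lborel (\<lambda>y. trunc_kernel s \<epsilon> y * (2 * ?w x))"
      by (intro integrable_mult_left integrable_trunc_kernel[OF s \<epsilon>])
    have sym: "(LINT y|lborel. trunc_kernel s \<epsilon> y * ?w (x - y)) = (LINT y|lborel. trunc_kernel s \<epsilon> y * ?w (x + y))"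
      using integral_lborel_minus[of "\<lambda>y. trunc_kernel s \<epsilon> y * ?w (x + y)"] by simp
    have "2 * (LINT y|lborel. trunc_kernel s \<epsilon> y * ?w (x + y)) - 2 * trunc_symbol s \<epsilon> (0::'a) * ?w x
        = (LINT y|lborel. trunc_kernel s \<epsilon> y * ?w (x + y) + trunc_kernel s \<epsilon> y * ?w (x - y) - trunc_kernel s \<epsilon> y * (2 * ?w x))"
    proof -
      have "has_bochner_integral lborel
          (\<lambda>y. trunc_kernel s \<epsilon> y * ?w (x + y) + trunc_kernel s \<epsilon> y * ?w (x - y) - trunc_kernel s \<epsilon> y * (2 * ?w x))
          ((LINT y|lborel. trunc_kernel s \<epsilon> y * ?w (x + y)) + (LINT y|lborel. trunc_kernel s \<epsilon> y * ?w (x + y)) - trunc_symbol s \<epsilon> (0::'a) * (2 * ?w x))"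
        using i1 i2 i3 unfolding trunc_symbol_def sym[symmetric]
        by (intro has_bochner_integral_diff has_bochner_integral_add) (auto simp: has_bochner_integral_iff sym)
      from has_bochner_integral_integral_eq[OF this] show ?thesis by simp
    qed
    also have "\<dots> \<le> (LINT y|lborel. (K1 + 1) * (jump_kernel s y * envelope s x y))"
    proof (intro integral_mono)
      fix y :: 'a
      have "trunc_kernel s \<epsilon> y * (?w (x + y) + ?w (x - y) - 2 * ?w x) \<le> trunc_kernel s \<epsilon> y * ((K1 + 1) * envelope s x y)"
        using s by (intro mult_left_mono le) auto
      also have "\<dots> \<le> jump_kernel s y * ((K1 + 1) * envelope s x y)"
        using K1 by (intro mult_right_mono trunc_kernel_le[OF s]) auto
      finally show "trunc_kernel s \<epsilon> y * ?w (x + y) + trunc_kernel s \<epsilon> y * ?w (x - y) - trunc_kernel s \<epsilon> y * (2 * ?w x)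
        \<le> (K1 + 1) * (jump_kernel s y * envelope s x y)" by (simp add: algebra_simps)
    qed (use i1 i2 i3 M(2) in auto)
    also have "\<dots> \<le> (K1 + 1) * (M * ?w x)" using M(3)[of x] K1 by (simp add: p_def mult_left_mono)
    finally have "2 * (LINT y|lborel. trunc_kernel s \<epsilon> y * ?w (x + y)) \<le> 2 * trunc_symbol s \<epsilon> (0::'a) * ?w x + (K1 + 1) * (M * ?w x)" by simp
    moreover have "(K1 + 1) * (M * ?w x) \<ge> 0" using K1 M by simp
    ultimately show ?thesis by (simp add: algebra_simps)
  qed
  thus ?thesis using K1 M(1) unfolding p_def by (intro exI[of _ "(K1 + 1) * M"]) auto
qed

lemma lborel_integral_swap:
  fixes A :: "'a::euclidean_space \<Rightarrow> real" and B :: "'b::euclidean_space \<Rightarrow> real"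
  assumes A: "integrable lborel A" and B: "integrable lborel B"
    and f [measurable]: "(\<lambda>(x, y). f x y) \<in> borel_measurable (lborel \<Otimes>\<^sub>M lborel)"
    and le: "\<And>x y. \<bar>f x y\<bar> \<le> A x * B y"
  shows "(LINT y|lborel. LINT x|lborel. f x y) = (LINT x|lborel. LINT y|lborel. f x y :: real)"
    and "integrable lborel (\<lambda>x. LINT y|lborel. f x y)"
proof -
  have fx [measurable]: "f x \<in> borel_measurable lborel" for x
    using measurable_compose[OF measurable_Pair1'[of x lborel lborel] f] by simp
  have ix: "integrable lborel (f x)" for x
    by (rule Bochner_Integration.integrable_bound[OF integrable_mult_right[OF B, of "A x"]])
       (auto intro!: AE_I2 order_trans[OF le])
  have "integrable lborel (\<lambda>x. LINT y|lborel. \<bar>f x y\<bar>)"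
  proof (rule Bochner_Integration.integrable_bound)
    show "integrable lborel (\<lambda>x. A x * (LINT y|lborel. B y))" by (intro integrable_mult_left A)
    show "AE x in lborel. norm (LINT y|lborel. \<bar>f x y\<bar>) \<le> norm (A x * (LINT y|lborel. B y))"
    proof (intro AE_I2)
      fix x
      have "(LINT y|lborel. \<bar>f x y\<bar>) \<le> (LINT y|lborel. A x * B y)"
        by (intro integral_mono integrable_abs ix integrable_mult_right B le)
      moreover have "(LINT y|lborel. \<bar>f x y\<bar>) \<ge> 0" by (intro Bochner_Integration.integral_nonneg) auto
      ultimately show "norm (LINT y|lborel. \<bar>f x y\<bar>) \<le> norm (A x * (LINT y|lborel. B y))" by simp
    qed
  qed measurable
  hence I: "integrable (lborel \<Otimes>\<^sub>M lborel) (\<lambda>(x, y). f x y)"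
    using ix by (intro lborel_pair.Fubini_integrable) auto
  show "(LINT y|lborel. LINT x|lborel. f x y) = (LINT x|lborel. LINT y|lborel. f x y)"
    by (rule lborel_pair.Fubini_integral[OF I])
  show "integrable lborel (\<lambda>x. LINT y|lborel. f x y)"
    using lborel_pair.integrable_fst'[OF I] by simp
qed

text \<open>
  The phase \<open>\<theta>\<close> is a function of the frequency. A linear phase translates the wave, and a phase
  shifted by \<open>pi / 2\<close> produces the sine transforms that arise as derivatives.
\<close>

definition wave :: "('a::euclidean_space \<Rightarrow> real) \<Rightarrow> ('a \<Rightarrow> real) \<Rightarrow> 'a \<Rightarrow> real" where
  "wave F \<theta> x = (LINT \<xi>|lborel. F \<xi> * cos (x \<bullet> \<xi> + \<theta> \<xi>))"

lemma integrable_mult_bounded: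
  fixes f g :: "'a::euclidean_space \<Rightarrow> real"
  assumes f: "integrable lborel f" and [measurable]: "g \<in> borel_measurable borel" and g: "\<And>x. \<bar>g x\<bar> \<le> B"
  shows "integrable lborel (\<lambda>x. f x * g x)"
proof (rule Bochner_Integration.integrable_bound[OF integrable_mult_right[OF f, of B]])
  show "AE x in lborel. norm (f x * g x) \<le> norm (B * f x)"
  proof (intro AE_I2)
    fix x
    have "\<bar>f x\<bar> * \<bar>g x\<bar> \<le> \<bar>f x\<bar> * \<bar>B\<bar>" using g[of x] by (intro mult_left_mono) auto
    thus "norm (f x * g x) \<le> norm (B * f x)" by (simp add: abs_mult mult.commute)
  qed
qed (use f in measurable)

lemma integrable_wave:
  assumes "integrable lborel F" and [measurable]: "\<theta> \<in> borel_measurable borel"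
  shows "integrable lborel (\<lambda>\<xi>. F \<xi> * cos (x \<bullet> \<xi> + \<theta> \<xi>))"
  by (rule integrable_mult_bounded[OF assms(1), of _ 1]) auto

lemma wave_abs_le:
  assumes F: "integrable lborel F" and \<theta>: "\<theta> \<in> borel_measurable borel"
  shows "\<bar>wave F \<theta> x\<bar> \<le> (LINT \<xi>|lborel. \<bar>F \<xi>\<bar>)"
proof -
  have "norm (wave F \<theta> x) \<le> (LINT \<xi>|lborel. norm (F \<xi> * cos (x \<bullet> \<xi> + \<theta> \<xi>)))"
    unfolding wave_def by (rule integral_norm_bound)
  also have "\<dots> \<le> (LINT \<xi>|lborel. \<bar>F \<xi>\<bar>)"
    by (intro integral_mono integrable_norm integrable_wave[OF F \<theta>] integrable_abs F) (auto simp: abs_mult mult_left_le)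
  finally show ?thesis by simp
qed

text \<open>
  Convolution with an even kernel multiplies the symbol by the cosine transform of the kernel: in the
  addition formula for \<open>cos ((x + y) \<bullet> \<xi> + \<theta> \<xi>)\<close> the sine term is odd in y and drops out.
\<close>

lemma wave_trunc_symbol:
  fixes F \<theta> :: "'a::euclidean_space \<Rightarrow> real"
  assumes s: "0 < s" "s < 1" and \<epsilon>: "0 < \<epsilon>" "\<epsilon> \<le> 1"
    and F: "integrable lborel F" and \<theta> [measurable]: "\<theta> \<in> borel_measurable borel"
  shows "wave (\<lambda>\<xi>. F \<xi> * trunc_symbol s \<epsilon> \<xi>) \<theta> x = (LINT y|lborel. trunc_kernel s \<epsilon> y * wave F \<theta> (x + y))"
proof -
  have [measurable]: "F \<in> borel_measurable borel" using F by auto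
  have inner: "(LINT y|lborel. trunc_kernel s \<epsilon> y * (F \<xi> * cos ((x + y) \<bullet> \<xi> + \<theta> \<xi>))) = F \<xi> * trunc_symbol s \<epsilon> \<xi> * cos (x \<bullet> \<xi> + \<theta> \<xi>)" for \<xi>
  proof -
    have ic: "integrable lborel (\<lambda>y. trunc_kernel s \<epsilon> y * cos (\<xi> \<bullet> y))"
      and isn: "integrable lborel (\<lambda>y. trunc_kernel s \<epsilon> y * sin (\<xi> \<bullet> y))"
      by (rule integrable_trunc_kernel_mult[OF s \<epsilon>, where B = 1]; simp)+
    have s0: "(LINT y|lborel. trunc_kernel s \<epsilon> y * sin (\<xi> \<bullet> y)) = 0"
      using integral_lborel_minus[of "\<lambda>y. trunc_kernel s \<epsilon> y * sin (\<xi> \<bullet> y)"] by simp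
    have "trunc_kernel s \<epsilon> y * (F \<xi> * cos ((x + y) \<bullet> \<xi> + \<theta> \<xi>))
       = (F \<xi> * cos (x \<bullet> \<xi> + \<theta> \<xi>)) * (trunc_kernel s \<epsilon> y * cos (\<xi> \<bullet> y)) - (F \<xi> * sin (x \<bullet> \<xi> + \<theta> \<xi>)) * (trunc_kernel s \<epsilon> y * sin (\<xi> \<bullet> y))" for y
    proof -
      have "(x + y) \<bullet> \<xi> + \<theta> \<xi> = (x \<bullet> \<xi> + \<theta> \<xi>) + \<xi> \<bullet> y" by (simp add: inner_add_left inner_commute[of \<xi> y])
      thus ?thesis by (simp only: cos_add) (simp add: algebra_simps)
    qed
    thus ?thesis using ic isn by (simp add: s0 trunc_symbol_def)
  qed
  have "(LINT \<xi>|lborel. LINT y|lborel. trunc_kernel s \<epsilon> y * (F \<xi> * cos ((x + y) \<bullet> \<xi> + \<theta> \<xi>)))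
      = (LINT y|lborel. LINT \<xi>|lborel. trunc_kernel s \<epsilon> y * (F \<xi> * cos ((x + y) \<bullet> \<xi> + \<theta> \<xi>)))"
  proof (rule lborel_integral_swap(1)[OF integrable_trunc_kernel[OF s \<epsilon>] integrable_abs[OF F]])
    fix y \<xi> :: 'a
    have "trunc_kernel s \<epsilon> y * (\<bar>F \<xi>\<bar> * \<bar>cos ((x + y) \<bullet> \<xi> + \<theta> \<xi>)\<bar>) \<le> trunc_kernel s \<epsilon> y * (\<bar>F \<xi>\<bar> * 1)"
      using s by (intro mult_left_mono) auto
    thus "\<bar>trunc_kernel s \<epsilon> y * (F \<xi> * cos ((x + y) \<bullet> \<xi> + \<theta> \<xi>))\<bar> \<le> trunc_kernel s \<epsilon> y * \<bar>F \<xi>\<bar>"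
      using s by (simp add: abs_mult)
  qed measurable
  thus ?thesis unfolding inner by (simp add: wave_def)
qed

text \<open>
  Convolution with a nonnegative kernel preserves upper bounds, and each convolution costs the factor
  from \<open>trunc_kernel_weight\<close>.
\<close>

lemma wave_trunc_symbol_power_le:
  fixes F \<theta> :: "'a::euclidean_space \<Rightarrow> real"
  assumes s: "0 < s" "s < 1" and \<epsilon>: "0 < \<epsilon>" "\<epsilon> \<le> 1"
    and F: "integrable lborel F" and \<theta> [measurable]: "\<theta> \<in> borel_measurable borel"
    and M: "M \<ge> 0" and le: "\<And>x. wave F \<theta> x \<le> M * tail_weight s x"
    and K: "K \<ge> 0" "\<And>x::'a. (LINT y|lborel. trunc_kernel s \<epsilon> y * tail_weight s (x + y)) \<le> (trunc_symbol s \<epsilon> (0::'a) + K) * tail_weight s x"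
  shows "wave (\<lambda>\<xi>. F \<xi> * trunc_symbol s \<epsilon> \<xi> ^ j) \<theta> x \<le> M * (trunc_symbol s \<epsilon> (0::'a) + K) ^ j * tail_weight s x"
    and "integrable lborel (\<lambda>\<xi>. F \<xi> * trunc_symbol s \<epsilon> \<xi> ^ j)"
proof -
  let ?L = "trunc_symbol s \<epsilon> (0::'a)"
  have [measurable]: "F \<in> borel_measurable borel" using F by auto
  have L: "?L \<ge> 0" using trunc_symbol_bound[OF s \<epsilon>, of "0::'a"] by linarith
  have int: "integrable lborel (\<lambda>\<xi>. F \<xi> * trunc_symbol s \<epsilon> \<xi> ^ j)" for j
    using trunc_symbol_bound[OF s \<epsilon>, where 'a='a] L
    by (intro integrable_mult_bounded[OF F, of _ "?L ^ j"]) (auto simp: power_abs intro!: power_mono)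
  show "integrable lborel (\<lambda>\<xi>. F \<xi> * trunc_symbol s \<epsilon> \<xi> ^ j)" by (rule int)
  show "wave (\<lambda>\<xi>. F \<xi> * trunc_symbol s \<epsilon> \<xi> ^ j) \<theta> x \<le> M * (?L + K) ^ j * tail_weight s x"
  proof (induction j arbitrary: x)
    case 0
    show ?case using le by simp
  next
    case (Suc j)
    have p: "real DIM('a) + 2 * s \<ge> 0" using s by simp
    have [measurable]: "(\<lambda>y. wave (\<lambda>\<xi>. F \<xi> * trunc_symbol s \<epsilon> \<xi> ^ j) \<theta> (x + y)) \<in> borel_measurable borel"
      unfolding wave_def by measurable
    have "wave (\<lambda>\<xi>. F \<xi> * trunc_symbol s \<epsilon> \<xi> ^ Suc j) \<theta> x
       = wave (\<lambda>\<xi>. (F \<xi> * trunc_symbol s \<epsilon> \<xi> ^ j) * trunc_symbol s \<epsilon> \<xi>) \<theta> x" by (simp add: mult_ac)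
    also have "\<dots> = (LINT y|lborel. trunc_kernel s \<epsilon> y * wave (\<lambda>\<xi>. F \<xi> * trunc_symbol s \<epsilon> \<xi> ^ j) \<theta> (x + y))"
      by (rule wave_trunc_symbol[OF s \<epsilon> int \<theta>])
    also have "\<dots> \<le> (LINT y|lborel. (M * (?L + K) ^ j) * (trunc_kernel s \<epsilon> y * tail_weight s (x + y)))"
    proof (rule integral_mono)
      show "integrable lborel (\<lambda>y. trunc_kernel s \<epsilon> y * wave (\<lambda>\<xi>. F \<xi> * trunc_symbol s \<epsilon> \<xi> ^ j) \<theta> (x + y))"
        using wave_abs_le[OF int \<theta>] by (intro integrable_trunc_kernel_mult[OF s \<epsilon>]) auto
      show "integrable lborel (\<lambda>y. (M * (?L + K) ^ j) * (trunc_kernel s \<epsilon> y * tail_weight s (x + y)))"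
        using weight_le_one[OF p] by (intro integrable_mult_right integrable_trunc_kernel_mult[OF s \<epsilon>, where B = 1]) auto
      show "trunc_kernel s \<epsilon> y * wave (\<lambda>\<xi>. F \<xi> * trunc_symbol s \<epsilon> \<xi> ^ j) \<theta> (x + y)
         \<le> (M * (?L + K) ^ j) * (trunc_kernel s \<epsilon> y * tail_weight s (x + y))" for y
        using mult_left_mono[OF Suc.IH[of "x + y"] trunc_kernel_nonneg[OF s]] by (simp add: mult_ac)
    qed
    also have "\<dots> \<le> (M * (?L + K) ^ j) * ((?L + K) * tail_weight s x)"
      using M K L by (simp only: integral_mult_right_zero) (intro mult_left_mono K(2); simp)
    finally show ?case by (simp add: mult_ac)
  qed
qed

text \<open>
  The fractional heat flow preserves upper bounds by the weight. For the truncated kernel with mass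
  \<open>L\<close>, the flow multiplies the symbol by \<open>exp (-t L)\<close> times the exponential series of t times the
  truncated symbol. Its j-th term is bounded by \<open>wave_trunc_symbol_power_le\<close>, and the sum of
  these bounds is \<open>M * exp (-t L) * exp (t (L + K)) = M * exp (K t)\<close>, in which the diverging mass has
  cancelled. The bound is one-sided, so that \<open>M = 0\<close> is a statement about signs.
\<close>

lemma wave_evolution_le:
  assumes s: "0 < s" "s < 1"
  shows "\<exists>K>0. \<forall>F \<theta> M t. integrable lborel F \<longrightarrow> \<theta> \<in> borel_measurable borel \<longrightarrow> M \<ge> 0 \<longrightarrow> t \<ge> 0 \<longrightarrow>
    (\<forall>x. wave F \<theta> x \<le> M * tail_weight s (x::'a::euclidean_space)) \<longrightarrow>
    (\<forall>x. wave (\<lambda>\<xi>. F \<xi> * exp (- t * norm \<xi> powr (2 * s))) \<theta> x \<le> M * exp (K * t) * tail_weight s x)"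
proof -
  obtain K where K: "K > 0" "\<And>\<epsilon> x. 0 < \<epsilon> \<Longrightarrow> \<epsilon> \<le> 1 \<Longrightarrow>
     (LINT y|lborel. trunc_kernel s \<epsilon> y * tail_weight s (x + y)) \<le> (trunc_symbol s \<epsilon> (0::'a) + K) * tail_weight s (x::'a)"
    using trunc_kernel_weight[OF s, where 'a='a] by blast
  have main: "wave (\<lambda>\<xi>. F \<xi> * exp (- t * norm \<xi> powr (2 * s))) \<theta> x \<le> M * exp (K * t) * tail_weight s x"
    if F: "integrable lborel F" and \<theta> [measurable]: "\<theta> \<in> borel_measurable borel" and M: "M \<ge> 0" and t: "t \<ge> 0"
      and le: "\<And>x. wave F \<theta> x \<le> M * tail_weight s x" for F \<theta> :: "'a \<Rightarrow> real" and M t x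
  proof -
    have [measurable]: "F \<in> borel_measurable borel" using F by auto
    have trunc: "wave (\<lambda>\<xi>. F \<xi> * exp (- t * (trunc_symbol s \<epsilon> (0::'a) - trunc_symbol s \<epsilon> \<xi>))) \<theta> x \<le> M * exp (K * t) * tail_weight s x"
      if \<epsilon>: "0 < \<epsilon>" "\<epsilon> \<le> 1" for \<epsilon>
    proof -
      let ?L = "trunc_symbol s \<epsilon> (0::'a)"
      have L: "?L \<ge> 0" using trunc_symbol_bound[OF s \<epsilon>, of "0::'a"] by linarith
      define a where "a = (\<lambda>j \<xi>. (t ^ j / fact j) * (F \<xi> * trunc_symbol s \<epsilon> \<xi> ^ j * cos (x \<bullet> \<xi> + \<theta> \<xi>)))"
      have pw: "wave (\<lambda>\<xi>. F \<xi> * trunc_symbol s \<epsilon> \<xi> ^ j) \<theta> x \<le> M * (?L + K) ^ j * tail_weight s x"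
        "integrable lborel (\<lambda>\<xi>. F \<xi> * trunc_symbol s \<epsilon> \<xi> ^ j)" for j
        using wave_trunc_symbol_power_le[OF s \<epsilon> F \<theta> M le less_imp_le[OF K(1)] K(2)[OF \<epsilon>]] by auto
      have ia: "integrable lborel (a j)" for j
        unfolding a_def by (intro integrable_mult_right integrable_wave pw(2) \<theta>)
      have inta: "integral\<^sup>L lborel (a j) = (t ^ j / fact j) * wave (\<lambda>\<xi>. F \<xi> * trunc_symbol s \<epsilon> \<xi> ^ j) \<theta> x" for j
        unfolding a_def wave_def by simp
      have na: "norm (a j \<xi>) \<le> ((t * ?L) ^ j / fact j) * \<bar>F \<xi>\<bar>" for j \<xi>
      proof -
        have "\<bar>trunc_symbol s \<epsilon> \<xi>\<bar> ^ j * \<bar>cos (x \<bullet> \<xi> + \<theta> \<xi>)\<bar> \<le> ?L ^ j * 1"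
          using trunc_symbol_bound[OF s \<epsilon>, of \<xi>] L by (intro mult_mono power_mono) auto
        hence "(t ^ j / fact j * \<bar>F \<xi>\<bar>) * (\<bar>trunc_symbol s \<epsilon> \<xi>\<bar> ^ j * \<bar>cos (x \<bullet> \<xi> + \<theta> \<xi>)\<bar>) \<le> (t ^ j / fact j * \<bar>F \<xi>\<bar>) * (?L ^ j * 1)"
          using t by (intro mult_left_mono) auto
        thus ?thesis using t by (simp add: a_def abs_mult power_abs power_mult_distrib mult_ac)
      qed
      have se: "summable (\<lambda>j. z ^ j / fact j)" for z :: real
        using summable_exp[of z] by (simp add: field_simps)
      have sa: "a j \<xi> = (F \<xi> * cos (x \<bullet> \<xi> + \<theta> \<xi>)) * ((t * trunc_symbol s \<epsilon> \<xi>) ^ j /\<^sub>R fact j)" for j \<xi>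
        by (simp add: a_def power_mult_distrib field_simps)
      have suma: "(\<lambda>j. a j \<xi>) sums (F \<xi> * cos (x \<bullet> \<xi> + \<theta> \<xi>) * exp (t * trunc_symbol s \<epsilon> \<xi>))" for \<xi>
        unfolding sa by (intro sums_mult exp_converges)
      have S: "(\<lambda>j. integral\<^sup>L lborel (a j)) sums (LINT \<xi>|lborel. (\<Sum>j. a j \<xi>))"
      proof (rule sums_integral[OF ia])
        show "AE \<xi> in lborel. summable (\<lambda>j. norm (a j \<xi>))"
          by (intro AE_I2 summable_comparison_test'[OF summable_mult2[OF se]]) (use na in auto)
        show "summable (\<lambda>j. LINT \<xi>|lborel. norm (a j \<xi>))"
        proof (rule summable_comparison_test'[OF summable_mult2[OF se[of "t * ?L"], of "LINT \<xi>|lborel. \<bar>F \<xi>\<bar>"]])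
          fix j :: nat
          have "(LINT \<xi>|lborel. norm (a j \<xi>)) \<le> (LINT \<xi>|lborel. ((t * ?L) ^ j / fact j) * \<bar>F \<xi>\<bar>)"
            by (intro integral_mono integrable_norm ia integrable_mult_right integrable_abs F na)
          thus "norm (LINT \<xi>|lborel. norm (a j \<xi>)) \<le> (t * ?L) ^ j / fact j * (LINT \<xi>|lborel. \<bar>F \<xi>\<bar>)"
            by (subst real_norm_def, subst abs_of_nonneg) (auto intro!: Bochner_Integration.integral_nonneg)
        qed
      qed
      have e: "wave (\<lambda>\<xi>. F \<xi> * exp (- t * (?L - trunc_symbol s \<epsilon> \<xi>))) \<theta> x = exp (- t * ?L) * (LINT \<xi>|lborel. (\<Sum>j. a j \<xi>))"
      proof -
        have "exp (- t * (?L - z)) = exp (- t * ?L) * exp (t * z)" for z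
          by (simp flip: exp_add add: algebra_simps)
        hence "F \<xi> * exp (- t * (?L - trunc_symbol s \<epsilon> \<xi>)) * cos (x \<bullet> \<xi> + \<theta> \<xi>) = exp (- t * ?L) * (\<Sum>j. a j \<xi>)" for \<xi>
          unfolding sums_unique[OF suma, symmetric] by (simp add: mult_ac)
        thus ?thesis unfolding wave_def by simp
      qed
      have S2: "(\<lambda>j. M * tail_weight s x * ((t * (?L + K)) ^ j /\<^sub>R fact j)) sums (M * tail_weight s x * exp (t * (?L + K)))"
        by (intro sums_mult exp_converges)
      have "(LINT \<xi>|lborel. (\<Sum>j. a j \<xi>)) \<le> M * tail_weight s x * exp (t * (?L + K))"
      proof (rule sums_le[OF _ S S2])
        fix j
        have "(t ^ j / fact j) * wave (\<lambda>\<xi>. F \<xi> * trunc_symbol s \<epsilon> \<xi> ^ j) \<theta> x \<le> (t ^ j / fact j) * (M * (?L + K) ^ j * tail_weight s x)"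
          using t by (intro mult_left_mono pw(1)) auto
        thus "integral\<^sup>L lborel (a j) \<le> M * tail_weight s x * ((t * (?L + K)) ^ j /\<^sub>R fact j)"
          unfolding inta by (simp add: power_mult_distrib divide_inverse mult_ac)
      qed
      hence "exp (- t * ?L) * (LINT \<xi>|lborel. (\<Sum>j. a j \<xi>)) \<le> exp (- t * ?L) * (M * tail_weight s x * exp (t * (?L + K)))"
        by (intro mult_left_mono) auto
      also have "\<dots> = M * exp (K * t) * tail_weight s x"
      proof -
        have "exp (- t * ?L) * exp (t * (?L + K)) = exp (K * t)" by (simp flip: exp_add add: algebra_simps)
        moreover have "exp (- t * ?L) * (M * tail_weight s x * exp (t * (?L + K))) = M * (exp (- t * ?L) * exp (t * (?L + K))) * tail_weight s x"
          by (simp only: mult_ac)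
        ultimately show ?thesis by (simp only:)
      qed
      finally show ?thesis unfolding e .
    qed
    have "(\<lambda>j. wave (\<lambda>\<xi>. F \<xi> * exp (- t * (trunc_symbol s (1 / Suc j) (0::'a) - trunc_symbol s (1 / Suc j) \<xi>))) \<theta> x)
       \<longlonglongrightarrow> wave (\<lambda>\<xi>. F \<xi> * exp (- t * norm \<xi> powr (2 * s))) \<theta> x"
      unfolding wave_def
    proof (rule integral_dominated_convergence[where w = "\<lambda>\<xi>. \<bar>F \<xi>\<bar>"])
      show "AE \<xi> in lborel. (\<lambda>j. F \<xi> * exp (- t * (trunc_symbol s (1 / Suc j) (0::'a) - trunc_symbol s (1 / Suc j) \<xi>)) * cos (x \<bullet> \<xi> + \<theta> \<xi>))
          \<longlonglongrightarrow> F \<xi> * exp (- t * norm \<xi> powr (2 * s)) * cos (x \<bullet> \<xi> + \<theta> \<xi>)"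
        by (intro AE_I2 tendsto_intros trunc_symbol_tendsto[OF s])
      fix j :: nat
      show "AE \<xi> in lborel. norm (F \<xi> * exp (- t * (trunc_symbol s (1 / Suc j) (0::'a) - trunc_symbol s (1 / Suc j) \<xi>)) * cos (x \<bullet> \<xi> + \<theta> \<xi>)) \<le> \<bar>F \<xi>\<bar>"
      proof (intro AE_I2)
        fix \<xi> :: 'a
        have "\<bar>trunc_symbol s (1 / Suc j) \<xi>\<bar> \<le> trunc_symbol s (1 / Suc j) (0::'a)"
          by (intro trunc_symbol_bound[OF s]) auto
        hence "t * (trunc_symbol s (1 / Suc j) (0::'a) - trunc_symbol s (1 / Suc j) \<xi>) \<ge> 0" using t by (intro mult_nonneg_nonneg) auto
        hence "exp (- t * (trunc_symbol s (1 / Suc j) (0::'a) - trunc_symbol s (1 / Suc j) \<xi>)) * \<bar>cos (x \<bullet> \<xi> + \<theta> \<xi>)\<bar> \<le> 1 * 1"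
          by (intro mult_mono) auto
        hence "\<bar>F \<xi>\<bar> * (exp (- t * (trunc_symbol s (1 / Suc j) (0::'a) - trunc_symbol s (1 / Suc j) \<xi>)) * \<bar>cos (x \<bullet> \<xi> + \<theta> \<xi>)\<bar>) \<le> \<bar>F \<xi>\<bar> * (1 * 1)"
          by (intro mult_left_mono) auto
        thus "norm (F \<xi> * exp (- t * (trunc_symbol s (1 / Suc j) (0::'a) - trunc_symbol s (1 / Suc j) \<xi>)) * cos (x \<bullet> \<xi> + \<theta> \<xi>)) \<le> \<bar>F \<xi>\<bar>"
          by (simp add: abs_mult mult.assoc)
      qed
    qed (use F in auto)
    moreover have "wave (\<lambda>\<xi>. F \<xi> * exp (- t * (trunc_symbol s (1 / Suc j) (0::'a) - trunc_symbol s (1 / Suc j) \<xi>))) \<theta> x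
        \<le> M * exp (K * t) * tail_weight s x" for j by (rule trunc) auto
    ultimately show ?thesis by (intro LIMSEQ_le_const2) auto
  qed
  show ?thesis using main K(1) by blast
qed

section \<open>Smoothness of cosine transforms\<close>

lemma cos_first_order:
  fixes a h :: real
  shows "\<bar>cos (a + h) - cos a - h * cos (a + pi / 2)\<bar> \<le> h\<^sup>2"
proof -
  have "cmod (iexp a * (iexp h - (1 + \<i> * h))) \<le> h\<^sup>2 / 2"
    using iexp_approx1[of h 1] by (simp add: norm_mult numeral_2_eq_2)
  hence "\<bar>Re (iexp a * (iexp h - (1 + \<i> * h)))\<bar> \<le> h\<^sup>2 / 2"
    by (rule order_trans[OF abs_Re_le_cmod])
  moreover have "Re (iexp a * (iexp h - (1 + \<i> * h))) = cos (a + h) - cos a - h * cos (a + pi / 2)"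
    by (simp add: Re_exp Im_exp cos_add algebra_simps)
  ultimately have "\<bar>cos (a + h) - cos a - h * cos (a + pi / 2)\<bar> \<le> h\<^sup>2 / 2" by (simp only:)
  thus ?thesis using zero_le_power2[of h] by linarith
qed

text \<open>
  Finiteness of all moments makes every derivative of the corresponding wave a wave again.
\<close>

definition rapid :: "('a::euclidean_space \<Rightarrow> real) \<Rightarrow> bool" where
  "rapid F \<longleftrightarrow> F \<in> borel_measurable borel \<and> (\<forall>k. integrable lborel (\<lambda>\<xi>. norm \<xi> ^ k * F \<xi>))"

lemma rapid_integrable:
  assumes "rapid F" shows "integrable lborel F"
proof -
  have "integrable lborel (\<lambda>\<xi>. norm \<xi> ^ 0 * F \<xi>)" using assms unfolding rapid_def by blast
  thus ?thesis by simp
qed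

lemma rapid_mult_le:
  assumes F: "rapid F" and [measurable]: "g \<in> borel_measurable borel" and g: "\<And>\<xi>. \<bar>g \<xi>\<bar> \<le> B * norm \<xi> ^ m"
  shows "rapid (\<lambda>\<xi>. F \<xi> * g \<xi>)"
  unfolding rapid_def
proof safe
  have [measurable]: "F \<in> borel_measurable borel" using F by (simp add: rapid_def)
  show "(\<lambda>\<xi>. F \<xi> * g \<xi>) \<in> borel_measurable borel" by measurable
  fix k
  have "integrable lborel (\<lambda>\<xi>. B * (norm \<xi> ^ (k + m) * F \<xi>))"
    using F by (intro integrable_mult_right) (simp add: rapid_def)
  thus "integrable lborel (\<lambda>\<xi>. norm \<xi> ^ k * (F \<xi> * g \<xi>))"
  proof (rule Bochner_Integration.integrable_bound)
    show "AE \<xi> in lborel. norm (norm \<xi> ^ k * (F \<xi> * g \<xi>)) \<le> norm (B * (norm \<xi> ^ (k + m) * F \<xi>))"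
    proof (intro AE_I2)
      fix \<xi>
      have "(norm \<xi> ^ k * \<bar>F \<xi>\<bar>) * \<bar>g \<xi>\<bar> \<le> (norm \<xi> ^ k * \<bar>F \<xi>\<bar>) * \<bar>B * norm \<xi> ^ m\<bar>"
        by (intro mult_left_mono order_trans[OF g]) auto
      thus "norm (norm \<xi> ^ k * (F \<xi> * g \<xi>)) \<le> norm (B * (norm \<xi> ^ (k + m) * F \<xi>))"
        by (simp add: abs_mult power_add mult_ac)
    qed
  qed measurable
qed

lemma rapid_inner: "rapid F \<Longrightarrow> rapid (\<lambda>\<xi>. F \<xi> * (y \<bullet> \<xi>))"
  by (rule rapid_mult_le[where B = "norm y" and m = 1]) (auto intro: Cauchy_Schwarz_ineq2)

lemma rapid_gaussian:
  assumes "a > 0" shows "rapid (\<lambda>\<xi>::'a::euclidean_space. exp (- a * (norm \<xi>)\<^sup>2))"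
  unfolding rapid_def using integrable_norm_power_gaussian[OF assms] by auto

lemma rapid_cmult: "rapid F \<Longrightarrow> rapid (\<lambda>\<xi>. c * F \<xi>)"
  using rapid_mult_le[of F "\<lambda>_. c" "\<bar>c\<bar>" 0] by (simp add: mult.commute)

text \<open>
  The derivatives of a wave: each differentiation along a vector multiplies the symbol by the inner
  product with that vector and advances the phase by a quarter turn.
\<close>

abbreviation wave_D :: "('a::euclidean_space \<Rightarrow> real) \<Rightarrow> ('a \<Rightarrow> real) \<Rightarrow> 'a \<Rightarrow> 'a \<Rightarrow> real" where
  "wave_D F \<theta> y \<equiv> wave (\<lambda>\<xi>. F \<xi> * (y \<bullet> \<xi>)) (\<lambda>\<xi>. \<theta> \<xi> + pi / 2)"

abbreviation wave_D2 :: "('a::euclidean_space \<Rightarrow> real) \<Rightarrow> ('a \<Rightarrow> real) \<Rightarrow> 'a \<Rightarrow> 'a \<Rightarrow> 'a \<Rightarrow> real" where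
  "wave_D2 F \<theta> y z \<equiv> wave (\<lambda>\<xi>. F \<xi> * (y \<bullet> \<xi>) * (z \<bullet> \<xi>)) (\<lambda>\<xi>. \<theta> \<xi> + pi / 2 + pi / 2)"

text \<open>
  The first-order remainder of the cosine is at most the square of the increment, and the second
  moment of the symbol is finite; this gives a remainder of order \<open>\<bar>y\<bar>\<^sup>2\<close> for the wave.
\<close>

lemma wave_has_derivative:
  fixes F \<theta> :: "'a::euclidean_space \<Rightarrow> real"
  assumes F: "rapid F" and \<theta> [measurable]: "\<theta> \<in> borel_measurable borel"
  shows "(wave F \<theta> has_derivative (\<lambda>y. wave (\<lambda>\<xi>. F \<xi> * (y \<bullet> \<xi>)) (\<lambda>\<xi>. \<theta> \<xi> + pi / 2) x)) (at x)"
proof -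
  have [measurable]: "F \<in> borel_measurable borel" using F by (simp add: rapid_def)
  let ?D = "\<lambda>y. wave (\<lambda>\<xi>. F \<xi> * (y \<bullet> \<xi>)) (\<lambda>\<xi>. \<theta> \<xi> + pi / 2) x"
  have iD: "integrable lborel (\<lambda>\<xi>. F \<xi> * (y \<bullet> \<xi>) * cos (x \<bullet> \<xi> + (\<theta> \<xi> + pi / 2)))" for y
    by (intro integrable_wave rapid_integrable rapid_inner F) measurable
  have i2: "integrable lborel (\<lambda>\<xi>. norm \<xi> ^ 2 * \<bar>F \<xi>\<bar>)"
  proof -
    have "integrable lborel (\<lambda>\<xi>. \<bar>norm \<xi> ^ 2 * F \<xi>\<bar>)"
      using F unfolding rapid_def by (intro integrable_abs) simp
    thus ?thesis by (simp add: abs_mult)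
  qed
  have i1: "integrable lborel (\<lambda>\<xi>. norm \<xi> * \<bar>F \<xi>\<bar>)"
  proof -
    have "integrable lborel (\<lambda>\<xi>. \<bar>norm \<xi> ^ 1 * F \<xi>\<bar>)"
      using F unfolding rapid_def by (intro integrable_abs) (erule conjE, erule allE, assumption)
    thus ?thesis by (simp add: abs_mult)
  qed
  define B where "B = (LINT \<xi>|lborel. norm \<xi> ^ 2 * \<bar>F \<xi>\<bar>)"
  define B1 where "B1 = (LINT \<xi>|lborel. norm \<xi> * \<bar>F \<xi>\<bar>)"
  have lin: "bounded_linear ?D"
  proof (rule bounded_linear_intro[where K = B1])
    show "?D (y + z) = ?D y + ?D z" for y z
      using iD[of y] iD[of z] by (simp add: wave_def inner_add_left distrib_left distrib_right)
    show "?D (r *\<^sub>R y) = r *\<^sub>R ?D y" for r y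
    proof -
      have "?D (r *\<^sub>R y) = (LINT \<xi>|lborel. r * (F \<xi> * (y \<bullet> \<xi>) * cos (x \<bullet> \<xi> + (\<theta> \<xi> + pi / 2))))"
        by (simp add: wave_def mult_ac)
      thus ?thesis by (simp add: wave_def)
    qed
    show "norm (?D y) \<le> norm y * B1" for y
    proof -
      have "norm (?D y) \<le> (LINT \<xi>|lborel. \<bar>F \<xi> * (y \<bullet> \<xi>)\<bar>)"
        unfolding real_norm_def by (intro wave_abs_le rapid_integrable rapid_inner F) measurable
      also have "\<dots> \<le> (LINT \<xi>|lborel. norm y * (norm \<xi> * \<bar>F \<xi>\<bar>))"
      proof (intro integral_mono integrable_abs rapid_integrable[OF rapid_inner[OF F]] integrable_mult_right i1)
        fix \<xi>
        have "\<bar>F \<xi>\<bar> * \<bar>y \<bullet> \<xi>\<bar> \<le> \<bar>F \<xi>\<bar> * (norm y * norm \<xi>)" by (intro mult_left_mono Cauchy_Schwarz_ineq2) auto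
        thus "\<bar>F \<xi> * (y \<bullet> \<xi>)\<bar> \<le> norm y * (norm \<xi> * \<bar>F \<xi>\<bar>)" by (simp add: abs_mult mult_ac)
      qed
      finally show ?thesis by (simp add: B1_def)
    qed
  qed
  have rem: "norm (wave F \<theta> (x + y) - wave F \<theta> x - ?D y) \<le> B * (norm y)\<^sup>2" for y
  proof -
    have iF: "integrable lborel (\<lambda>\<xi>. F \<xi> * cos (z \<bullet> \<xi> + \<theta> \<xi>))" for z
      by (intro integrable_wave rapid_integrable F) measurable
    define G where "G = (\<lambda>\<xi>. F \<xi> * cos ((x + y) \<bullet> \<xi> + \<theta> \<xi>) - F \<xi> * cos (x \<bullet> \<xi> + \<theta> \<xi>) - F \<xi> * (y \<bullet> \<xi>) * cos (x \<bullet> \<xi> + (\<theta> \<xi> + pi / 2)))"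
    have hG: "has_bochner_integral lborel G (wave F \<theta> (x + y) - wave F \<theta> x - ?D y)"
      unfolding G_def wave_def
      by (intro has_bochner_integral_diff has_bochner_integral_integrable iF iD)
    hence iG: "integrable lborel G" and vG: "wave F \<theta> (x + y) - wave F \<theta> x - ?D y = integral\<^sup>L lborel G"
      by (auto simp: has_bochner_integral_iff)
    have "norm (integral\<^sup>L lborel G) \<le> (LINT \<xi>|lborel. norm (G \<xi>))"
      by (rule integral_norm_bound)
    also have "\<dots> \<le> (LINT \<xi>|lborel. (norm y)\<^sup>2 * (norm \<xi> ^ 2 * \<bar>F \<xi>\<bar>))"
    proof (intro integral_mono integrable_norm iG integrable_mult_right i2)
      fix \<xi>
      have "G \<xi> = F \<xi> * (cos ((x \<bullet> \<xi> + \<theta> \<xi>) + y \<bullet> \<xi>) - cos (x \<bullet> \<xi> + \<theta> \<xi>) - (y \<bullet> \<xi>) * cos ((x \<bullet> \<xi> + \<theta> \<xi>) + pi / 2))"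
        by (simp add: G_def inner_add_left algebra_simps)
      hence "norm (G \<xi>) \<le> \<bar>F \<xi>\<bar> * (y \<bullet> \<xi>)\<^sup>2"
        using cos_first_order[of "x \<bullet> \<xi> + \<theta> \<xi>" "y \<bullet> \<xi>"] by (simp add: abs_mult mult_left_mono)
      also have "\<dots> \<le> \<bar>F \<xi>\<bar> * (norm y * norm \<xi>)\<^sup>2"
        using power_mono[OF Cauchy_Schwarz_ineq2[of y \<xi>], of 2] by (intro mult_left_mono) auto
      finally show "norm (G \<xi>) \<le> (norm y)\<^sup>2 * (norm \<xi> ^ 2 * \<bar>F \<xi>\<bar>)"
        by (simp add: power_mult_distrib mult_ac)
    qed
    finally show ?thesis unfolding vG by (simp add: B_def mult.commute)
  qed
  have B0: "B \<ge> 0" unfolding B_def by (intro Bochner_Integration.integral_nonneg) auto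
  show ?thesis unfolding has_derivative_at
  proof (intro conjI lin)
    show "(\<lambda>h. norm (wave F \<theta> (x + h) - wave F \<theta> x - ?D h) / norm h) \<midarrow>0\<rightarrow> 0"
    proof (rule Lim_null_comparison)
      show "\<forall>\<^sub>F h in at 0. norm (norm (wave F \<theta> (x + h) - wave F \<theta> x - ?D h) / norm h) \<le> B * norm h"
      proof (intro always_eventually allI)
        fix h
        show "norm (norm (wave F \<theta> (x + h) - wave F \<theta> x - ?D h) / norm h) \<le> B * norm h"
        proof (cases "h = 0")
          case False
          thus ?thesis using rem[of h] by (simp add: divide_le_eq power2_eq_square mult.assoc)
        qed simp
      qed
      have "(\<lambda>h::'a. B * norm h) \<midarrow>0\<rightarrow> B * norm (0::'a)" by (intro tendsto_intros)
      thus "(\<lambda>h::'a. B * norm h) \<midarrow>0\<rightarrow> 0" by simp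
    qed
  qed
qed

lemma partial_deriv_eq: "(f has_derivative f') (at x) \<Longrightarrow> partial_deriv b f x = f' b"
  by (simp add: partial_deriv_def frechet_derivative_at[symmetric])

lemma wave_partial_deriv:
  assumes "rapid F" "\<theta> \<in> borel_measurable borel"
  shows "partial_deriv b (wave F \<theta>) = wave (\<lambda>\<xi>. F \<xi> * (b \<bullet> \<xi>)) (\<lambda>\<xi>. \<theta> \<xi> + pi / 2)"
proof
  fix x
  show "partial_deriv b (wave F \<theta>) x = wave (\<lambda>\<xi>. F \<xi> * (b \<bullet> \<xi>)) (\<lambda>\<xi>. \<theta> \<xi> + pi / 2) x"
    by (rule partial_deriv_eq[OF wave_has_derivative[OF assms]])
qed

lemma wave_C_k:
  assumes "rapid F" "\<theta> \<in> borel_measurable borel"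
  shows "C_k k (wave F \<theta>)"
  using assms
proof (induction k arbitrary: F \<theta>)
  case 0
  show ?case using wave_has_derivative[OF 0]
    by (auto intro!: continuous_at_imp_continuous_on has_derivative_continuous)
next
  case (Suc k)
  show ?case unfolding C_k.simps(2) wave_partial_deriv[OF Suc.prems]
  proof (intro conjI allI ballI Suc.IH rapid_inner Suc.prems)
    show "wave F \<theta> differentiable (at x)" for x
      using wave_has_derivative[OF Suc.prems] by (rule differentiableI)
  qed (use Suc.prems in measurable)
qed

lemma C_k_Suc_imp: "C_k (Suc k) f \<Longrightarrow> C_k k f"
proof (induction k arbitrary: f)
  case 0
  hence "isCont f x" for x by (simp add: differentiable_imp_continuous_within)
  thus ?case by (simp add: continuous_at_imp_continuous_on)
next
  case (Suc k)
  from Suc.prems have 1: "f differentiable (at x)" for x by (simp only: C_k.simps(2)[of "Suc k"])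
  from Suc.prems have 2: "C_k (Suc k) (partial_deriv b f)" if "b \<in> Basis" for b
    using that by (simp only: C_k.simps(2)[of "Suc k"])
  show ?case unfolding C_k.simps(2)[of k] using 1 Suc.IH[OF 2] by blast
qed

lemma has_derivative_frechet:
  "f differentiable (at x) \<Longrightarrow> (f has_derivative frechet_derivative f (at x)) (at x)"
  by (simp only: frechet_derivative_works)

lemma C_k_add: "C_k k f \<Longrightarrow> C_k k g \<Longrightarrow> C_k k (\<lambda>x. f x + g x)"
proof (induction k arbitrary: f g)
  case 0
  thus ?case by (simp add: continuous_on_add)
next
  case (Suc k)
  have d: "f differentiable (at x)" "g differentiable (at x)" for x using Suc.prems by simp_all
  have p: "partial_deriv b (\<lambda>x. f x + g x) = (\<lambda>x. partial_deriv b f x + partial_deriv b g x)" for b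
  proof
    fix x
    show "partial_deriv b (\<lambda>x. f x + g x) x = partial_deriv b f x + partial_deriv b g x"
      using partial_deriv_eq[OF has_derivative_add[OF d[THEN has_derivative_frechet]]]
      by (simp add: partial_deriv_def)
  qed
  show ?case unfolding C_k.simps(2) p
  proof (intro conjI allI ballI Suc.IH)
    show "(\<lambda>x. f x + g x) differentiable (at x)" for x by (intro differentiable_add d)
  qed (use Suc.prems in simp_all)
qed

lemma partial_deriv_mult:
  assumes "f differentiable (at x)" "g differentiable (at x)"
  shows "partial_deriv b (\<lambda>x. f x * g x) x = f x * partial_deriv b g x + partial_deriv b f x * g x"
  using partial_deriv_eq[OF has_derivative_mult[OF assms[THEN has_derivative_frechet]]]
  by (simp add: partial_deriv_def)

lemma C_k_mult: "C_k k f \<Longrightarrow> C_k k g \<Longrightarrow> C_k k (\<lambda>x. f x * g x)"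
proof (induction k arbitrary: f g)
  case 0
  thus ?case by (simp add: continuous_on_mult)
next
  case (Suc k)
  have d: "f differentiable (at x)" "g differentiable (at x)" for x using Suc.prems by simp_all
  have p: "partial_deriv b (\<lambda>x. f x * g x) = (\<lambda>x. f x * partial_deriv b g x + partial_deriv b f x * g x)" for b
    by (intro ext partial_deriv_mult d)
  show ?case unfolding C_k.simps(2) p
  proof (intro conjI allI ballI C_k_add Suc.IH C_k_Suc_imp[OF Suc.prems(1)] C_k_Suc_imp[OF Suc.prems(2)])
    show "(\<lambda>x. f x * g x) differentiable (at x)" for x by (intro differentiable_mult d)
  qed (use Suc.prems in simp_all)
qed

section \<open>The fractional Laplacian as an absolutely convergent integral\<close>

text \<open>
  Each integral outside a ball is invariant under a reflection of the increment, hence equal to half the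
  integral of the second difference. The second difference being integrable against the kernel on the
  whole space, the limit exists by dominated convergence.
\<close>

lemma frac_laplacian_eq:
  fixes \<psi> :: "'a::euclidean_space \<Rightarrow> real"
  assumes s: "0 < s" "s < 1" and [measurable]: "\<psi> \<in> borel_measurable borel" and B: "\<And>y. \<bar>\<psi> y\<bar> \<le> B"
    and int: "integrable lborel (\<lambda>y. jump_kernel s y * (2 * \<psi> x - \<psi> (x + y) - \<psi> (x - y)))"
  shows "frac_laplacian s \<psi> x = (LINT y|lborel. jump_kernel s y * (2 * \<psi> x - \<psi> (x + y) - \<psi> (x - y))) / 2"
proof -
  define C where "C = frac_const TYPE('a) s"
  have C: "C > 0" unfolding C_def by (rule frac_const_pos[OF s])
  define g where "g = (\<lambda>\<epsilon>. LINT y:- ball x \<epsilon>|lebesgue. (\<psi> x - \<psi> y) / norm (x - y) powr (real DIM('a) + 2 * s))"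
  have g_eq: "g \<epsilon> = (1 / (2 * C)) * (LINT y|lborel. trunc_kernel s \<epsilon> y * (2 * \<psi> x - \<psi> (x + y) - \<psi> (x - y)))"
    if \<epsilon>: "0 < \<epsilon>" "\<epsilon> < 1" for \<epsilon>
  proof -
    have "g \<epsilon> = (LINT y|lborel. indicator (- ball x \<epsilon>) y * ((\<psi> x - \<psi> y) / norm (x - y) powr (real DIM('a) + 2 * s)))"
      unfolding g_def set_lebesgue_integral_def by (subst integral_completion) auto
    also have "\<dots> = (LINT z|lborel. indicator (- ball x \<epsilon>) (x + z) * ((\<psi> x - \<psi> (x + z)) / norm (x - (x + z)) powr (real DIM('a) + 2 * s)))"
      by (subst lborel_distr_plus[of x, symmetric], subst integral_distr) auto
    also have "\<dots> = (LINT z|lborel. (1 / C) * (trunc_kernel s \<epsilon> z * (\<psi> x - \<psi> (x + z))))"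
      using C by (intro Bochner_Integration.integral_cong refl)
        (auto simp: trunc_kernel_def jump_kernel_def C_def[symmetric] indicator_def dist_norm)
    finally have 1: "g \<epsilon> = (1 / C) * (LINT z|lborel. trunc_kernel s \<epsilon> z * (\<psi> x - \<psi> (x + z)))"
      by simp
    have i: "integrable lborel (\<lambda>z. trunc_kernel s \<epsilon> z * (\<psi> x - \<psi> (x + z)))"
    proof (rule integrable_trunc_kernel_mult[OF s])
      show "\<bar>\<psi> x - \<psi> (x + z)\<bar> \<le> B + B" for z using B[of x] B[of "x + z"] by linarith
    qed (use \<epsilon> in auto)
    have i': "integrable lborel (\<lambda>z. trunc_kernel s \<epsilon> z * (\<psi> x - \<psi> (x - z)))"
      using integrable_lborel_minus[OF i] by simp
    have "(LINT z|lborel. trunc_kernel s \<epsilon> z * (\<psi> x - \<psi> (x - z))) = (LINT z|lborel. trunc_kernel s \<epsilon> z * (\<psi> x - \<psi> (x + z)))"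
      using integral_lborel_minus[of "\<lambda>z. trunc_kernel s \<epsilon> z * (\<psi> x - \<psi> (x + z))"] by simp
    hence "2 * (LINT z|lborel. trunc_kernel s \<epsilon> z * (\<psi> x - \<psi> (x + z)))
       = (LINT z|lborel. trunc_kernel s \<epsilon> z * (\<psi> x - \<psi> (x + z))) + (LINT z|lborel. trunc_kernel s \<epsilon> z * (\<psi> x - \<psi> (x - z)))"
      by simp
    also have "\<dots> = (LINT z|lborel. trunc_kernel s \<epsilon> z * (\<psi> x - \<psi> (x + z)) + trunc_kernel s \<epsilon> z * (\<psi> x - \<psi> (x - z)))"
      by (rule Bochner_Integration.integral_add[OF i i', symmetric])
    also have "\<dots> = (LINT y|lborel. trunc_kernel s \<epsilon> y * (2 * \<psi> x - \<psi> (x + y) - \<psi> (x - y)))"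
      by (intro Bochner_Integration.integral_cong refl) (simp add: algebra_simps)
    finally have 2: "(LINT z|lborel. trunc_kernel s \<epsilon> z * (\<psi> x - \<psi> (x + z)))
        = (LINT y|lborel. trunc_kernel s \<epsilon> y * (2 * \<psi> x - \<psi> (x + y) - \<psi> (x - y))) / 2" by linarith
    show ?thesis unfolding 1 2 by simp
  qed
  define I where "I = (LINT y|lborel. jump_kernel s y * (2 * \<psi> x - \<psi> (x + y) - \<psi> (x - y)))"
  have "(g \<longlongrightarrow> (1 / (2 * C)) * I) (at_right 0)"
  proof (rule tendsto_at_right_sequentially[of 0 1])
    fix S :: "nat \<Rightarrow> real"
    assume S: "\<And>n. 0 < S n" "\<And>n. S n < 1" "S \<longlonglongrightarrow> 0"
    have "(\<lambda>n. LINT y|lborel. trunc_kernel s (S n) y * (2 * \<psi> x - \<psi> (x + y) - \<psi> (x - y))) \<longlonglongrightarrow> I"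
      unfolding I_def
    proof (rule integral_dominated_convergence[where w = "\<lambda>y. \<bar>jump_kernel s y * (2 * \<psi> x - \<psi> (x + y) - \<psi> (x - y))\<bar>"])
      show "AE y in lborel. (\<lambda>n. trunc_kernel s (S n) y * (2 * \<psi> x - \<psi> (x + y) - \<psi> (x - y)))
          \<longlonglongrightarrow> jump_kernel s y * (2 * \<psi> x - \<psi> (x + y) - \<psi> (x - y))"
      proof (intro AE_I2)
        fix y :: 'a
        show "(\<lambda>n. trunc_kernel s (S n) y * (2 * \<psi> x - \<psi> (x + y) - \<psi> (x - y)))
          \<longlonglongrightarrow> jump_kernel s y * (2 * \<psi> x - \<psi> (x + y) - \<psi> (x - y))"
        proof (cases "y = 0")
          case False
          have "eventually (\<lambda>n. S n < norm y) sequentially"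
            using S(3)[THEN order_tendstoD(2), of "norm y"] False by simp
          hence "eventually (\<lambda>n. trunc_kernel s (S n) y * (2 * \<psi> x - \<psi> (x + y) - \<psi> (x - y))
              = jump_kernel s y * (2 * \<psi> x - \<psi> (x + y) - \<psi> (x - y))) sequentially"
            by eventually_elim (simp add: trunc_kernel_def)
          thus ?thesis by (rule tendsto_eventually)
        qed simp
      qed
      show "AE y in lborel. norm (trunc_kernel s (S n) y * (2 * \<psi> x - \<psi> (x + y) - \<psi> (x - y)))
          \<le> \<bar>jump_kernel s y * (2 * \<psi> x - \<psi> (x + y) - \<psi> (x - y))\<bar>" for n
        using s by (intro AE_I2) (auto simp: abs_mult trunc_kernel_le intro!: mult_right_mono)
    qed (use int in auto)
    hence "(\<lambda>n. (1 / (2 * C)) * (LINT y|lborel. trunc_kernel s (S n) y * (2 * \<psi> x - \<psi> (x + y) - \<psi> (x - y)))) \<longlonglongrightarrow> (1 / (2 * C)) * I"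
      by (intro tendsto_mult_left)
    thus "(\<lambda>n. g (S n)) \<longlonglongrightarrow> (1 / (2 * C)) * I" using S by (simp add: g_eq)
  qed simp
  hence "Lim (at_right 0) g = (1 / (2 * C)) * I" by (intro tendsto_Lim) auto
  hence "frac_laplacian s \<psi> x = C * ((1 / (2 * C)) * I)"
    unfolding frac_laplacian_def g_def C_def by simp
  thus ?thesis using C by (simp add: I_def)
qed

text \<open>
  The directional derivatives are carried along explicitly, so that those of products
  and of waves can be written down. The derivative along y and then along z is \<open>f2 y z\<close>.
\<close>

definition C2_with :: "('a::euclidean_space \<Rightarrow> real) \<Rightarrow> ('a \<Rightarrow> 'a \<Rightarrow> real) \<Rightarrow> ('a \<Rightarrow> 'a \<Rightarrow> 'a \<Rightarrow> real) \<Rightarrow> bool" where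
  "C2_with f f1 f2 \<longleftrightarrow> (\<forall>x. (f has_derivative (\<lambda>y. f1 y x)) (at x)) \<and>
     (\<forall>y x. (f1 y has_derivative (\<lambda>z. f2 y z x)) (at x))"

lemma C2_with_laplacian:
  assumes "C2_with f f1 f2"
  shows "laplacian f x = (\<Sum>b\<in>Basis. f2 b b x)"
proof -
  have "partial_deriv b f = f1 b" for b
  proof
    fix x
    show "partial_deriv b f x = f1 b x"
      by (rule partial_deriv_eq) (use assms in \<open>auto simp: C2_with_def\<close>)
  qed
  moreover have "partial_deriv b (f1 b) x = f2 b b x" for b
    by (rule partial_deriv_eq) (use assms in \<open>auto simp: C2_with_def\<close>)
  ultimately show ?thesis by (simp add: laplacian_def)
qed

lemma C2_with_mult:
  assumes f: "C2_with f f1 f2" and g: "C2_with g g1 g2"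
  shows "C2_with (\<lambda>x. f x * g x) (\<lambda>y x. f x * g1 y x + f1 y x * g x)
    (\<lambda>y z x. (f x * g2 y z x + f1 z x * g1 y x) + (f1 y x * g1 z x + f2 y z x * g x))"
  unfolding C2_with_def
proof (intro conjI allI)
  note d = f[unfolded C2_with_def, THEN conjunct1, rule_format] f[unfolded C2_with_def, THEN conjunct2, rule_format]
    g[unfolded C2_with_def, THEN conjunct1, rule_format] g[unfolded C2_with_def, THEN conjunct2, rule_format]
  show "((\<lambda>x. f x * g x) has_derivative (\<lambda>y. f x * g1 y x + f1 y x * g x)) (at x)" for x
    by (rule has_derivative_mult[OF d(1) d(3)])
  show "((\<lambda>x. f x * g1 y x + f1 y x * g x) has_derivative
      (\<lambda>z. (f x * g2 y z x + f1 z x * g1 y x) + (f1 y x * g1 z x + f2 y z x * g x))) (at x)" for y x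
    by (rule has_derivative_add[OF has_derivative_mult[OF d(1) d(4)] has_derivative_mult[OF d(2) d(3)]])
qed

lemma has_derivative_line:
  assumes "(f has_derivative f') (at (x + t *\<^sub>R y))"
  shows "((\<lambda>t. f (x + t *\<^sub>R y)) has_real_derivative f' y) (at t)"
proof -
  have lin: "linear f'" using assms by (rule has_derivative_linear)
  have "((\<lambda>t. x + t *\<^sub>R y) has_derivative (\<lambda>h. h *\<^sub>R y)) (at t)"
    by (auto intro!: derivative_eq_intros)
  from has_derivative_compose[OF this assms]
  have "((\<lambda>t. f (x + t *\<^sub>R y)) has_derivative (\<lambda>h. f' (h *\<^sub>R y))) (at t)" .
  moreover have "(\<lambda>h. f' (h *\<^sub>R y)) = (*) (f' y)"
    using lin by (auto simp: linear_cmul mult.commute)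
  ultimately show ?thesis by (simp add: has_field_derivative_def)
qed

lemma C2_with_second_difference:
  assumes f: "C2_with f f1 f2" and B: "\<And>t. \<bar>t\<bar> \<le> 1 \<Longrightarrow> \<bar>f2 y y (x + t *\<^sub>R y)\<bar> \<le> B"
  shows "\<bar>2 * f x - f (x + y) - f (x - y)\<bar> \<le> B"
proof -
  have "((\<lambda>t. f (x + t *\<^sub>R y)) has_real_derivative f1 y (x + t *\<^sub>R y)) (at t)" for t
    using f by (intro has_derivative_line) (auto simp: C2_with_def)
  moreover have "((\<lambda>t. f1 y (x + t *\<^sub>R y)) has_real_derivative f2 y y (x + t *\<^sub>R y)) (at t)" for t
    using f by (intro has_derivative_line) (auto simp: C2_with_def)
  ultimately have "\<bar>f (x + 1 *\<^sub>R y) + f (x + (- 1) *\<^sub>R y) - 2 * f (x + 0 *\<^sub>R y)\<bar> \<le> B"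
    by (rule second_difference_bound[OF _ _ B])
  thus ?thesis by simp
qed

text \<open>
  The second-order bound concerns a repeated direction only, which suffices for the Laplacian
  and for second differences.
\<close>

definition decaying :: "real \<Rightarrow> real \<Rightarrow> ('a::euclidean_space \<Rightarrow> real) \<Rightarrow> ('a \<Rightarrow> 'a \<Rightarrow> real) \<Rightarrow> ('a \<Rightarrow> 'a \<Rightarrow> 'a \<Rightarrow> real) \<Rightarrow> bool" where
  "decaying s M f f1 f2 \<longleftrightarrow> (\<forall>x. \<bar>f x\<bar> \<le> M * tail_weight s x) \<and>
     (\<forall>x y. \<bar>f1 y x\<bar> \<le> M * norm y * tail_weight s x) \<and>
     (\<forall>x y. \<bar>f2 y y x\<bar> \<le> M * (norm y)\<^sup>2 * tail_weight s x)"

text \<open>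
  For \<open>\<bar>y\<bar> \<le> 1\<close> the second derivative along the segment is controlled by the weight at x, since
  the weight varies by a bounded factor there; for larger y the three values are bounded separately.
\<close>

lemma second_difference_le_envelope:
  fixes f :: "'a::euclidean_space \<Rightarrow> real"
  assumes s: "0 < s" "s < 1" and f: "C2_with f f1 f2" and d: "decaying s M f f1 f2"
  shows "\<bar>2 * f x - f (x + y) - f (x - y)\<bar> \<le> 2 * M * 3 powr ((real DIM('a) + 2 * s) / 2) * envelope s x y"
proof -
  define K where "K = (3::real) powr ((real DIM('a) + 2 * s) / 2)"
  have K: "K \<ge> 1" using s by (simp add: K_def ge_one_powr_ge_zero)
  have M: "M \<ge> 0"
  proof -
    have "\<bar>f 0\<bar> \<le> M * tail_weight s (0::'a)" using d unfolding decaying_def by blast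
    hence "0 \<le> M * tail_weight s (0::'a)" by linarith
    thus ?thesis using weight_pos[of "real DIM('a) + 2 * s" "0::'a"] by (simp add: zero_le_mult_iff)
  qed
  have p: "real DIM('a) + 2 * s \<ge> 0" using s by simp
  show ?thesis
  proof (cases "norm y \<le> 1")
    case True
    have "\<bar>2 * f x - f (x + y) - f (x - y)\<bar> \<le> M * (norm y)\<^sup>2 * (K * tail_weight s x)"
    proof (rule C2_with_second_difference[OF f])
      fix t :: real assume t: "\<bar>t\<bar> \<le> 1"
      have "norm (t *\<^sub>R y) \<le> 1" using t True by (simp add: mult_le_one)
      hence "(norm (t *\<^sub>R y))\<^sup>2 \<le> 1" by (simp add: power_le_one)
      from weight_shift[OF p this] have "tail_weight s (x + t *\<^sub>R y) \<le> K * tail_weight s x" by (simp add: K_def)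
      hence "M * (norm y)\<^sup>2 * tail_weight s (x + t *\<^sub>R y) \<le> M * (norm y)\<^sup>2 * (K * tail_weight s x)"
        using M by (intro mult_left_mono) auto
      moreover have "\<bar>f2 y y (x + t *\<^sub>R y)\<bar> \<le> M * (norm y)\<^sup>2 * tail_weight s (x + t *\<^sub>R y)"
        using d unfolding decaying_def by blast
      ultimately show "\<bar>f2 y y (x + t *\<^sub>R y)\<bar> \<le> M * (norm y)\<^sup>2 * (K * tail_weight s x)"
        by (rule order_trans[rotated])
    qed
    also have "\<dots> = M * K * envelope s x y"
      using True by (simp add: envelope_def min_absorb2 power_le_one)
    also have "\<dots> \<le> 2 * M * K * envelope s x y" using M K by (intro mult_right_mono) auto
    finally show ?thesis by (simp add: K_def)
  next
    case False
    have a: "\<bar>f z\<bar> \<le> M * tail_weight s z" for z using d unfolding decaying_def by blast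
    have sq: "1 \<le> (norm y)\<^sup>2" using False by (simp add: one_le_power)
    have "\<bar>2 * f x - f (x + y) - f (x - y)\<bar> \<le> 2 * M * tail_weight s x + M * tail_weight s (x + y) + M * tail_weight s (x - y)"
      using a[of x] a[of "x + y"] a[of "x - y"] by linarith
    also have "\<dots> \<le> 2 * M * 1 * envelope s x y"
      using False M sq by (simp add: envelope_def algebra_simps)
    also have "\<dots> \<le> 2 * M * K * envelope s x y" using M K by (intro mult_right_mono mult_left_mono) auto
    finally show ?thesis by (simp add: K_def)
  qed
qed

lemma one_minus_cos_le:
  fixes \<xi> y :: "'a::euclidean_space"
  shows "1 - cos (\<xi> \<bullet> y) \<le> 2 * (1 + (norm \<xi>)\<^sup>2) * min 1 ((norm y)\<^sup>2)"
proof (cases "norm y \<le> 1")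
  case True
  have "1 - cos (\<xi> \<bullet> y) \<le> (\<xi> \<bullet> y)\<^sup>2"
    using cos_first_order[of 0 "\<xi> \<bullet> y"] by simp
  also have "\<dots> \<le> (norm \<xi> * norm y)\<^sup>2"
    using power_mono[OF Cauchy_Schwarz_ineq2[of \<xi> y], of 2] by simp
  also have "\<dots> \<le> 2 * (1 + (norm \<xi>)\<^sup>2) * (norm y)\<^sup>2"
    unfolding power_mult_distrib by (intro mult_right_mono) auto
  finally show ?thesis using True by (simp add: min_absorb2 power_le_one)
next
  case False
  have "1 - cos (\<xi> \<bullet> y) \<le> 2" using cos_ge_minus_one[of "\<xi> \<bullet> y"] by linarith
  also have "\<dots> \<le> 2 * (1 + (norm \<xi>)\<^sup>2)" by simp
  finally show ?thesis using False by (simp add: min_absorb1 one_le_power)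
qed

text \<open>
  The second difference of a cosine is
  \<open>2 * cos (x \<bullet> \<xi> + \<theta> \<xi>) * (1 - cos (\<xi> \<bullet> y))\<close>, so exchanging the integrals leaves the symbol of
  the fractional Laplacian.
\<close>

lemma wave_jump_integral:
  fixes F \<theta> :: "'a::euclidean_space \<Rightarrow> real"
  assumes s: "0 < s" "s < 1" and F: "rapid F" and \<theta> [measurable]: "\<theta> \<in> borel_measurable borel"
  shows "(LINT y|lborel. jump_kernel s y * (2 * wave F \<theta> x - wave F \<theta> (x + y) - wave F \<theta> (x - y)))
     = 2 * wave (\<lambda>\<xi>. F \<xi> * norm \<xi> powr (2 * s)) \<theta> x" (is ?A)
    and "integrable lborel (\<lambda>y. jump_kernel s y * (2 * wave F \<theta> x - wave F \<theta> (x + y) - wave F \<theta> (x - y)))" (is ?B)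
proof -
  have [measurable]: "F \<in> borel_measurable borel" using F by (simp add: rapid_def)
  define G where "G = (\<lambda>y \<xi>. jump_kernel s y * (F \<xi> * (2 * cos (x \<bullet> \<xi> + \<theta> \<xi>) * (1 - cos (\<xi> \<bullet> y)))))"
  have inner: "(LINT \<xi>|lborel. G y \<xi>) = jump_kernel s y * (2 * wave F \<theta> x - wave F \<theta> (x + y) - wave F \<theta> (x - y))" for y
  proof -
    have iF: "integrable lborel (\<lambda>\<xi>. F \<xi> * cos (z \<bullet> \<xi> + \<theta> \<xi>))" for z
      by (intro integrable_wave rapid_integrable F) measurable
    have "F \<xi> * (2 * cos (x \<bullet> \<xi> + \<theta> \<xi>) * (1 - cos (\<xi> \<bullet> y)))
       = 2 * (F \<xi> * cos (x \<bullet> \<xi> + \<theta> \<xi>)) - F \<xi> * cos ((x + y) \<bullet> \<xi> + \<theta> \<xi>) - F \<xi> * cos ((x - y) \<bullet> \<xi> + \<theta> \<xi>)" for \<xi>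
    proof -
      have "(x + y) \<bullet> \<xi> + \<theta> \<xi> = (x \<bullet> \<xi> + \<theta> \<xi>) + \<xi> \<bullet> y" "(x - y) \<bullet> \<xi> + \<theta> \<xi> = (x \<bullet> \<xi> + \<theta> \<xi>) - \<xi> \<bullet> y"
        by (simp_all add: inner_add_left inner_diff_left inner_commute[of \<xi> y])
      thus ?thesis by (simp only: cos_add cos_diff) (simp add: algebra_simps)
    qed
    hence "(LINT \<xi>|lborel. F \<xi> * (2 * cos (x \<bullet> \<xi> + \<theta> \<xi>) * (1 - cos (\<xi> \<bullet> y)))) = 2 * wave F \<theta> x - wave F \<theta> (x + y) - wave F \<theta> (x - y)"
      using iF by (simp add: wave_def)
    thus ?thesis by (simp add: G_def)
  qed
  have inner': "(LINT y|lborel. G y \<xi>) = 2 * (F \<xi> * norm \<xi> powr (2 * s) * cos (x \<bullet> \<xi> + \<theta> \<xi>))" for \<xi>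
  proof -
    have "(LINT y|lborel. (1 - cos (\<xi> \<bullet> y)) * jump_kernel s y) = norm \<xi> powr (2 * s)"
      using nn_integral_jump_kernel_symbol[OF s, of \<xi>] s
      by (intro integral_eq_nn_integral[THEN trans]) (auto intro!: AE_I2)
    moreover have "(LINT y|lborel. G y \<xi>) = (LINT y|lborel. (2 * F \<xi> * cos (x \<bullet> \<xi> + \<theta> \<xi>)) * ((1 - cos (\<xi> \<bullet> y)) * jump_kernel s y))"
      by (intro Bochner_Integration.integral_cong refl) (simp add: G_def)
    ultimately show ?thesis by simp
  qed
  have iB: "integrable lborel (\<lambda>\<xi>. 4 * (1 + (norm \<xi>)\<^sup>2) * \<bar>F \<xi>\<bar>)"
  proof -
    have "integrable lborel (\<lambda>\<xi>. \<bar>norm \<xi> ^ 0 * F \<xi>\<bar> + \<bar>norm \<xi> ^ 2 * F \<xi>\<bar>)"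
      using F unfolding rapid_def by (intro Bochner_Integration.integrable_add integrable_abs) (erule conjE, erule allE, assumption)+
    hence "integrable lborel (\<lambda>\<xi>. 4 * (\<bar>norm \<xi> ^ 0 * F \<xi>\<bar> + \<bar>norm \<xi> ^ 2 * F \<xi>\<bar>))"
      by (rule integrable_mult_right)
    thus ?thesis by (simp add: abs_mult algebra_simps)
  qed
  have bd: "\<bar>G y \<xi>\<bar> \<le> (min 1 ((norm y)\<^sup>2) * jump_kernel s y) * (4 * (1 + (norm \<xi>)\<^sup>2) * \<bar>F \<xi>\<bar>)" for y \<xi>
  proof -
    have "\<bar>2 * cos (x \<bullet> \<xi> + \<theta> \<xi>) * (1 - cos (\<xi> \<bullet> y))\<bar> \<le> 2 * 1 * (2 * (1 + (norm \<xi>)\<^sup>2) * min 1 ((norm y)\<^sup>2))"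
      unfolding abs_mult using one_minus_cos_le[of \<xi> y] by (intro mult_mono) auto
    hence "jump_kernel s y * (\<bar>F \<xi>\<bar> * \<bar>2 * cos (x \<bullet> \<xi> + \<theta> \<xi>) * (1 - cos (\<xi> \<bullet> y))\<bar>)
       \<le> jump_kernel s y * (\<bar>F \<xi>\<bar> * (2 * 1 * (2 * (1 + (norm \<xi>)\<^sup>2) * min 1 ((norm y)\<^sup>2))))"
      using s by (intro mult_left_mono) auto
    moreover have "\<bar>G y \<xi>\<bar> = jump_kernel s y * (\<bar>F \<xi>\<bar> * \<bar>2 * cos (x \<bullet> \<xi> + \<theta> \<xi>) * (1 - cos (\<xi> \<bullet> y))\<bar>)"
      using s by (simp add: G_def abs_mult)
    moreover have "jump_kernel s y * (\<bar>F \<xi>\<bar> * (2 * 1 * (2 * (1 + (norm \<xi>)\<^sup>2) * min 1 ((norm y)\<^sup>2))))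
       = (min 1 ((norm y)\<^sup>2) * jump_kernel s y) * (4 * (1 + (norm \<xi>)\<^sup>2) * \<bar>F \<xi>\<bar>)"
      by (simp add: algebra_simps)
    ultimately show ?thesis by (simp only:)
  qed
  have mG: "(\<lambda>(y, \<xi>). G y \<xi>) \<in> borel_measurable (lborel \<Otimes>\<^sub>M lborel)"
    unfolding G_def by measurable
  note swap = lborel_integral_swap[OF integrable_jump_kernel_levy[OF s] iB mG bd]
  show ?B using swap(2) unfolding inner .
  show ?A using swap(1) unfolding inner inner' by (simp add: wave_def)
qed

lemma frac_laplacian_wave:
  fixes F \<theta> :: "'a::euclidean_space \<Rightarrow> real"
  assumes s: "0 < s" "s < 1" and F: "rapid F" and \<theta> [measurable]: "\<theta> \<in> borel_measurable borel"
  shows "frac_laplacian s (wave F \<theta>) x = wave (\<lambda>\<xi>. F \<xi> * norm \<xi> powr (2 * s)) \<theta> x"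
proof -
  have [measurable]: "F \<in> borel_measurable borel" using F by (simp add: rapid_def)
  have [measurable]: "wave F \<theta> \<in> borel_measurable borel"
    unfolding wave_def[abs_def] by measurable
  show ?thesis
    using frac_laplacian_eq[OF s _ wave_abs_le[OF rapid_integrable[OF F] \<theta>] wave_jump_integral(2)[OF s F \<theta>]]
    by (simp add: wave_jump_integral(1)[OF s F \<theta>])
qed

lemma wave_C2_with:
  assumes F: "rapid F" and \<theta> [measurable]: "\<theta> \<in> borel_measurable borel"
  shows "C2_with (wave F \<theta>) (\<lambda>y. wave (\<lambda>\<xi>. F \<xi> * (y \<bullet> \<xi>)) (\<lambda>\<xi>. \<theta> \<xi> + pi / 2))
     (\<lambda>y z. wave (\<lambda>\<xi>. F \<xi> * (y \<bullet> \<xi>) * (z \<bullet> \<xi>)) (\<lambda>\<xi>. \<theta> \<xi> + pi / 2 + pi / 2))"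
  unfolding C2_with_def
  by (intro conjI allI wave_has_derivative rapid_inner F; measurable)

lemma laplacian_wave:
  assumes F: "rapid F" and \<theta> [measurable]: "\<theta> \<in> borel_measurable borel"
  shows "laplacian (wave F \<theta>) x = - wave (\<lambda>\<xi>. F \<xi> * (norm \<xi>)\<^sup>2) \<theta> x"
proof -
  have i: "integrable lborel (\<lambda>\<xi>. F \<xi> * (b \<bullet> \<xi>) * (b \<bullet> \<xi>) * cos (x \<bullet> \<xi> + (\<theta> \<xi> + pi / 2 + pi / 2)))" for b
    by (intro integrable_wave rapid_integrable rapid_inner F) measurable
  have "laplacian (wave F \<theta>) x = (LINT \<xi>|lborel. (\<Sum>b\<in>Basis. F \<xi> * (b \<bullet> \<xi>) * (b \<bullet> \<xi>) * cos (x \<bullet> \<xi> + (\<theta> \<xi> + pi / 2 + pi / 2))))"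
    unfolding C2_with_laplacian[OF wave_C2_with[OF F \<theta>]] wave_def by (rule Bochner_Integration.integral_sum[OF i, symmetric])
  also have "\<dots> = (LINT \<xi>|lborel. - (F \<xi> * (norm \<xi>)\<^sup>2 * cos (x \<bullet> \<xi> + \<theta> \<xi>)))"
  proof (intro Bochner_Integration.integral_cong refl)
    fix \<xi> :: 'a
    have "(norm \<xi>)\<^sup>2 = (\<Sum>b\<in>Basis. (b \<bullet> \<xi>) * (b \<bullet> \<xi>))"
      unfolding power2_norm_eq_inner by (subst euclidean_inner) (simp add: inner_commute)
    moreover have "cos (x \<bullet> \<xi> + (\<theta> \<xi> + pi / 2 + pi / 2)) = - cos (x \<bullet> \<xi> + \<theta> \<xi>)"
      using cos_periodic_pi[of "x \<bullet> \<xi> + \<theta> \<xi>"] by (simp add: add.assoc)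
    ultimately show "(\<Sum>b\<in>Basis. F \<xi> * (b \<bullet> \<xi>) * (b \<bullet> \<xi>) * cos (x \<bullet> \<xi> + (\<theta> \<xi> + pi / 2 + pi / 2))) = - (F \<xi> * (norm \<xi>)\<^sup>2 * cos (x \<bullet> \<xi> + \<theta> \<xi>))"
      by (simp add: sum_distrib_left sum_distrib_right sum_negf mult.assoc)
  qed
  finally show ?thesis by (simp add: wave_def)
qed

section \<open>Cutoff functions and decaying functions\<close>

text \<open>
  With \<open>p = 1\<close> this is the standard flat function. Admitting polynomials in \<open>1/t\<close> gives a class that is
  closed under differentiation, \<open>bump_deriv\<close> being the action on the polynomial.
\<close>

definition bump :: "real poly \<Rightarrow> real \<Rightarrow> real" where
  "bump p t = (if t > 0 then poly p (1 / t) * exp (- (1 / t)) else 0)"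

definition bump_deriv :: "real poly \<Rightarrow> real poly" where
  "bump_deriv p = [:0, 0, 1:] * (p - pderiv p)"

lemma poly_mult_exp_tendsto_0: "((\<lambda>v::real. poly q v * exp (- v)) \<longlongrightarrow> 0) at_top"
proof -
  have "((\<lambda>v. \<Sum>i\<le>degree q. coeff q i * (v ^ i / exp v)) \<longlongrightarrow> (\<Sum>i\<le>degree q. coeff q i * 0)) at_top"
    by (intro tendsto_sum tendsto_mult tendsto_const tendsto_power_div_exp_0)
  thus ?thesis by (simp add: poly_altdef sum_distrib_right exp_minus divide_inverse mult.assoc)
qed

lemma bump_tendsto_0: "(bump q \<longlongrightarrow> 0) (at 0)"
proof (rule filterlim_split_at)
  show "(bump q \<longlongrightarrow> 0) (at_left 0)"
    by (rule tendsto_eventually) (auto simp: eventually_at_filter bump_def)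
  have "((\<lambda>t. poly q (inverse t) * exp (- inverse t)) \<longlongrightarrow> 0) (at_right 0)"
    by (rule filterlim_compose[OF poly_mult_exp_tendsto_0 filterlim_inverse_at_top_right])
  moreover have "eventually (\<lambda>t. poly q (inverse t) * exp (- inverse t) = bump q t) (at_right 0)"
    by (auto simp: eventually_at_filter bump_def inverse_eq_divide)
  ultimately show "(bump q \<longlongrightarrow> 0) (at_right 0)" by (rule Lim_transform_eventually)
qed

lemma bump_has_derivative: "(bump p has_real_derivative bump (bump_deriv p) t) (at t)"
proof (cases t "0::real" rule: linorder_cases)
  case less
  have "((\<lambda>_. 0) has_real_derivative 0) (at t)" by simp
  hence "(bump p has_real_derivative 0) (at t)"
    by (rule has_field_derivative_transform_within_open[where S = "{..<0}"]) (use less in \<open>auto simp: bump_def\<close>)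
  thus ?thesis using less by (simp add: bump_def)
next
  case equal
  have "((\<lambda>h. (bump p (0 + h) - bump p 0) / h) \<longlongrightarrow> 0) (at 0)"
  proof (rule Lim_transform_eventually[OF bump_tendsto_0[of "pCons 0 p"]])
    show "eventually (\<lambda>h. bump (pCons 0 p) h = (bump p (0 + h) - bump p 0) / h) (at 0)"
      by (auto simp: eventually_at_filter bump_def)
  qed
  thus ?thesis using equal by (simp add: DERIV_def bump_def)
next
  case greater
  have "((\<lambda>t. poly p (1 / t) * exp (- (1 / t))) has_real_derivative
      (poly (pderiv p) (1 / t) * (- 1 / t\<^sup>2)) * exp (- (1 / t)) + (exp (- (1 / t)) * (1 / t\<^sup>2)) * poly p (1 / t)) (at t)"
    using greater
    by (auto intro!: derivative_eq_intros DERIV_chain2[OF poly_DERIV] simp: power2_eq_square)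
  hence "((\<lambda>t. poly p (1 / t) * exp (- (1 / t))) has_real_derivative bump (bump_deriv p) t) (at t)"
    using greater by (simp add: bump_def bump_deriv_def power2_eq_square field_simps)
  thus ?thesis
    by (rule has_field_derivative_transform_within_open[where S = "{0<..}"]) (use greater in \<open>auto simp: bump_def\<close>)
qed

lemma bump_bounded: "\<exists>B>0. \<forall>t\<le>1. \<bar>bump p t\<bar> \<le> B"
proof -
  have "continuous_on {0..1} (bump p)"
    by (intro continuous_at_imp_continuous_on ballI DERIV_isCont[OF bump_has_derivative])
  hence "bounded (bump p ` {0..1})"
    by (intro compact_imp_bounded compact_continuous_image) auto
  then obtain B where B: "B > 0" "\<And>t. t \<in> {0..1} \<Longrightarrow> norm (bump p t) \<le> B"
    by (auto simp: bounded_pos)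
  have "\<bar>bump p t\<bar> \<le> B" if "t \<le> 1" for t
  proof (cases "t \<ge> 0")
    case True
    thus ?thesis using B(2)[of t] that by simp
  next
    case False
    thus ?thesis using B(1) by (simp add: bump_def)
  qed
  thus ?thesis using B(1) by blast
qed

text \<open>
  A smooth function supported in the ball of radius R, obtained by composing with a polynomial in x.
\<close>

definition radial_bump :: "real poly \<Rightarrow> real \<Rightarrow> 'a::euclidean_space \<Rightarrow> real" where
  "radial_bump p R x = bump p (1 - (norm x)\<^sup>2 / R\<^sup>2)"

lemma has_derivative_linear_form: "((\<lambda>x::'a::euclidean_space. c * (x \<bullet> b)) has_derivative (\<lambda>z. c * (z \<bullet> b))) (at x)"
  by (auto intro!: derivative_eq_intros)

lemma radial_bump_has_derivative:
  "(radial_bump p R has_derivative (\<lambda>y. radial_bump (bump_deriv p) R x * (- 2 / R\<^sup>2 * (x \<bullet> y)))) (at x)"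
proof -
  have "((\<lambda>x::'a. 1 - c * (x \<bullet> x)) has_derivative (\<lambda>y. - 2 * c * (x \<bullet> y))) (at x)" for c
    by (auto intro!: derivative_eq_intros simp: inner_commute algebra_simps)
  from this[of "1 / R\<^sup>2"]
  have "((\<lambda>x::'a. 1 - (x \<bullet> x) / R\<^sup>2) has_derivative (\<lambda>y. - 2 / R\<^sup>2 * (x \<bullet> y))) (at x)"
    by simp
  from has_derivative_compose[OF this bump_has_derivative[of p, unfolded has_field_derivative_def]]
  show ?thesis by (simp add: radial_bump_def[abs_def] power2_norm_eq_inner)
qed

lemma radial_bump_C2_with:
  "C2_with (radial_bump p R) (\<lambda>y x. radial_bump (bump_deriv p) R x * (- 2 / R\<^sup>2 * (x \<bullet> y)))
    (\<lambda>y z x. radial_bump (bump_deriv p) R x * (- 2 / R\<^sup>2 * (z \<bullet> y)) +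
       (radial_bump (bump_deriv (bump_deriv p)) R x * (- 2 / R\<^sup>2 * (x \<bullet> z))) * (- 2 / R\<^sup>2 * (x \<bullet> y)))"
  unfolding C2_with_def
  by (intro conjI allI radial_bump_has_derivative has_derivative_mult has_derivative_linear_form)

lemma C_k_const: "C_k k (\<lambda>x. c)"
proof (induction k arbitrary: c)
  case (Suc k)
  have "partial_deriv b (\<lambda>x. c) = (\<lambda>x. 0)" for b :: 'a
    by (intro ext partial_deriv_eq[of _ "\<lambda>_. 0"]) simp
  thus ?case using Suc.IH by simp
qed simp

lemma C_k_linear: "C_k k (\<lambda>x. c * (x \<bullet> b))"
proof (cases k)
  case 0
  thus ?thesis by (auto intro!: continuous_intros)
next
  case (Suc j)
  have d: "((\<lambda>x::'a. c * (x \<bullet> b)) has_derivative (\<lambda>z. c * (z \<bullet> b))) (at x)" for x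
    by (rule has_derivative_linear_form)
  have p: "partial_deriv a (\<lambda>x. c * (x \<bullet> b)) = (\<lambda>x. c * (a \<bullet> b))" for a
    by (intro ext partial_deriv_eq[OF d])
  show ?thesis unfolding Suc C_k.simps(2) p using d by (auto simp: C_k_const intro: differentiableI)
qed

lemma radial_bump_C_k: "C_k k (radial_bump p R)"
proof (induction k arbitrary: p)
  case 0
  show ?case using radial_bump_has_derivative
    by (auto intro!: continuous_at_imp_continuous_on has_derivative_continuous)
next
  case (Suc k)
  have p: "partial_deriv b (radial_bump p R) = (\<lambda>x. radial_bump (bump_deriv p) R x * (- 2 / R\<^sup>2 * (x \<bullet> b)))" for b :: 'a
    by (intro ext partial_deriv_eq[OF radial_bump_has_derivative])
  show ?case unfolding C_k.simps(2) p
    by (intro conjI allI ballI C_k_mult Suc.IH C_k_linear differentiableI[OF radial_bump_has_derivative])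
qed

lemma radial_bump_outside:
  assumes "R > 0" "norm x \<ge> R"
  shows "radial_bump p R x = 0"
proof -
  have "R\<^sup>2 \<le> (norm x)\<^sup>2" using assms by (intro power_mono) auto
  hence "1 \<le> (norm x)\<^sup>2 / R\<^sup>2" using assms by (simp add: le_divide_eq)
  thus ?thesis by (simp add: radial_bump_def bump_def)
qed

text \<open>
  The bounds are uniform in \<open>R \<ge> 1\<close>: inside the ball \<open>\<bar>x\<bar> < R\<close>, and each differentiation brings
  a factor of at most \<open>2 \<bar>x\<bar> \<bar>y\<bar> / R\<^sup>2\<close> or \<open>2 \<bar>y\<bar>\<^sup>2 / R\<^sup>2\<close>.
\<close>

lemma radial_bump_derivative_bounds:
  fixes p :: "real poly"
  shows "\<exists>B>0. \<forall>R\<ge>1. \<forall>x y::'a::euclidean_space.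
    \<bar>radial_bump (bump_deriv p) R x * (- 2 / R\<^sup>2 * (x \<bullet> y))\<bar> \<le> B * norm y \<and>
    \<bar>radial_bump (bump_deriv p) R x * (- 2 / R\<^sup>2 * (y \<bullet> y)) +
       (radial_bump (bump_deriv (bump_deriv p)) R x * (- 2 / R\<^sup>2 * (x \<bullet> y))) * (- 2 / R\<^sup>2 * (x \<bullet> y))\<bar> \<le> B * (norm y)\<^sup>2"
proof -
  obtain B1 where B1: "B1 > 0" "\<forall>t\<le>1. \<bar>bump (bump_deriv p) t\<bar> \<le> B1" using bump_bounded by blast
  obtain B2 where B2: "B2 > 0" "\<forall>t\<le>1. \<bar>bump (bump_deriv (bump_deriv p)) t\<bar> \<le> B2" using bump_bounded by blast
  have "\<bar>radial_bump (bump_deriv p) R x * (- 2 / R\<^sup>2 * (x \<bullet> y))\<bar> \<le> (2 * B1 + 4 * B2) * norm y \<and>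
    \<bar>radial_bump (bump_deriv p) R x * (- 2 / R\<^sup>2 * (y \<bullet> y)) +
       (radial_bump (bump_deriv (bump_deriv p)) R x * (- 2 / R\<^sup>2 * (x \<bullet> y))) * (- 2 / R\<^sup>2 * (x \<bullet> y))\<bar> \<le> (2 * B1 + 4 * B2) * (norm y)\<^sup>2"
    if R: "R \<ge> 1" for R and x y :: 'a
  proof (cases "norm x \<ge> R")
    case True
    thus ?thesis using R B1(1) B2(1) by (simp add: radial_bump_outside)
  next
    case False
    define a where "a = radial_bump (bump_deriv p) R x"
    define b where "b = radial_bump (bump_deriv (bump_deriv p)) R x"
    define c where "c = - 2 / R\<^sup>2 * (x \<bullet> y)"
    have a: "\<bar>a\<bar> \<le> B1" and b: "\<bar>b\<bar> \<le> B2" using B1(2) B2(2) by (auto simp: a_def b_def radial_bump_def)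
    have "\<bar>x \<bullet> y\<bar> \<le> R * norm y"
      using Cauchy_Schwarz_ineq2[of x y] mult_right_mono[of "norm x" R "norm y"] False by simp
    also have "\<dots> \<le> R\<^sup>2 * norm y" using R by (intro mult_right_mono) (auto simp: power2_eq_square)
    finally have c: "\<bar>c\<bar> \<le> 2 * norm y" using R by (simp add: c_def abs_mult field_simps)
    have d: "\<bar>- 2 / R\<^sup>2 * (y \<bullet> y)\<bar> \<le> 2 * (norm y)\<^sup>2"
    proof -
      have "1 \<le> R\<^sup>2" using R by (simp add: one_le_power)
      hence "2 * (norm y)\<^sup>2 * 1 \<le> 2 * (norm y)\<^sup>2 * R\<^sup>2" by (intro mult_left_mono) auto
      thus ?thesis using R by (simp add: power2_norm_eq_inner field_simps)
    qed
    have "\<bar>a * c\<bar> \<le> B1 * (2 * norm y)" unfolding abs_mult using B1(1) by (intro mult_mono a c) auto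
    also have "\<dots> \<le> (2 * B1 + 4 * B2) * norm y" using B2(1) by (simp add: algebra_simps)
    finally have 1: "\<bar>a * c\<bar> \<le> (2 * B1 + 4 * B2) * norm y" .
    have "\<bar>a * (- 2 / R\<^sup>2 * (y \<bullet> y)) + b * c * c\<bar> \<le> \<bar>a\<bar> * \<bar>- 2 / R\<^sup>2 * (y \<bullet> y)\<bar> + \<bar>b\<bar> * (\<bar>c\<bar> * \<bar>c\<bar>)"
      by (rule order_trans[OF abs_triangle_ineq]) (simp add: abs_mult mult.assoc)
    also have "\<dots> \<le> B1 * (2 * (norm y)\<^sup>2) + B2 * ((2 * norm y) * (2 * norm y))"
      using B1(1) B2(1) by (intro add_mono mult_mono a b c d) auto
    also have "\<dots> = (2 * B1 + 4 * B2) * (norm y)\<^sup>2" by (simp add: power2_eq_square algebra_simps)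
    finally show ?thesis using 1 by (simp add: a_def b_def c_def)
  qed
  thus ?thesis using B1(1) B2(1) by (intro exI[of _ "2 * B1 + 4 * B2"]) auto
qed

lemma radial_bump_tendsto: "(\<lambda>j. radial_bump p (real (Suc j)) x) \<longlonglongrightarrow> bump p 1"
proof -
  have "(\<lambda>j. 1 - (norm x)\<^sup>2 * (inverse (real (Suc j)))\<^sup>2) \<longlonglongrightarrow> 1 - (norm x)\<^sup>2 * 0\<^sup>2"
    by (intro tendsto_intros LIMSEQ_inverse_real_of_nat)
  hence "(\<lambda>j. 1 - (norm x)\<^sup>2 / (real (Suc j))\<^sup>2) \<longlonglongrightarrow> 1"
    by (simp add: divide_inverse power_inverse)
  thus ?thesis unfolding radial_bump_def
    by (rule isCont_tendsto_compose[OF DERIV_isCont[OF bump_has_derivative]])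
qed

text \<open>
  The factor \<open>exp 1\<close> normalises the value at the origin to 1, so that the cutoffs converge to 1
  pointwise.
\<close>

abbreviation cutoff :: "nat \<Rightarrow> 'a::euclidean_space \<Rightarrow> real" where
  "cutoff j \<equiv> radial_bump [:exp 1:] (real (Suc j))"

lemma cutoff_range: "0 \<le> cutoff j x" "cutoff j x \<le> 1"
proof -
  define t where "t = 1 - (norm x)\<^sup>2 / (real (Suc j))\<^sup>2"
  have t1: "t \<le> 1" by (simp add: t_def)
  show "0 \<le> cutoff j x" by (simp add: radial_bump_def bump_def)
  have "bump [:exp 1:] t \<le> 1"
  proof (cases "t > 0")
    case True
    have "exp 1 * exp (- (1 / t)) = exp (1 - 1 / t)" by (simp flip: exp_add)
    moreover have "1 - 1 / t \<le> 0" using True t1 by (simp add: field_simps)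
    ultimately show ?thesis using True by (simp add: bump_def)
  qed (simp add: bump_def)
  thus "cutoff j x \<le> 1" by (simp add: radial_bump_def t_def)
qed

lemma cutoff_tendsto: "(\<lambda>j. cutoff j x) \<longlonglongrightarrow> 1"
  using radial_bump_tendsto[of "[:exp 1:]" x] by (simp add: bump_def flip: exp_add)

lemma decaying_nonneg_const:
  fixes f :: "'a::euclidean_space \<Rightarrow> real"
  assumes "decaying s M f f1 f2"
  shows "M \<ge> 0"
proof -
  have "\<bar>f 0\<bar> \<le> M * tail_weight s (0::'a)" using assms unfolding decaying_def by blast
  hence "0 \<le> M * tail_weight s (0::'a)" by linarith
  moreover have "tail_weight s (0::'a) > 0" by (rule weight_pos)
  ultimately show ?thesis by (simp add: zero_le_mult_iff not_le[symmetric])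
qed

lemma decaying_mult:
  fixes f :: "'a::euclidean_space \<Rightarrow> real"
  assumes d: "decaying s M f f1 f2" and B: "B \<ge> 0"
    and g: "\<And>x. \<bar>g x\<bar> \<le> 1" "\<And>x y. \<bar>g1 y x\<bar> \<le> B * norm y" "\<And>x y. \<bar>g2 y y x\<bar> \<le> B * (norm y)\<^sup>2"
  shows "decaying s (M * (1 + 3 * B)) (\<lambda>x. f x * g x) (\<lambda>y x. f x * g1 y x + f1 y x * g x)
    (\<lambda>y z x. (f x * g2 y z x + f1 z x * g1 y x) + (f1 y x * g1 z x + f2 y z x * g x))"
proof -
  have M: "M \<ge> 0" by (rule decaying_nonneg_const[OF d])
  have f: "\<bar>f x\<bar> \<le> M * tail_weight s x" "\<bar>f1 y x\<bar> \<le> M * norm y * tail_weight s x"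
    "\<bar>f2 y y x\<bar> \<le> M * (norm y)\<^sup>2 * tail_weight s x" for x y using d unfolding decaying_def by blast+
  show ?thesis unfolding decaying_def
  proof (intro conjI allI)
    fix x y :: 'a
    define w where "w = tail_weight s x"
    have w: "w \<ge> 0" by (simp add: w_def)
    note f = f[where x = x, folded w_def]
    have a: "\<bar>f x * g x\<bar> \<le> (M * w) * 1" unfolding abs_mult using M w by (intro mult_mono f g) auto
    also have "\<dots> \<le> M * (1 + 3 * B) * w" using M w B by (simp add: algebra_simps)
    finally show "\<bar>f x * g x\<bar> \<le> M * (1 + 3 * B) * tail_weight s x" by (simp add: w_def)
    have "\<bar>f x * g1 y x\<bar> \<le> (M * w) * (B * norm y)" unfolding abs_mult using M w by (intro mult_mono f g) auto
    moreover have "\<bar>f1 y x * g x\<bar> \<le> (M * norm y * w) * 1" unfolding abs_mult using M w by (intro mult_mono f g) auto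
    ultimately have "\<bar>f x * g1 y x + f1 y x * g x\<bar> \<le> (M * w) * (B * norm y) + (M * norm y * w) * 1" by linarith
    also have "\<dots> \<le> (M * w) * (B * norm y) + (M * norm y * w) * 1 + 2 * ((M * w) * (B * norm y))" using M w B by simp
    also have "\<dots> = M * (1 + 3 * B) * norm y * w" by (simp add: algebra_simps)
    finally show "\<bar>f x * g1 y x + f1 y x * g x\<bar> \<le> M * (1 + 3 * B) * norm y * tail_weight s x" by (simp add: w_def)
    have "\<bar>f x * g2 y y x\<bar> \<le> (M * w) * (B * (norm y)\<^sup>2)" unfolding abs_mult using M w by (intro mult_mono f g) auto
    moreover have "\<bar>f1 y x * g1 y x\<bar> \<le> (M * norm y * w) * (B * norm y)" unfolding abs_mult using M w by (intro mult_mono f g) auto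
    moreover have "\<bar>f2 y y x * g x\<bar> \<le> (M * (norm y)\<^sup>2 * w) * 1" unfolding abs_mult using M w by (intro mult_mono f g) auto
    ultimately have "\<bar>(f x * g2 y y x + f1 y x * g1 y x) + (f1 y x * g1 y x + f2 y y x * g x)\<bar>
       \<le> (M * w) * (B * (norm y)\<^sup>2) + 2 * ((M * norm y * w) * (B * norm y)) + (M * (norm y)\<^sup>2 * w) * 1" by linarith
    also have "\<dots> = M * (1 + 3 * B) * (norm y)\<^sup>2 * w" by (simp add: algebra_simps power2_eq_square)
    finally show "\<bar>(f x * g2 y y x + f1 y x * g1 y x) + (f1 y x * g1 y x + f2 y y x * g x)\<bar>
       \<le> M * (1 + 3 * B) * (norm y)\<^sup>2 * tail_weight s x" by (simp add: w_def)
  qed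
qed

text \<open>
  Integrate the bound by the envelope against the jump kernel.
\<close>

lemma decaying_frac_laplacian:
  assumes s: "0 < s" "s < 1"
  shows "\<exists>K>0. \<forall>(f::'a::euclidean_space \<Rightarrow> real) f1 f2 M. C2_with f f1 f2 \<longrightarrow> decaying s M f f1 f2 \<longrightarrow>
     (\<forall>x. integrable lborel (\<lambda>y. jump_kernel s y * (2 * f x - f (x + y) - f (x - y))) \<and>
          frac_laplacian s f x = (LINT y|lborel. jump_kernel s y * (2 * f x - f (x + y) - f (x - y))) / 2 \<and>
          \<bar>frac_laplacian s f x\<bar> \<le> K * M * tail_weight s x)"
proof -
  define P where "P = (3::real) powr ((real DIM('a) + 2 * s) / 2)"
  have P: "P > 0" by (simp add: P_def)
  obtain E where E: "E > 0" "\<And>x::'a. integrable lborel (\<lambda>y. jump_kernel s y * envelope s x y)"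
    "\<And>x::'a. (LINT y|lborel. jump_kernel s y * envelope s x y) \<le> E * tail_weight s x"
    using jump_kernel_envelope[OF s, where 'a='a] by auto
  have p: "real DIM('a) + 2 * s \<ge> 0" using s by simp
  have main: "integrable lborel (\<lambda>y. jump_kernel s y * (2 * f x - f (x + y) - f (x - y))) \<and>
          frac_laplacian s f x = (LINT y|lborel. jump_kernel s y * (2 * f x - f (x + y) - f (x - y))) / 2 \<and>
          \<bar>frac_laplacian s f x\<bar> \<le> P * E * M * tail_weight s x"
    if f: "C2_with f f1 f2" and d: "decaying s M f f1 f2" for f :: "'a \<Rightarrow> real" and f1 f2 M x
  proof -
    have M: "M \<ge> 0" by (rule decaying_nonneg_const[OF d])
    have "continuous_on UNIV f"
      using f unfolding C2_with_def by (auto intro!: continuous_at_imp_continuous_on has_derivative_continuous)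
    hence [measurable]: "f \<in> borel_measurable borel" by (rule borel_measurable_continuous_onI)
    have bd: "\<bar>f y\<bar> \<le> M" for y
    proof -
      have "\<bar>f y\<bar> \<le> M * tail_weight s y" using d unfolding decaying_def by blast
      also have "\<dots> \<le> M * 1" using M weight_le_one[OF p] by (intro mult_left_mono) auto
      finally show ?thesis by simp
    qed
    have le: "\<bar>jump_kernel s y * (2 * f x - f (x + y) - f (x - y))\<bar> \<le> 2 * M * P * (jump_kernel s y * envelope s x y)" for y
      using mult_left_mono[OF second_difference_le_envelope[OF s f d, of x y] jump_kernel_nonneg[OF s, of y]] s
      by (simp add: abs_mult P_def mult_ac)
    have int: "integrable lborel (\<lambda>y. jump_kernel s y * (2 * f x - f (x + y) - f (x - y)))"
    proof (rule Bochner_Integration.integrable_bound[OF integrable_mult_right[OF E(2)[of x], of "2 * M * P"]])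
      show "AE y in lborel. norm (jump_kernel s y * (2 * f x - f (x + y) - f (x - y))) \<le> norm (2 * M * P * (jump_kernel s y * envelope s x y))"
        using le by (intro AE_I2) (auto intro: order_trans[OF _ abs_ge_self])
    qed measurable
    have eq: "frac_laplacian s f x = (LINT y|lborel. jump_kernel s y * (2 * f x - f (x + y) - f (x - y))) / 2"
      by (rule frac_laplacian_eq[OF s _ bd int]) measurable
    have "norm (LINT y|lborel. jump_kernel s y * (2 * f x - f (x + y) - f (x - y))) \<le> (LINT y|lborel. norm (jump_kernel s y * (2 * f x - f (x + y) - f (x - y))))"
      by (rule integral_norm_bound)
    also have "\<dots> \<le> (LINT y|lborel. 2 * M * P * (jump_kernel s y * envelope s x y))"
      using le by (intro integral_mono integrable_norm int integrable_mult_right E(2)) auto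
    also have "\<dots> \<le> 2 * M * P * (E * tail_weight s x)"
      using E(3)[of x] M P by (simp add: mult_left_mono)
    finally have "\<bar>frac_laplacian s f x\<bar> \<le> P * E * M * tail_weight s x"
      unfolding eq by (simp add: mult_ac)
    thus ?thesis using int eq by blast
  qed
  have "P * E > 0" using P E(1) by simp
  with main show ?thesis by blast
qed

section \<open>Testing with decaying functions\<close>

lemma tail_weight_le:
  fixes x :: "'a::euclidean_space"
  assumes s: "0 < s" "s < 1"
  shows "tail_weight s x \<le> 2 / (1 + norm x powr (real DIM('a) + 2 * s))"
proof -
  define p where "p = real DIM('a) + 2 * s"
  have p: "p \<ge> 0" using s by (simp add: p_def)
  define A where "A = (4 + (norm x)\<^sup>2) powr (p / 2)"
  have "((norm x)\<^sup>2) powr (p / 2) \<le> A" unfolding A_def using p by (intro powr_mono2) auto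
  moreover have "((norm x)\<^sup>2) powr (p / 2) = norm x powr p"
  proof (cases "x = 0")
    case False
    hence "((norm x)\<^sup>2) powr (p / 2) = (norm x powr 2) powr (p / 2)" by (simp add: powr_numeral)
    also have "\<dots> = norm x powr p" unfolding powr_powr by simp
    finally show ?thesis .
  qed simp
  moreover have "1 \<le> A" unfolding A_def using p by (intro ge_one_powr_ge_zero) auto
  ultimately have "1 + norm x powr p \<le> 2 * A" by simp
  moreover have "A > 0" by (simp add: A_def)
  moreover have "1 + norm x powr p > 0" by (simp add: add_pos_nonneg)
  ultimately have "1 / A \<le> 2 / (1 + norm x powr p)" by (simp add: field_simps)
  moreover have "tail_weight s x = 1 / A"
    unfolding weight_def p_def[symmetric] A_def minus_divide_left[symmetric] powr_minus_divide ..
  ultimately show ?thesis by (simp add: p_def)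
qed

lemma L_2s_integrable_weight:
  fixes u :: "'a::euclidean_space \<Rightarrow> real"
  assumes s: "0 < s" "s < 1" and u: "L_2s s u" and [measurable]: "u \<in> borel_measurable lebesgue"
  shows "integrable lebesgue (\<lambda>x. \<bar>u x\<bar> * tail_weight s x)"
proof -
  have w_meas [measurable]: "tail_weight s \<in> borel_measurable (lebesgue :: 'a measure)"
    by (rule measurable_completion) simp
  have "integrable lebesgue (\<lambda>x. 2 * (\<bar>u x\<bar> / (1 + norm x powr (real DIM('a) + 2 * s))))"
    using u by (intro integrable_mult_right) (simp add: L_2s_def)
  thus ?thesis
  proof (rule Bochner_Integration.integrable_bound)
    show "AE x in lebesgue. norm (\<bar>u x\<bar> * tail_weight s x) \<le> norm (2 * (\<bar>u x\<bar> / (1 + norm x powr (real DIM('a) + 2 * s))))"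
    proof (intro AE_I2)
      fix x :: 'a
      have "\<bar>u x\<bar> * tail_weight s x \<le> \<bar>u x\<bar> * (2 / (1 + norm x powr (real DIM('a) + 2 * s)))"
        by (intro mult_left_mono tail_weight_le[OF s]) auto
      also have "\<dots> = 2 * (\<bar>u x\<bar> / (1 + norm x powr (real DIM('a) + 2 * s)))" by simp
      also have "\<dots> \<le> norm (2 * (\<bar>u x\<bar> / (1 + norm x powr (real DIM('a) + 2 * s))))" by simp
      finally show "norm (\<bar>u x\<bar> * tail_weight s x) \<le> norm (2 * (\<bar>u x\<bar> / (1 + norm x powr (real DIM('a) + 2 * s))))"
        by simp
    qed
  qed measurable
qed

lemma C_2_partial_continuous:
  assumes "C_k (Suc (Suc 0)) f" "b \<in> Basis"
  shows "continuous_on UNIV (partial_deriv b (partial_deriv b f))"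
  using assms by simp

lemma laplacian_measurable:
  fixes f :: "'a::euclidean_space \<Rightarrow> real"
  assumes "\<forall>k. C_k k f"
  shows "laplacian f \<in> borel_measurable borel"
  unfolding laplacian_def[abs_def]
proof (rule borel_measurable_sum)
  fix b :: 'a assume "b \<in> Basis"
  hence "continuous_on UNIV (partial_deriv b (partial_deriv b f))"
    using assms by (intro C_2_partial_continuous) auto
  thus "(\<lambda>x. partial_deriv b (partial_deriv b f) x) \<in> borel_measurable borel"
    by (simp add: borel_measurable_continuous_onI)
qed

text \<open>
  The products of \<open>\<phi>\<close> with the cutoffs are test functions, and they satisfy the decay bounds with one
  common constant. So their images under the operator are dominated by a multiple of the weight,
  against which u is integrable, and they converge pointwise. The integral with the q-th power of u
  passes to the limit by Fatou's lemma.
\<close>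

lemma supersolution_test_decaying:
  fixes u \<phi> :: "'a::euclidean_space \<Rightarrow> real"
  assumes s: "0 < s" "s < 1" and u: "nonneg_distr_supersolution s q u"
    and \<phi>: "\<forall>k. C_k k \<phi>" "C2_with \<phi> \<phi>1 \<phi>2" "decaying s M \<phi> \<phi>1 \<phi>2" "\<And>x. \<phi> x \<ge> 0"
  shows "(\<integral>\<^sup>+x. ennreal (u x powr q * \<phi> x) \<partial>lebesgue) \<le> ennreal (LINT x|lebesgue. u x * (- laplacian \<phi> x + frac_laplacian s \<phi> x))"
    and "integrable lebesgue (\<lambda>x. u x * (- laplacian \<phi> x + frac_laplacian s \<phi> x))"
proof -
  have p0: "real DIM('a) + 2 * s \<ge> 0" using s by simp
  have M: "M \<ge> 0" by (rule decaying_nonneg_const[OF \<phi>(3)])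
  have u_meas [measurable]: "u \<in> borel_measurable lebesgue"
    using u by (simp add: nonneg_distr_supersolution_def Lq_loc_def)
  have u_nn: "AE x in lebesgue. u x \<ge> 0" using u by (simp add: nonneg_distr_supersolution_def)
  have uw: "integrable lebesgue (\<lambda>x. \<bar>u x\<bar> * tail_weight s x)"
    using u by (intro L_2s_integrable_weight[OF s]) (auto simp: nonneg_distr_supersolution_def)
  define c where "c = [:exp 1::real:]"
  obtain B where B: "B > 0" and Bb: "\<And>R (x::'a) y. R \<ge> 1 \<Longrightarrow> \<bar>radial_bump (bump_deriv c) R x * (- 2 / R\<^sup>2 * (x \<bullet> y))\<bar> \<le> B * norm y"
    "\<And>R (x::'a) y. R \<ge> 1 \<Longrightarrow> \<bar>radial_bump (bump_deriv c) R x * (- 2 / R\<^sup>2 * (y \<bullet> y)) +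
       (radial_bump (bump_deriv (bump_deriv c)) R x * (- 2 / R\<^sup>2 * (x \<bullet> y))) * (- 2 / R\<^sup>2 * (x \<bullet> y))\<bar> \<le> B * (norm y)\<^sup>2"
    using radial_bump_derivative_bounds[of c, where 'a='a] by blast
  obtain K where K: "K > 0" and Kb: "\<And>(f::'a \<Rightarrow> real) f1 f2 M x. C2_with f f1 f2 \<Longrightarrow> decaying s M f f1 f2 \<Longrightarrow>
     integrable lborel (\<lambda>y. jump_kernel s y * (2 * f x - f (x + y) - f (x - y))) \<and>
          frac_laplacian s f x = (LINT y|lborel. jump_kernel s y * (2 * f x - f (x + y) - f (x - y))) / 2 \<and>
          \<bar>frac_laplacian s f x\<bar> \<le> K * M * tail_weight s x"
    using decaying_frac_laplacian[OF s, where 'a='a] by blast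
  define \<chi>1 where "\<chi>1 = (\<lambda>j (y::'a) x. radial_bump (bump_deriv c) (real (Suc j)) x * (- 2 / (real (Suc j))\<^sup>2 * (x \<bullet> y)))"
  define \<chi>2 where "\<chi>2 = (\<lambda>j (y::'a) z x. radial_bump (bump_deriv c) (real (Suc j)) x * (- 2 / (real (Suc j))\<^sup>2 * (z \<bullet> y)) +
       (radial_bump (bump_deriv (bump_deriv c)) (real (Suc j)) x * (- 2 / (real (Suc j))\<^sup>2 * (x \<bullet> z))) * (- 2 / (real (Suc j))\<^sup>2 * (x \<bullet> y)))"
  define \<psi> where "\<psi> = (\<lambda>j x. \<phi> x * cutoff j x)"
  define \<psi>1 where "\<psi>1 = (\<lambda>j y x. \<phi> x * \<chi>1 j y x + \<phi>1 y x * cutoff j x)"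
  define \<psi>2 where "\<psi>2 = (\<lambda>j y z x. (\<phi> x * \<chi>2 j y z x + \<phi>1 z x * \<chi>1 j y x) + (\<phi>1 y x * \<chi>1 j z x + \<phi>2 y z x * cutoff j x))"
  define M' where "M' = M * (1 + 3 * B)"
  have M': "M' \<ge> 0" using M B by (simp add: M'_def)
  have MM': "M \<le> M'" using M B by (simp add: M'_def algebra_simps)
  have C2c: "C2_with (cutoff j) (\<chi>1 j) (\<chi>2 j)" for j
    unfolding \<chi>1_def \<chi>2_def c_def by (rule radial_bump_C2_with)
  have C2: "C2_with (\<psi> j) (\<psi>1 j) (\<psi>2 j)" for j
    unfolding \<psi>_def \<psi>1_def \<psi>2_def by (rule C2_with_mult[OF \<phi>(2) C2c])
  have dec: "decaying s M' (\<psi> j) (\<psi>1 j) (\<psi>2 j)" for j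
    unfolding \<psi>_def \<psi>1_def \<psi>2_def M'_def
  proof (rule decaying_mult[OF \<phi>(3) less_imp_le[OF B]])
    show "\<bar>cutoff j x\<bar> \<le> 1" for x using cutoff_range[of j x] by simp
    show "\<bar>\<chi>1 j y x\<bar> \<le> B * norm y" for x y unfolding \<chi>1_def by (rule Bb(1)) simp
    show "\<bar>\<chi>2 j y y x\<bar> \<le> B * (norm y)\<^sup>2" for x y unfolding \<chi>2_def by (rule Bb(2)) simp
  qed
  have Ck: "C_k k (\<psi> j)" for k j
    unfolding \<psi>_def using \<phi>(1) by (intro C_k_mult radial_bump_C_k) auto
  have supp: "\<psi> j x = 0" if "x \<notin> cball 0 (real (Suc j))" for j x
    using that by (simp add: \<psi>_def radial_bump_outside)
  have test: "test_function (\<psi> j)" for j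
    unfolding test_function_def
  proof (intro conjI allI Ck)
    have "{x. \<psi> j x \<noteq> 0} \<subseteq> cball 0 (real (Suc j))" using supp by blast
    hence "bounded {x. \<psi> j x \<noteq> 0}" by (rule bounded_subset[OF bounded_cball])
    thus "compact (closure {x. \<psi> j x \<noteq> 0})" by (simp only: compact_closure)
  qed
  have nn: "\<psi> j x \<ge> 0" for j x unfolding \<psi>_def using \<phi>(4) cutoff_range by (intro mult_nonneg_nonneg) auto
  have meas_b: "f \<in> borel_measurable borel" if "\<forall>k. C_k k f" for f :: "'a \<Rightarrow> real"
    using that[rule_format, of 0] by (simp add: borel_measurable_continuous_onI)
  have frac_meas: "frac_laplacian s f \<in> borel_measurable borel" if f: "\<forall>k. C_k k f" "C2_with f f1 f2" "decaying s N f f1 f2"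
    for f :: "'a \<Rightarrow> real" and f1 f2 N
  proof -
    have [measurable]: "f \<in> borel_measurable borel" by (rule meas_b[OF f(1)])
    have "frac_laplacian s f = (\<lambda>x. (LINT y|lborel. jump_kernel s y * (2 * f x - f (x + y) - f (x - y))) / 2)"
      using Kb[OF f(2,3)] by blast
    moreover have "(\<lambda>x. (LINT y|lborel. jump_kernel s y * (2 * f x - f (x + y) - f (x - y))) / 2) \<in> borel_measurable borel"
      by measurable
    ultimately show ?thesis by simp
  qed
  define L where "L = (\<lambda>f (x::'a). - laplacian f x + frac_laplacian s f x)"
  have L_meas: "L f \<in> borel_measurable lebesgue" if f: "\<forall>k. C_k k f" "C2_with f f1 f2" "decaying s N f f1 f2"
    for f :: "'a \<Rightarrow> real" and f1 f2 N
  proof -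
    have [measurable]: "laplacian f \<in> borel_measurable borel" "frac_laplacian s f \<in> borel_measurable borel"
      using laplacian_measurable[OF f(1)] frac_meas[OF f] by auto
    have "L f \<in> borel_measurable borel" unfolding L_def by measurable
    thus ?thesis by (intro measurable_completion) simp
  qed
  have L_le: "\<bar>L f x\<bar> \<le> (real DIM('a) + K) * N * tail_weight s x" if f: "C2_with f f1 f2" "decaying s N f f1 f2"
    for f :: "'a \<Rightarrow> real" and f1 f2 N x
  proof -
    have "\<bar>laplacian f x\<bar> \<le> (\<Sum>b\<in>(Basis::'a set). \<bar>f2 b b x\<bar>)"
      unfolding C2_with_laplacian[OF f(1)] by (rule sum_abs)
    also have "\<dots> \<le> (\<Sum>b\<in>(Basis::'a set). N * (norm b)\<^sup>2 * tail_weight s x)"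
      using f(2) unfolding decaying_def by (intro sum_mono) blast
    also have "\<dots> = real DIM('a) * N * tail_weight s x" by simp
    finally have "\<bar>laplacian f x\<bar> \<le> real DIM('a) * N * tail_weight s x" .
    moreover have "\<bar>frac_laplacian s f x\<bar> \<le> K * N * tail_weight s x" using Kb[OF f] by blast
    moreover have "\<bar>L f x\<bar> \<le> \<bar>laplacian f x\<bar> + \<bar>frac_laplacian s f x\<bar>" unfolding L_def by linarith
    ultimately show ?thesis unfolding distrib_right by linarith
  qed
  have lap_lim: "(\<lambda>j. laplacian (\<psi> j) x) \<longlonglongrightarrow> laplacian \<phi> x" for x
  proof -
    have inv: "(\<lambda>j. - 2 / (real (Suc j))\<^sup>2 * a) \<longlonglongrightarrow> 0" for a
    proof -
      have "(\<lambda>j. - 2 * (inverse (real (Suc j)))\<^sup>2 * a) \<longlonglongrightarrow> - 2 * 0\<^sup>2 * a"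
        by (intro tendsto_intros LIMSEQ_inverse_real_of_nat)
      thus ?thesis by (simp add: divide_inverse power_inverse)
    qed
    have c1: "(\<lambda>j. \<chi>1 j y x) \<longlonglongrightarrow> 0" for y
      unfolding \<chi>1_def using tendsto_mult[OF radial_bump_tendsto[of "bump_deriv c" x] inv[of "x \<bullet> y"]] by simp
    have c2: "(\<lambda>j. \<chi>2 j y z x) \<longlonglongrightarrow> 0" for y z
      unfolding \<chi>2_def
      using tendsto_add[OF tendsto_mult[OF radial_bump_tendsto[of "bump_deriv c" x] inv[of "z \<bullet> y"]]
          tendsto_mult[OF tendsto_mult[OF radial_bump_tendsto[of "bump_deriv (bump_deriv c)" x] inv[of "x \<bullet> z"]] inv[of "x \<bullet> y"]]]
      by simp
    have "(\<lambda>j. \<psi>2 j b b x) \<longlonglongrightarrow> (\<phi> x * 0 + \<phi>1 b x * 0) + (\<phi>1 b x * 0 + \<phi>2 b b x * 1)" for b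
      unfolding \<psi>2_def by (intro tendsto_intros c1 c2 cutoff_tendsto)
    hence "(\<lambda>j. \<Sum>b\<in>Basis. \<psi>2 j b b x) \<longlonglongrightarrow> (\<Sum>b\<in>Basis. \<phi>2 b b x)"
      by (intro tendsto_sum) simp
    thus ?thesis by (simp add: C2_with_laplacian[OF C2] C2_with_laplacian[OF \<phi>(2)])
  qed
  have \<psi>_lim: "(\<lambda>j. \<psi> j x) \<longlonglongrightarrow> \<phi> x" for x
    unfolding \<psi>_def using tendsto_mult[OF tendsto_const[of "\<phi> x"] cutoff_tendsto[of x]] by simp
  have frac_lim: "(\<lambda>j. frac_laplacian s (\<psi> j) x) \<longlonglongrightarrow> frac_laplacian s \<phi> x" for x
  proof -
    obtain E where E: "\<And>x::'a. integrable lborel (\<lambda>y. jump_kernel s y * envelope s x y)"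
      using jump_kernel_envelope[OF s, where 'a='a] by auto
    let ?P = "2 * M' * 3 powr ((real DIM('a) + 2 * s) / 2)"
    have [measurable]: "\<psi> j \<in> borel_measurable borel" for j using Ck by (intro meas_b) auto
    have [measurable]: "\<phi> \<in> borel_measurable borel" using \<phi>(1) by (rule meas_b)
    have "(\<lambda>j. LINT y|lborel. jump_kernel s y * (2 * \<psi> j x - \<psi> j (x + y) - \<psi> j (x - y)))
        \<longlonglongrightarrow> (LINT y|lborel. jump_kernel s y * (2 * \<phi> x - \<phi> (x + y) - \<phi> (x - y)))"
    proof (rule integral_dominated_convergence[where w = "\<lambda>y. ?P * (jump_kernel s y * envelope s x y)"])
      show "integrable lborel (\<lambda>y. ?P * (jump_kernel s y * envelope s x y))" by (intro integrable_mult_right E)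
      show "AE y in lborel. (\<lambda>j. jump_kernel s y * (2 * \<psi> j x - \<psi> j (x + y) - \<psi> j (x - y)))
          \<longlonglongrightarrow> jump_kernel s y * (2 * \<phi> x - \<phi> (x + y) - \<phi> (x - y))"
        by (intro AE_I2 tendsto_intros \<psi>_lim)
      show "AE y in lborel. norm (jump_kernel s y * (2 * \<psi> j x - \<psi> j (x + y) - \<psi> j (x - y))) \<le> ?P * (jump_kernel s y * envelope s x y)" for j
      proof (intro AE_I2)
        fix y
        show "norm (jump_kernel s y * (2 * \<psi> j x - \<psi> j (x + y) - \<psi> j (x - y))) \<le> ?P * (jump_kernel s y * envelope s x y)"
          using mult_left_mono[OF second_difference_le_envelope[OF s C2 dec, of j x y] jump_kernel_nonneg[OF s, of y]] s
          by (simp add: abs_mult mult_ac)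
      qed
    qed measurable
    hence "(\<lambda>j. (LINT y|lborel. jump_kernel s y * (2 * \<psi> j x - \<psi> j (x + y) - \<psi> j (x - y))) / 2)
        \<longlonglongrightarrow> (LINT y|lborel. jump_kernel s y * (2 * \<phi> x - \<phi> (x + y) - \<phi> (x - y))) / 2"
      by (intro tendsto_divide tendsto_const) auto
    moreover have "frac_laplacian s (\<psi> j) x = (LINT y|lborel. jump_kernel s y * (2 * \<psi> j x - \<psi> j (x + y) - \<psi> j (x - y))) / 2" for j
      using Kb[OF C2 dec] by blast
    moreover have "frac_laplacian s \<phi> x = (LINT y|lborel. jump_kernel s y * (2 * \<phi> x - \<phi> (x + y) - \<phi> (x - y))) / 2"
      using Kb[OF \<phi>(2,3)] by blast
    ultimately show ?thesis by (simp only:)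
  qed
  define W where "W = (\<lambda>x. (real DIM('a) + K) * M' * (\<bar>u x\<bar> * tail_weight s x))"
  have W: "integrable lebesgue W" unfolding W_def by (intro integrable_mult_right uw)
  have uL_le: "\<bar>u x * L f x\<bar> \<le> W x" if f: "C2_with f f1 f2" "decaying s N f f1 f2" "N \<le> M'" for f f1 f2 N x
  proof -
    have "\<bar>L f x\<bar> \<le> (real DIM('a) + K) * N * tail_weight s x" by (rule L_le[OF f(1,2)])
    also have "\<dots> \<le> (real DIM('a) + K) * M' * tail_weight s x"
      using f(3) K by (intro mult_right_mono mult_left_mono) auto
    finally have "\<bar>u x\<bar> * \<bar>L f x\<bar> \<le> \<bar>u x\<bar> * ((real DIM('a) + K) * M' * tail_weight s x)" by (intro mult_left_mono) auto
    thus ?thesis by (simp add: W_def abs_mult mult_ac)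
  qed
  have [measurable]: "L (\<psi> j) \<in> borel_measurable lebesgue" for j using Ck by (intro L_meas[OF _ C2 dec]) auto
  have [measurable]: "L \<phi> \<in> borel_measurable lebesgue" by (rule L_meas[OF \<phi>(1,2,3)])
  have int_lim: "(\<lambda>j. LINT x|lebesgue. u x * L (\<psi> j) x) \<longlonglongrightarrow> (LINT x|lebesgue. u x * L \<phi> x)"
  proof (rule integral_dominated_convergence[OF _ _ W])
    show "AE x in lebesgue. (\<lambda>j. u x * L (\<psi> j) x) \<longlonglongrightarrow> u x * L \<phi> x"
      unfolding L_def by (intro AE_I2 tendsto_intros lap_lim frac_lim)
    show "AE x in lebesgue. norm (u x * L (\<psi> j) x) \<le> W x" for j
      using uL_le[OF C2 dec order_refl] by (intro AE_I2) simp
  qed measurable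
  have iL: "integrable lebesgue (\<lambda>x. u x * L \<phi> x)"
  proof (rule Bochner_Integration.integrable_bound[OF W])
    show "AE x in lebesgue. norm (u x * L \<phi> x) \<le> norm (W x)"
      using uL_le[OF \<phi>(2,3) MM'] by (intro AE_I2) (auto intro: order_trans[OF _ abs_ge_self])
  qed measurable
  show "integrable lebesgue (\<lambda>x. u x * (- laplacian \<phi> x + frac_laplacian s \<phi> x))"
    using iL unfolding L_def .
  have \<psi>_meas [measurable]: "\<psi> j \<in> borel_measurable lebesgue" for j
    using meas_b[of "\<psi> j"] Ck by (intro measurable_completion) simp
  have [measurable]: "\<phi> \<in> borel_measurable lebesgue"
    using meas_b[OF \<phi>(1)] by (intro measurable_completion) simp
  have uq_int: "integrable lebesgue (\<lambda>x. u x powr q * \<psi> j x)" for j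
  proof -
    have "set_integrable lebesgue (cball 0 (real (Suc j))) (\<lambda>x. \<bar>u x\<bar> powr q)"
    proof -
      have "Lq_loc q u" using u by (simp add: nonneg_distr_supersolution_def)
      hence "L1_loc (\<lambda>x. \<bar>u x\<bar> powr q)" by (simp add: Lq_loc_def)
      hence "compact (cball 0 (real (Suc j)) :: 'a set) \<longrightarrow> set_integrable lebesgue (cball 0 (real (Suc j))) (\<lambda>x. \<bar>u x\<bar> powr q)"
        unfolding L1_loc_def by (rule spec)
      thus ?thesis using compact_cball by (rule mp)
    qed
    hence "integrable lebesgue (\<lambda>x. M' * (indicator (cball 0 (real (Suc j))) x * \<bar>u x\<bar> powr q))"
      unfolding set_integrable_def by (intro integrable_mult_right) simp
    thus ?thesis
    proof (rule Bochner_Integration.integrable_bound)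
      show "AE x in lebesgue. norm (u x powr q * \<psi> j x) \<le> norm (M' * (indicator (cball 0 (real (Suc j))) x * \<bar>u x\<bar> powr q))"
        using u_nn
      proof eventually_elim
        case (elim x)
        have "\<bar>\<psi> j x\<bar> \<le> M' * tail_weight s x" using dec[of j, unfolded decaying_def, THEN conjunct1] by (rule spec)
        hence "\<psi> j x \<le> M' * tail_weight s x" by linarith
        also have "\<dots> \<le> M' * 1" using M' weight_le_one[OF p0] by (intro mult_left_mono) auto
        finally have le: "\<psi> j x \<le> M'" by simp
        show ?case
        proof (cases "x \<in> cball 0 (real (Suc j))")
          case True
          have "u x powr q * \<psi> j x \<le> u x powr q * M'" using le by (intro mult_left_mono) auto
          thus ?thesis using True elim nn[of j x] M' by (simp add: abs_mult mult.commute)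
        next
          case False
          thus ?thesis by (simp add: supp)
        qed
      qed
    qed measurable
  qed
  have step: "(\<integral>\<^sup>+x. ennreal (u x powr q * \<psi> j x) \<partial>lebesgue) \<le> ennreal (LINT x|lebesgue. u x * L (\<psi> j) x)" for j
  proof -
    have "(\<integral>\<^sup>+x. ennreal (u x powr q * \<psi> j x) \<partial>lebesgue) = ennreal (LINT x|lebesgue. u x powr q * \<psi> j x)"
      using nn by (intro nn_integral_eq_integral uq_int) auto
    also have "\<dots> \<le> ennreal (LINT x|lebesgue. u x * L (\<psi> j) x)"
    proof (rule ennreal_leI)
      have "\<forall>f. test_function f \<and> (\<forall>x. f x \<ge> 0) \<longrightarrow>
          (LINT x|lebesgue. u x * L f x) \<ge> (LINT x|lebesgue. u x powr q * f x)"
        using u unfolding nonneg_distr_supersolution_def L_def by (elim conjE)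
      from this[THEN spec, of "\<psi> j"] test[of j] nn[of j]
      show "(LINT x|lebesgue. u x powr q * \<psi> j x) \<le> (LINT x|lebesgue. u x * L (\<psi> j) x)" by simp
    qed
    finally show ?thesis .
  qed
  have "(\<integral>\<^sup>+x. ennreal (u x powr q * \<phi> x) \<partial>lebesgue) = (\<integral>\<^sup>+x. liminf (\<lambda>j. ennreal (u x powr q * \<psi> j x)) \<partial>lebesgue)"
  proof (intro nn_integral_cong)
    fix x
    have "(\<lambda>j. ennreal (u x powr q * \<psi> j x)) \<longlonglongrightarrow> ennreal (u x powr q * \<phi> x)"
      by (intro tendsto_ennrealI tendsto_intros \<psi>_lim)
    thus "ennreal (u x powr q * \<phi> x) = liminf (\<lambda>j. ennreal (u x powr q * \<psi> j x))"
      by (rule lim_imp_Liminf[OF trivial_limit_sequentially, symmetric])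
  qed
  also have "\<dots> \<le> liminf (\<lambda>j. \<integral>\<^sup>+x. ennreal (u x powr q * \<psi> j x) \<partial>lebesgue)"
    by (intro nn_integral_liminf) measurable
  also have "\<dots> \<le> liminf (\<lambda>j. ennreal (LINT x|lebesgue. u x * L (\<psi> j) x))"
    by (intro Liminf_mono always_eventually allI step)
  also have "\<dots> = ennreal (LINT x|lebesgue. u x * L \<phi> x)"
    by (rule lim_imp_Liminf[OF trivial_limit_sequentially tendsto_ennrealI[OF int_lim]])
  finally show "(\<integral>\<^sup>+x. ennreal (u x powr q * \<phi> x) \<partial>lebesgue) \<le> ennreal (LINT x|lebesgue. u x * (- laplacian \<phi> x + frac_laplacian s \<phi> x))"
    by (simp only: L_def)
qed

section \<open>Regularised heat flow\<close>

text \<open>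
  The phase that translates a wave by \<open>x0\<close>.
\<close>

abbreviation phase :: "'a::euclidean_space \<Rightarrow> 'a \<Rightarrow> real" where
  "phase x0 \<equiv> (\<lambda>\<xi>. - (x0 \<bullet> \<xi>))"

lemma wave_phase: "wave F (phase x0) x = wave F (\<lambda>_. 0) (x - x0)"
  by (simp add: wave_def inner_diff_left)

lemma wave_cmult: "wave (\<lambda>\<xi>. c * F \<xi>) \<theta> x = c * wave F \<theta> x"
  by (simp add: wave_def mult.assoc)

text \<open>
  The Gauss kernel at time a, the fundamental solution of the classical heat equation.
\<close>

definition heat_gaussian :: "real \<Rightarrow> 'a::euclidean_space \<Rightarrow> real" where
  "heat_gaussian a z = (1 / (2 * pi) ^ DIM('a)) * ((pi / a) powr (real DIM('a) / 2) * exp (- (norm z)\<^sup>2 / (4 * a)))"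

text \<open>
  The symbol of the Gauss kernel, with the factor of the inverse Fourier transform included.
\<close>

definition gaussian_symbol :: "real \<Rightarrow> 'a::euclidean_space \<Rightarrow> real" where
  "gaussian_symbol a \<xi> = (1 / (2 * pi) ^ DIM('a)) * exp (- a * (norm \<xi>)\<^sup>2)"

lemma gaussian_symbol_pos [simp]: "gaussian_symbol a \<xi> > 0"
  by (simp add: gaussian_symbol_def)

lemma heat_gaussian_nonneg [simp]: "heat_gaussian a z \<ge> 0"
  by (simp add: heat_gaussian_def)

lemma gaussian_symbol_measurable [measurable]: "gaussian_symbol a \<in> borel_measurable borel"
  unfolding gaussian_symbol_def[abs_def] by measurable

lemma heat_gaussian_measurable [measurable]: "heat_gaussian a \<in> borel_measurable borel"
  unfolding heat_gaussian_def[abs_def] by measurable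

lemma rapid_gaussian_symbol: "a > 0 \<Longrightarrow> rapid (gaussian_symbol a)"
  unfolding gaussian_symbol_def[abs_def] by (intro rapid_cmult rapid_gaussian)

lemma wave_gaussian_symbol:
  fixes x :: "'a::euclidean_space"
  assumes a: "a > 0"
  shows "wave (gaussian_symbol a) (phase x0) x = heat_gaussian a (x - x0)"
  unfolding wave_phase gaussian_symbol_def[abs_def] wave_cmult heat_gaussian_def
  using gaussian_fourier(2)[OF a, of "x - x0"] by (simp add: wave_def)

text \<open>
  Both sides are derivatives of the same function, computed once from the symbol and once from the
  closed form of the Gauss kernel.
\<close>

lemma gaussian_wave_derivatives:
  fixes x x0 :: "'a::euclidean_space"
  assumes a: "a > 0"
  shows "wave_D (gaussian_symbol a) (phase x0) y x
           = - ((x - x0) \<bullet> y) / (2 * a) * heat_gaussian a (x - x0)" (is "?f1 y x = ?g1 y x")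
    and "wave_D2 (gaussian_symbol a) (phase x0) y z x
           = - (z \<bullet> y) / (2 * a) * heat_gaussian a (x - x0)
             + ((x - x0) \<bullet> y) * ((x - x0) \<bullet> z) / (2 * a)\<^sup>2 * heat_gaussian a (x - x0)"
proof -
  have dg: "((\<lambda>x. heat_gaussian a (x - x0)) has_derivative (\<lambda>y. ?g1 y x)) (at x)" for x
  proof -
    define k where "k = 1 / (4 * a)"
    define c where "c = (1 / (2 * pi) ^ DIM('a)) * (pi / a) powr (real DIM('a) / 2)"
    have hg: "heat_gaussian a z = c * exp (- (z \<bullet> z) * k)" for z :: 'a
      by (simp add: heat_gaussian_def c_def k_def power2_norm_eq_inner)
    have "((\<lambda>x. exp (- ((x - x0) \<bullet> (x - x0)) * k)) has_derivative
        (\<lambda>y. exp (- ((x - x0) \<bullet> (x - x0)) * k) * (- ((x - x0) \<bullet> y + y \<bullet> (x - x0)) * k))) (at x)"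
      by (auto intro!: derivative_eq_intros simp: algebra_simps)
    from has_derivative_mult_right[OF this, of c]
    have "((\<lambda>x. heat_gaussian a (x - x0)) has_derivative
        (\<lambda>y. c * (exp (- ((x - x0) \<bullet> (x - x0)) * k) * (- ((x - x0) \<bullet> y + y \<bullet> (x - x0)) * k)))) (at x)"
      unfolding hg .
    moreover have "c * (exp (- ((x - x0) \<bullet> (x - x0)) * k) * (- ((x - x0) \<bullet> y + y \<bullet> (x - x0)) * k)) = ?g1 y x" for y
      using a by (simp add: hg k_def inner_commute[of y] field_simps)
    ultimately show ?thesis by simp
  qed
  have C2: "C2_with (wave (gaussian_symbol a) (phase x0)) ?f1
      (wave_D2 (gaussian_symbol a) (phase x0))"
    by (rule wave_C2_with[OF rapid_gaussian_symbol[OF a]]) measurable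
  have W: "wave (gaussian_symbol a) (phase x0) = (\<lambda>x. heat_gaussian a (x - x0))"
    by (intro ext wave_gaussian_symbol a)
  have f1: "?f1 y x = ?g1 y x" for y x
  proof -
    have "((\<lambda>x. heat_gaussian a (x - x0)) has_derivative (\<lambda>y. ?f1 y x)) (at x)"
      using C2 unfolding C2_with_def W by blast
    from has_derivative_unique[OF this dg] show ?thesis by (rule fun_cong)
  qed
  show "?f1 y x = ?g1 y x" by (rule f1)
  have "(?f1 y has_derivative (\<lambda>z. wave_D2 (gaussian_symbol a) (phase x0) y z x)) (at x)"
    using C2 unfolding C2_with_def by blast
  moreover have "?f1 y = (\<lambda>x. ?g1 y x)" by (intro ext f1)
  ultimately have 1: "((\<lambda>x. ?g1 y x) has_derivative (\<lambda>z. wave_D2 (gaussian_symbol a) (phase x0) y z x)) (at x)"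
    by (simp only:)
  have "((\<lambda>x. - ((x - x0) \<bullet> y) / (2 * a)) has_derivative (\<lambda>z. - (z \<bullet> y) / (2 * a))) (at x)"
    using a by (auto intro!: derivative_eq_intros)
  from has_derivative_unique[OF 1 has_derivative_mult[OF this dg]]
  have "wave_D2 (gaussian_symbol a) (phase x0) y z x
      = - ((x - x0) \<bullet> y) / (2 * a) * ?g1 z x + - (z \<bullet> y) / (2 * a) * heat_gaussian a (x - x0)"
    by (rule fun_cong)
  thus "wave_D2 (gaussian_symbol a) (phase x0) y z x
           = - (z \<bullet> y) / (2 * a) * heat_gaussian a (x - x0)
             + ((x - x0) \<bullet> y) * ((x - x0) \<bullet> z) / (2 * a)\<^sup>2 * heat_gaussian a (x - x0)"
    by (simp add: power2_eq_square)
qed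

text \<open>
  The constant M serves all times a in the interval, as is needed for integrating in time. On the
  interval the Gauss kernel is at most a fixed multiple of \<open>exp (-\<bar>x - x0\<bar>\<^sup>2 / (4 b))\<close>, which
  absorbs the polynomial factors of the derivatives and any power of the weight.
\<close>

lemma gaussian_wave_decaying:
  fixes x0 :: "'a::euclidean_space"
  assumes s: "0 < s" "s < 1" and \<delta>: "0 < \<delta>" "\<delta> \<le> b"
  shows "\<exists>M\<ge>0. \<forall>a. \<delta> \<le> a \<longrightarrow> a \<le> b \<longrightarrow> decaying s M (wave (gaussian_symbol a) (phase x0))
     (wave_D (gaussian_symbol a) (phase x0))
     (wave_D2 (gaussian_symbol a) (phase x0))"
proof -
  define p where "p = real DIM('a) + 2 * s"
  have p: "p \<ge> 0" using s by (simp add: p_def)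
  define \<kappa> where "\<kappa> = 1 / (4 * b)"
  have b: "b > 0" and \<kappa>: "\<kappa> > 0" using \<delta> by (auto simp: \<kappa>_def)
  obtain M0 where M0: "M0 > 0" "\<And>v. v \<ge> 1 \<Longrightarrow> v powr (1 + p / 2) * exp (- \<kappa> * v) \<le> M0"
    using powr_mult_exp_bounded[OF \<kappa>, of "1 + p / 2"] by blast
  define N where "N = M0 * exp (4 * \<kappa>) * (2 + (norm x0)\<^sup>2) powr (p / 2)"
  have N: "N \<ge> 0" using M0 by (simp add: N_def)
  have key: "(4 + (norm (x - x0))\<^sup>2) * exp (- \<kappa> * (norm (x - x0))\<^sup>2) \<le> N * tail_weight s x" for x :: 'a
  proof -
    define v where "v = 4 + (norm (x - x0))\<^sup>2"
    have v: "v \<ge> 1" "v > 0" by (auto simp: v_def add_pos_nonneg)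
    have w: "weight p (x - x0) = v powr (- (p / 2))" by (simp add: weight_def v_def)
    have "v * exp (- \<kappa> * (norm (x - x0))\<^sup>2) = (v powr (1 + p / 2) * exp (- \<kappa> * v)) * exp (4 * \<kappa>) * v powr (- (p / 2))"
    proof -
      have "v powr (1 + p / 2) * v powr (- (p / 2)) = v" using v by (simp flip: powr_add)
      moreover have "exp (- \<kappa> * v) * exp (4 * \<kappa>) = exp (- \<kappa> * (norm (x - x0))\<^sup>2)"
        by (simp add: v_def algebra_simps flip: exp_add)
      moreover have "(v powr (1 + p / 2) * exp (- \<kappa> * v)) * exp (4 * \<kappa>) * v powr (- (p / 2))
          = (v powr (1 + p / 2) * v powr (- (p / 2))) * (exp (- \<kappa> * v) * exp (4 * \<kappa>))"
        by (simp only: mult_ac)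
      ultimately show ?thesis by (simp only:)
    qed
    also have "\<dots> \<le> M0 * exp (4 * \<kappa>) * v powr (- (p / 2))"
      using M0(2)[OF v(1)] by (intro mult_right_mono) auto
    also have "\<dots> \<le> M0 * exp (4 * \<kappa>) * ((2 + (norm x0)\<^sup>2) powr (p / 2) * weight p x)"
      unfolding w[symmetric] using weight_shift[OF p, of "- x0" "(norm x0)\<^sup>2" x] M0(1)
      by (intro mult_left_mono) auto
    finally show ?thesis by (simp add: v_def N_def p_def mult.assoc)
  qed
  define A where "A = (1 / (2 * pi) ^ DIM('a)) * (pi / \<delta>) powr (real DIM('a) / 2)"
  have A: "A \<ge> 0" by (simp add: A_def)
  define D where "D = 1 + 1 / (2 * \<delta>) + 1 / (2 * \<delta>)\<^sup>2"
  have D: "D \<ge> 1" "1 / (2 * \<delta>) \<le> D" "1 / (2 * \<delta>)\<^sup>2 \<le> D" "1 / (2 * \<delta>) + 1 / (2 * \<delta>)\<^sup>2 \<le> D" using \<delta> by (auto simp: D_def)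
  have G: "heat_gaussian a z \<le> A * exp (- \<kappa> * (norm z)\<^sup>2)" if a: "\<delta> \<le> a" "a \<le> b" for a and z :: 'a
  proof -
    have "(pi / a) powr (real DIM('a) / 2) \<le> (pi / \<delta>) powr (real DIM('a) / 2)"
      using a \<delta> by (intro powr_mono2) (auto intro!: divide_left_mono)
    moreover have "exp (- (norm z)\<^sup>2 / (4 * a)) \<le> exp (- \<kappa> * (norm z)\<^sup>2)"
      using a \<delta> by (simp add: \<kappa>_def frac_le)
    ultimately have "(pi / a) powr (real DIM('a) / 2) * exp (- (norm z)\<^sup>2 / (4 * a)) \<le> (pi / \<delta>) powr (real DIM('a) / 2) * exp (- \<kappa> * (norm z)\<^sup>2)"
      by (intro mult_mono) auto
    thus ?thesis unfolding heat_gaussian_def A_def mult.assoc by (intro mult_left_mono) auto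
  qed
  define M where "M = D * A * N"
  have M: "M \<ge> 0" using A N D by (simp add: M_def)
  have bound: "c * heat_gaussian a (x - x0) \<le> M * d * tail_weight s x"
    if a: "\<delta> \<le> a" "a \<le> b" and c: "0 \<le> c" "c \<le> D * d * (4 + (norm (x - x0))\<^sup>2)" and d: "d \<ge> 0" for a c d and x :: 'a
  proof -
    have "c * heat_gaussian a (x - x0) \<le> (D * d * (4 + (norm (x - x0))\<^sup>2)) * (A * exp (- \<kappa> * (norm (x - x0))\<^sup>2))"
      using c by (intro mult_mono G a) auto
    also have "\<dots> = (D * d * A) * ((4 + (norm (x - x0))\<^sup>2) * exp (- \<kappa> * (norm (x - x0))\<^sup>2))" by (simp only: mult_ac)
    also have "\<dots> \<le> (D * d * A) * (N * tail_weight s x)"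
      using D d A by (intro mult_left_mono key mult_nonneg_nonneg) auto
    finally show ?thesis by (simp add: M_def mult_ac)
  qed
  have "decaying s M (wave (gaussian_symbol a) (phase x0))
     (wave_D (gaussian_symbol a) (phase x0))
     (wave_D2 (gaussian_symbol a) (phase x0))"
    if a: "\<delta> \<le> a" "a \<le> b" for a
  proof -
    have a0: "a > 0" using a \<delta> by linarith
    have ia: "1 / (2 * a) \<le> 1 / (2 * \<delta>)" using a \<delta> by (simp add: frac_le)
    have ia2: "1 / (2 * a)\<^sup>2 \<le> 1 / (2 * \<delta>)\<^sup>2" using a \<delta> by (intro divide_left_mono power_mono) auto
    show ?thesis
      unfolding decaying_def wave_gaussian_symbol[OF a0] gaussian_wave_derivatives[OF a0]
    proof (intro conjI allI)
      fix x y :: 'a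
      define r where "r = norm (x - x0)"
      have "2 * r \<le> 1 + r\<^sup>2" using zero_le_power2[of "r - 1"] by (simp add: power2_eq_square algebra_simps)
      moreover have "r \<ge> 0" by (simp add: r_def)
      ultimately have r: "r \<ge> 0" "r \<le> 4 + r\<^sup>2" by linarith+
      show "\<bar>heat_gaussian a (x - x0)\<bar> \<le> M * tail_weight s x"
        using bound[OF a, of 1 1 x] D mult_mono[of 1 D 1 "4 + (norm (x - x0))\<^sup>2"] by simp
      have cs: "\<bar>(x - x0) \<bullet> y\<bar> \<le> r * norm y" unfolding r_def by (rule Cauchy_Schwarz_ineq2)
      have "\<bar>(x - x0) \<bullet> y\<bar> * (1 / (2 * a)) \<le> (r * norm y) * (1 / (2 * a))"
        using cs a0 by (intro mult_right_mono) auto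
      also have "\<dots> \<le> ((4 + r\<^sup>2) * norm y) * D" using ia D a0 r by (intro mult_mono) auto
      finally have "\<bar>(x - x0) \<bullet> y\<bar> * (1 / (2 * a)) * heat_gaussian a (x - x0) \<le> M * norm y * tail_weight s x"
        using a0 by (intro bound[OF a]) (auto simp: r_def mult_ac)
      thus "\<bar>- ((x - x0) \<bullet> y) / (2 * a) * heat_gaussian a (x - x0)\<bar> \<le> M * norm y * tail_weight s x"
        using a0 by (simp add: abs_mult)
      have "\<bar>- (y \<bullet> y) / (2 * a) * heat_gaussian a (x - x0) + ((x - x0) \<bullet> y) * ((x - x0) \<bullet> y) / (2 * a)\<^sup>2 * heat_gaussian a (x - x0)\<bar>
        \<le> ((norm y)\<^sup>2 * (1 / (2 * a)) + ((x - x0) \<bullet> y)\<^sup>2 * (1 / (2 * a)\<^sup>2)) * heat_gaussian a (x - x0)"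
      proof -
        have "\<bar>- P * h + Q * h\<bar> \<le> (P + Q) * h" if "P \<ge> 0" "Q \<ge> 0" "h \<ge> 0" for P Q h :: real
          using that mult_nonneg_nonneg[of P h] mult_nonneg_nonneg[of Q h] by (simp add: distrib_right abs_le_iff)
        from this[of "(y \<bullet> y) * (1 / (2 * a))" "((x - x0) \<bullet> y)\<^sup>2 * (1 / (2 * a)\<^sup>2)" "heat_gaussian a (x - x0)"]
        show ?thesis using a0 unfolding power2_norm_eq_inner by (simp add: power2_eq_square)
      qed
      also have "\<dots> \<le> M * (norm y)\<^sup>2 * tail_weight s x"
      proof (rule bound[OF a])
        show "0 \<le> (norm y)\<^sup>2 * (1 / (2 * a)) + ((x - x0) \<bullet> y)\<^sup>2 * (1 / (2 * a)\<^sup>2)" using a0 by simp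
        have "((x - x0) \<bullet> y)\<^sup>2 \<le> r\<^sup>2 * (norm y)\<^sup>2"
          using power_mono[OF cs, of 2] by (simp add: power_mult_distrib)
        also have "\<dots> \<le> (4 + r\<^sup>2) * (norm y)\<^sup>2" by (intro mult_right_mono) auto
        finally have "((x - x0) \<bullet> y)\<^sup>2 * (1 / (2 * a)\<^sup>2) \<le> ((4 + r\<^sup>2) * (norm y)\<^sup>2) * (1 / (2 * \<delta>)\<^sup>2)"
          using ia2 by (intro mult_mono) auto
        moreover have "(norm y)\<^sup>2 * (1 / (2 * a)) \<le> ((4 + r\<^sup>2) * (norm y)\<^sup>2) * (1 / (2 * \<delta>))"
          using ia a0 mult_right_mono[of 1 "4 + r\<^sup>2" "(norm y)\<^sup>2"] by (intro mult_mono) auto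
        ultimately have "(norm y)\<^sup>2 * (1 / (2 * a)) + ((x - x0) \<bullet> y)\<^sup>2 * (1 / (2 * a)\<^sup>2)
            \<le> ((4 + r\<^sup>2) * (norm y)\<^sup>2) * (1 / (2 * \<delta>) + 1 / (2 * \<delta>)\<^sup>2)" unfolding distrib_left by linarith
        also have "\<dots> \<le> ((4 + r\<^sup>2) * (norm y)\<^sup>2) * D" using D(4) by (intro mult_left_mono) auto
        finally show "(norm y)\<^sup>2 * (1 / (2 * a)) + ((x - x0) \<bullet> y)\<^sup>2 * (1 / (2 * a)\<^sup>2) \<le> D * (norm y)\<^sup>2 * (4 + (norm (x - x0))\<^sup>2)"
          by (simp add: r_def mult_ac)
      qed simp
      finally show "\<bar>- (y \<bullet> y) / (2 * a) * heat_gaussian a (x - x0) + ((x - x0) \<bullet> y) * ((x - x0) \<bullet> y) / (2 * a)\<^sup>2 * heat_gaussian a (x - x0)\<bar>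
         \<le> M * (norm y)\<^sup>2 * tail_weight s x" .
    qed
  qed
  thus ?thesis using M by blast
qed

definition full_symbol :: "real \<Rightarrow> 'a::euclidean_space \<Rightarrow> real" where
  "full_symbol s \<xi> = (norm \<xi>)\<^sup>2 + norm \<xi> powr (2 * s)"

lemma full_symbol_nonneg [simp]: "full_symbol s \<xi> \<ge> 0"
  by (simp add: full_symbol_def)

lemma full_symbol_measurable [measurable]: "full_symbol s \<in> borel_measurable borel"
  unfolding full_symbol_def[abs_def] by measurable

text \<open>
  Apply the one-sided bound to the wave and to its negative; the bound with constant 0, applied to
  the negative, gives the preservation of positivity.
\<close>

lemma wave_evolution_abs:
  assumes s: "0 < s" "s < 1"
  shows "\<exists>K>0. \<forall>F \<theta> t. integrable lborel F \<longrightarrow> \<theta> \<in> borel_measurable borel \<longrightarrow> t \<ge> 0 \<longrightarrow>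
    (\<forall>M\<ge>0. (\<forall>x. \<bar>wave F \<theta> x\<bar> \<le> M * tail_weight s (x::'a::euclidean_space)) \<longrightarrow>
       (\<forall>x. \<bar>wave (\<lambda>\<xi>. F \<xi> * exp (- t * norm \<xi> powr (2 * s))) \<theta> x\<bar> \<le> M * exp (K * t) * tail_weight s x)) \<and>
    ((\<forall>x. wave F \<theta> x \<ge> 0) \<longrightarrow> (\<forall>x. wave (\<lambda>\<xi>. F \<xi> * exp (- t * norm \<xi> powr (2 * s))) \<theta> x \<ge> 0))"
proof -
  obtain K where K: "K > 0" and Kb: "\<And>F \<theta> M t. integrable lborel F \<Longrightarrow> \<theta> \<in> borel_measurable borel \<Longrightarrow> M \<ge> 0 \<Longrightarrow> t \<ge> 0 \<Longrightarrow>
    (\<forall>x. wave F \<theta> x \<le> M * tail_weight s (x::'a)) \<Longrightarrow>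
    (\<forall>x. wave (\<lambda>\<xi>. F \<xi> * exp (- t * norm \<xi> powr (2 * s))) \<theta> x \<le> M * exp (K * t) * tail_weight s x)"
    using wave_evolution_le[OF s, where 'a='a] by (elim exE conjE) simp
  have neg: "wave (\<lambda>\<xi>. - F \<xi> * g \<xi>) \<theta> x = - wave (\<lambda>\<xi>. F \<xi> * g \<xi>) \<theta> x" "wave (\<lambda>\<xi>. - F \<xi>) \<theta> x = - wave F \<theta> x" for F g \<theta> and x :: 'a
    by (simp_all add: wave_def)
  have 1: "\<bar>wave (\<lambda>\<xi>. F \<xi> * exp (- t * norm \<xi> powr (2 * s))) \<theta> x\<bar> \<le> M * exp (K * t) * tail_weight s x"
    if F: "integrable lborel F" "\<theta> \<in> borel_measurable borel" "t \<ge> 0" "M \<ge> 0" and le: "\<forall>x. \<bar>wave F \<theta> x\<bar> \<le> M * tail_weight s (x::'a)"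
    for F \<theta> t M x
  proof -
    have a: "wave F \<theta> x \<le> M * tail_weight s x" "- wave F \<theta> x \<le> M * tail_weight s x" for x
      using le[rule_format, of x] by linarith+
    have "wave (\<lambda>\<xi>. F \<xi> * exp (- t * norm \<xi> powr (2 * s))) \<theta> x \<le> M * exp (K * t) * tail_weight s x"
      using Kb[OF F(1,2,4,3)] a(1) by blast
    moreover have "wave (\<lambda>\<xi>. - F \<xi> * exp (- t * norm \<xi> powr (2 * s))) \<theta> x \<le> M * exp (K * t) * tail_weight s x"
      using Kb[of "\<lambda>\<xi>. - F \<xi>" \<theta> M t] F a(2) by (simp add: neg(2))
    ultimately show ?thesis unfolding neg by linarith
  qed
  have 2: "wave (\<lambda>\<xi>. F \<xi> * exp (- t * norm \<xi> powr (2 * s))) \<theta> x \<ge> 0"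
    if F: "integrable lborel F" "\<theta> \<in> borel_measurable borel" "t \<ge> 0" and le: "\<forall>x. wave F \<theta> x \<ge> 0" for F \<theta> t and x :: 'a
  proof -
    have "wave (\<lambda>\<xi>. - F \<xi> * exp (- t * norm \<xi> powr (2 * s))) \<theta> x \<le> 0 * exp (K * t) * tail_weight s x"
      using Kb[of "\<lambda>\<xi>. - F \<xi>" \<theta> 0 t] F le by (simp add: neg(2))
    thus ?thesis unfolding neg by simp
  qed
  show ?thesis
    by (intro exI[of _ K] conjI allI impI K; (rule 1 2; assumption))
qed

text \<open>
  The heat kernel at time t convolved with the Gauss kernel at time \<open>\<delta>\<close>.
\<close>

definition reg_heat_kernel :: "real \<Rightarrow> real \<Rightarrow> 'a::euclidean_space \<Rightarrow> real \<Rightarrow> real" where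
  "reg_heat_kernel s \<delta> z t = wave (\<lambda>\<xi>. gaussian_symbol \<delta> \<xi> * exp (- t * full_symbol s \<xi>)) (\<lambda>_. 0) z"

text \<open>
  The symbol of the operator that integrates the heat flow over the times from 0 to T.
\<close>

definition time_symbol :: "real \<Rightarrow> real \<Rightarrow> 'a::euclidean_space \<Rightarrow> real" where
  "time_symbol s T \<xi> = (LINT t|lborel. indicator {0..T} t * exp (- t * full_symbol s \<xi>))"

lemma time_symbol_measurable [measurable]: "time_symbol s T \<in> borel_measurable borel"
  unfolding time_symbol_def[abs_def] by measurable

lemma integrable_indicator_Icc: "integrable lborel (indicator {a..b::real} :: real \<Rightarrow> real)"
  by (intro integrable_real_indicator) (simp_all add: emeasure_lborel_Icc_eq)

lemma integrable_Icc_bounded: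
  fixes f :: "real \<Rightarrow> real"
  assumes [measurable]: "f \<in> borel_measurable borel" and B: "\<And>t. 0 \<le> t \<Longrightarrow> t \<le> T \<Longrightarrow> \<bar>f t\<bar> \<le> B"
  shows "integrable lborel (\<lambda>t. indicator {0..T} t * f t)"
proof (rule Bochner_Integration.integrable_bound)
  show "integrable lborel (\<lambda>t::real. B * indicator {0..T} t)"
    by (intro integrable_mult_right integrable_indicator_Icc)
  show "AE t in lborel. norm (indicator {0..T} t * f t) \<le> norm (B * indicator {0..T} t)"
    using B by (intro AE_I2) (auto simp: indicator_def intro: order_trans[OF _ abs_ge_self])
qed measurable

lemma Icc_integral_abs_le:
  fixes f :: "real \<Rightarrow> real"
  assumes [measurable]: "f \<in> borel_measurable borel" and B: "\<And>t. 0 \<le> t \<Longrightarrow> t \<le> T \<Longrightarrow> \<bar>f t\<bar> \<le> B" and T: "T \<ge> 0"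
  shows "\<bar>LINT t|lborel. indicator {0..T} t * f t\<bar> \<le> T * B"
proof -
  have "norm (LINT t|lborel. indicator {0..T} t * f t) \<le> (LINT t|lborel. norm (indicator {0..T} t * f t))"
    by (rule integral_norm_bound)
  also have "\<dots> \<le> (LINT t|lborel. indicator {0..T} t * B)"
  proof (intro integral_mono integrable_norm integrable_mult_left integrable_indicator_Icc)
    show "integrable lborel (\<lambda>t. indicator {0..T} t * f t)" by (rule integrable_Icc_bounded) (use B in auto)
    show "norm (indicator {0..T} t * f t) \<le> indicator {0..T} t * B" for t
      using B[of t] by (auto simp: indicator_def)
  qed
  also have "\<dots> = T * B" using T by simp
  finally show ?thesis by simp
qed

lemma time_symbol_bounds:
  assumes "T \<ge> 0"
  shows "\<bar>time_symbol s T \<xi>\<bar> \<le> T"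
proof -
  have "\<bar>LINT t|lborel. indicator {0..T} t * exp (- t * full_symbol s \<xi>)\<bar> \<le> T * 1"
    using assms by (intro Icc_integral_abs_le) auto
  thus ?thesis by (simp add: time_symbol_def)
qed

text \<open>
  In terms of the operators: applying the generator to the time integral of the flow gives the
  difference of the flow at times 0 and T.
\<close>

lemma full_symbol_time_symbol:
  assumes "T \<ge> 0"
  shows "time_symbol s T \<xi> * full_symbol s \<xi> = 1 - exp (- T * full_symbol s \<xi>)"
proof -
  have "(LINT t|lborel. (full_symbol s \<xi> * exp (- t * full_symbol s \<xi>)) * indicator {0..T} t)
      = - exp (- T * full_symbol s \<xi>) - - exp (- 0 * full_symbol s \<xi>)"
    using assms by (intro integral_FTC_Icc_real) (auto intro!: derivative_eq_intros continuous_intros)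
  moreover have "(LINT t|lborel. (full_symbol s \<xi> * exp (- t * full_symbol s \<xi>)) * indicator {0..T} t)
      = (LINT t|lborel. (indicator {0..T} t * exp (- t * full_symbol s \<xi>)) * full_symbol s \<xi>)"
    by (intro Bochner_Integration.integral_cong refl) (simp only: mult_ac)
  ultimately show ?thesis by (simp add: time_symbol_def)
qed

lemma wave_time_symbol:
  fixes Q \<theta> :: "'a::euclidean_space \<Rightarrow> real"
  assumes Q: "integrable lborel Q" and \<theta> [measurable]: "\<theta> \<in> borel_measurable borel" and T: "T \<ge> 0"
  shows "wave (\<lambda>\<xi>. Q \<xi> * time_symbol s T \<xi>) \<theta> x
    = (LINT t|lborel. indicator {0..T} t * wave (\<lambda>\<xi>. Q \<xi> * exp (- t * full_symbol s \<xi>)) \<theta> x)"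
proof -
  have [measurable]: "Q \<in> borel_measurable borel" using Q by auto
  define f where "f = (\<lambda>t \<xi>. indicator {0..T} t * (Q \<xi> * exp (- t * full_symbol s \<xi>) * cos (x \<bullet> \<xi> + \<theta> \<xi>)))"
  have "(LINT \<xi>|lborel. LINT t|lborel. f t \<xi>) = (LINT t|lborel. LINT \<xi>|lborel. f t \<xi>)"
  proof (rule lborel_integral_swap(1))
    show "integrable lborel (\<lambda>t::real. indicator {0..T} t :: real)" by (rule integrable_indicator_Icc)
    show "integrable lborel (\<lambda>\<xi>. \<bar>Q \<xi>\<bar>)" by (intro integrable_abs Q)
    show "(\<lambda>(t, \<xi>). f t \<xi>) \<in> borel_measurable (lborel \<Otimes>\<^sub>M lborel)" unfolding f_def by measurable
    show "\<bar>f t \<xi>\<bar> \<le> indicator {0..T} t * \<bar>Q \<xi>\<bar>" for t \<xi>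
    proof (cases "t \<in> {0..T}")
      case True
      have "exp (- t * full_symbol s \<xi>) * \<bar>cos (x \<bullet> \<xi> + \<theta> \<xi>)\<bar> \<le> 1 * 1" using True by (intro mult_mono) auto
      hence "\<bar>Q \<xi>\<bar> * (exp (- t * full_symbol s \<xi>) * \<bar>cos (x \<bullet> \<xi> + \<theta> \<xi>)\<bar>) \<le> \<bar>Q \<xi>\<bar> * (1 * 1)" by (intro mult_left_mono) auto
      thus ?thesis using True by (simp add: f_def abs_mult mult.assoc)
    qed (simp add: f_def)
  qed
  moreover have "(LINT t|lborel. f t \<xi>) = Q \<xi> * time_symbol s T \<xi> * cos (x \<bullet> \<xi> + \<theta> \<xi>)" for \<xi>
  proof -
    have "(LINT t|lborel. f t \<xi>) = (LINT t|lborel. (indicator {0..T} t * exp (- t * full_symbol s \<xi>)) * (Q \<xi> * cos (x \<bullet> \<xi> + \<theta> \<xi>)))"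
      unfolding f_def by (intro Bochner_Integration.integral_cong refl) (simp only: mult_ac)
    thus ?thesis by (simp add: time_symbol_def)
  qed
  moreover have "(LINT \<xi>|lborel. f t \<xi>) = indicator {0..T} t * wave (\<lambda>\<xi>. Q \<xi> * exp (- t * full_symbol s \<xi>)) \<theta> x" for t
    by (simp add: f_def wave_def)
  ultimately show ?thesis by (simp add: wave_def)
qed

section \<open>The time-integrated potential\<close>

text \<open>
  The local part of the flow is absorbed into the Gauss kernel, whose time becomes \<open>\<delta> + t\<close>; only
  the fractional part has to be treated as an evolution.
\<close>

lemma gaussian_symbol_exp_full:
  "gaussian_symbol \<delta> \<xi> * exp (- t * full_symbol s \<xi>) = gaussian_symbol (\<delta> + t) \<xi> * exp (- t * norm \<xi> powr (2 * s))"
proof -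
  have "exp (- \<delta> * (norm \<xi>)\<^sup>2) * exp (- t * full_symbol s \<xi>) = exp (- (\<delta> + t) * (norm \<xi>)\<^sup>2) * exp (- t * norm \<xi> powr (2 * s))"
    by (simp add: full_symbol_def algebra_simps flip: exp_add)
  thus ?thesis by (simp add: gaussian_symbol_def mult.assoc)
qed

text \<open>
  Start from the Gauss kernel at time \<open>\<delta> + t\<close>, for which the bounds and the sign are explicit, and
  apply the fractional flow for time t. The derivatives are waves as well, so they evolve in the same way.
\<close>

lemma regularised_flow_bounds:
  fixes x0 :: "'a::euclidean_space"
  assumes s: "0 < s" "s < 1" and \<delta>: "0 < \<delta>" and T: "T \<ge> 0"
  shows "\<exists>M\<ge>0. \<forall>t. 0 \<le> t \<longrightarrow> t \<le> T \<longrightarrow>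
    decaying s M (wave (\<lambda>\<xi>. gaussian_symbol \<delta> \<xi> * exp (- t * full_symbol s \<xi>)) (phase x0))
     (\<lambda>y. wave (\<lambda>\<xi>. gaussian_symbol \<delta> \<xi> * (y \<bullet> \<xi>) * exp (- t * full_symbol s \<xi>)) (\<lambda>\<xi>. - (x0 \<bullet> \<xi>) + pi / 2))
     (\<lambda>y z. wave (\<lambda>\<xi>. gaussian_symbol \<delta> \<xi> * (y \<bullet> \<xi>) * (z \<bullet> \<xi>) * exp (- t * full_symbol s \<xi>)) (\<lambda>\<xi>. - (x0 \<bullet> \<xi>) + pi / 2 + pi / 2))
    \<and> (\<forall>x. wave (\<lambda>\<xi>. gaussian_symbol \<delta> \<xi> * exp (- t * full_symbol s \<xi>)) (phase x0) x \<ge> 0)"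
proof -
  obtain M0 where M0: "M0 \<ge> 0" and M0d: "\<forall>a. \<delta> \<le> a \<longrightarrow> a \<le> \<delta> + T \<longrightarrow> decaying s M0 (wave (gaussian_symbol a) (phase x0))
     (wave_D (gaussian_symbol a) (phase x0))
     (wave_D2 (gaussian_symbol a) (phase x0))"
  proof -
    have le: "\<delta> \<le> \<delta> + T" using T by simp
    show thesis using gaussian_wave_decaying[OF s \<delta> le, of x0] by (elim exE conjE) (rule that)
  qed
  obtain K where K: "K > 0" and Kb: "\<And>F \<theta> t. integrable lborel F \<Longrightarrow> \<theta> \<in> borel_measurable borel \<Longrightarrow> t \<ge> 0 \<Longrightarrow>
    (\<forall>M\<ge>0. (\<forall>x. \<bar>wave F \<theta> x\<bar> \<le> M * tail_weight s (x::'a)) \<longrightarrow>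
       (\<forall>x. \<bar>wave (\<lambda>\<xi>. F \<xi> * exp (- t * norm \<xi> powr (2 * s))) \<theta> x\<bar> \<le> M * exp (K * t) * tail_weight s x)) \<and>
    ((\<forall>x. wave F \<theta> x \<ge> 0) \<longrightarrow> (\<forall>x. wave (\<lambda>\<xi>. F \<xi> * exp (- t * norm \<xi> powr (2 * s))) \<theta> x \<ge> 0))"
    using wave_evolution_abs[OF s, where 'a='a] by (elim exE conjE) simp
  have abs: "\<bar>wave (\<lambda>\<xi>. F \<xi> * exp (- t * norm \<xi> powr (2 * s))) \<theta> x\<bar> \<le> M * exp (K * T) * tail_weight s x"
    if "integrable lborel F" "\<theta> \<in> borel_measurable borel" "t \<ge> 0" "t \<le> T" "M \<ge> 0" "\<And>x. \<bar>wave F \<theta> x\<bar> \<le> M * tail_weight s (x::'a)"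
    for F \<theta> t M x
  proof -
    have "\<bar>wave (\<lambda>\<xi>. F \<xi> * exp (- t * norm \<xi> powr (2 * s))) \<theta> x\<bar> \<le> M * exp (K * t) * tail_weight s x"
      using Kb[OF that(1,2,3)] that(5,6) by simp
    also have "\<dots> \<le> M * exp (K * T) * tail_weight s x"
      using that K by (intro mult_right_mono mult_left_mono) auto
    finally show ?thesis .
  qed
  have "decaying s (M0 * exp (K * T)) (wave (\<lambda>\<xi>. gaussian_symbol \<delta> \<xi> * exp (- t * full_symbol s \<xi>)) (phase x0))
     (\<lambda>y. wave (\<lambda>\<xi>. gaussian_symbol \<delta> \<xi> * (y \<bullet> \<xi>) * exp (- t * full_symbol s \<xi>)) (\<lambda>\<xi>. - (x0 \<bullet> \<xi>) + pi / 2))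
     (\<lambda>y z. wave (\<lambda>\<xi>. gaussian_symbol \<delta> \<xi> * (y \<bullet> \<xi>) * (z \<bullet> \<xi>) * exp (- t * full_symbol s \<xi>)) (\<lambda>\<xi>. - (x0 \<bullet> \<xi>) + pi / 2 + pi / 2))
    \<and> (\<forall>x. wave (\<lambda>\<xi>. gaussian_symbol \<delta> \<xi> * exp (- t * full_symbol s \<xi>)) (phase x0) x \<ge> 0)"
    if t: "0 \<le> t" "t \<le> T" for t
  proof -
    let ?a = "\<delta> + t"
    have a: "?a > 0" "\<delta> \<le> ?a" "?a \<le> \<delta> + T" using t \<delta> by auto
    have r: "rapid (gaussian_symbol ?a :: 'a \<Rightarrow> real)" by (rule rapid_gaussian_symbol[OF a(1)])
    have d: "decaying s M0 (wave (gaussian_symbol ?a) (phase x0))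
     (wave_D (gaussian_symbol ?a) (phase x0))
     (wave_D2 (gaussian_symbol ?a) (phase x0))"
      using M0d a by simp
    have e0: "gaussian_symbol \<delta> \<xi> * exp (- t * full_symbol s \<xi>) = gaussian_symbol ?a \<xi> * exp (- t * norm \<xi> powr (2 * s))" for \<xi> :: 'a
      by (rule gaussian_symbol_exp_full)
    have e1: "gaussian_symbol \<delta> \<xi> * (y \<bullet> \<xi>) * exp (- t * full_symbol s \<xi>) = gaussian_symbol ?a \<xi> * (y \<bullet> \<xi>) * exp (- t * norm \<xi> powr (2 * s))" for \<xi> y :: 'a
      using arg_cong[OF e0[of \<xi>], of "\<lambda>v. v * (y \<bullet> \<xi>)"] by (simp only: mult_ac)
    have e2: "gaussian_symbol \<delta> \<xi> * (y \<bullet> \<xi>) * (z \<bullet> \<xi>) * exp (- t * full_symbol s \<xi>) = gaussian_symbol ?a \<xi> * (y \<bullet> \<xi>) * (z \<bullet> \<xi>) * exp (- t * norm \<xi> powr (2 * s))" for \<xi> y z :: 'a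
      using arg_cong[OF e0[of \<xi>], of "\<lambda>v. v * (y \<bullet> \<xi>) * (z \<bullet> \<xi>)"] by (simp only: mult_ac)
    have b0: "\<bar>wave (\<lambda>\<xi>. gaussian_symbol ?a \<xi> * exp (- t * norm \<xi> powr (2 * s))) (phase x0) x\<bar> \<le> M0 * exp (K * T) * tail_weight s x" for x
      using d by (intro abs rapid_integrable r t M0) (auto simp: decaying_def)
    have b1: "\<bar>wave (\<lambda>\<xi>. gaussian_symbol ?a \<xi> * (y \<bullet> \<xi>) * exp (- t * norm \<xi> powr (2 * s))) (\<lambda>\<xi>. - (x0 \<bullet> \<xi>) + pi / 2) x\<bar>
        \<le> (M0 * norm y) * exp (K * T) * tail_weight s x" for x y
      using d M0 by (intro abs rapid_integrable rapid_inner r t) (auto simp: decaying_def)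
    have b2: "\<bar>wave (\<lambda>\<xi>. gaussian_symbol ?a \<xi> * (y \<bullet> \<xi>) * (y \<bullet> \<xi>) * exp (- t * norm \<xi> powr (2 * s))) (\<lambda>\<xi>. - (x0 \<bullet> \<xi>) + pi / 2 + pi / 2) x\<bar>
        \<le> (M0 * (norm y)\<^sup>2) * exp (K * T) * tail_weight s x" for x y
      using d M0 by (intro abs rapid_integrable rapid_inner r t) (auto simp: decaying_def)
    have nn: "wave (\<lambda>\<xi>. gaussian_symbol ?a \<xi> * exp (- t * norm \<xi> powr (2 * s))) (phase x0) x \<ge> 0" for x
      using Kb[OF rapid_integrable[OF r], of "\<lambda>\<xi>. - (x0 \<bullet> \<xi>)" t] t by (simp add: wave_gaussian_symbol[OF a(1)])
    show ?thesis
      unfolding e0 e1 e2 decaying_def using b0 b1 b2 nn by (simp only: mult_ac simp_thms)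
  qed
  moreover have "M0 * exp (K * T) \<ge> 0" using M0 by simp
  ultimately show ?thesis by blast
qed

text \<open>
  The function \<open>\<Phi>\<close> is the time integral of the regularised heat kernel centred at \<open>x0\<close>. It is an
  admissible test function because the bounds on the flow integrate over the bounded time
  interval, and its image under the operator is the Gauss kernel minus the nonnegative flow at time T.
\<close>

lemma potential_properties:
  fixes x0 :: "'a::euclidean_space"
  assumes s: "0 < s" "s < 1" and \<delta>: "0 < \<delta>" and T: "T \<ge> 0"
  defines "\<Phi> \<equiv> wave (\<lambda>\<xi>. gaussian_symbol \<delta> \<xi> * time_symbol s T \<xi>) (phase x0)"
  shows "\<forall>k. C_k k \<Phi>"
    and "\<exists>M \<Phi>1 \<Phi>2. C2_with \<Phi> \<Phi>1 \<Phi>2 \<and> decaying s M \<Phi> \<Phi>1 \<Phi>2"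
    and "\<Phi> x \<ge> 0"
    and "- laplacian \<Phi> x + frac_laplacian s \<Phi> x \<le> heat_gaussian \<delta> (x - x0)"
    and "ennreal (\<Phi> x) = (\<integral>\<^sup>+t. indicator {0..T} t * ennreal (reg_heat_kernel s \<delta> (x - x0) t) \<partial>lborel)"
    and "0 \<le> t \<Longrightarrow> t \<le> T \<Longrightarrow> reg_heat_kernel s \<delta> (x - x0) t \<ge> 0"
proof -
  let ?\<theta> = "\<lambda>\<xi>. - (x0 \<bullet> \<xi>)"
  define F where "F = (\<lambda>\<xi>::'a. gaussian_symbol \<delta> \<xi> * time_symbol s T \<xi>)"
  have g: "rapid (gaussian_symbol \<delta> :: 'a \<Rightarrow> real)" by (rule rapid_gaussian_symbol[OF \<delta>])
  have F: "rapid F" unfolding F_def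
    by (rule rapid_mult_le[OF g, where B = T and m = 0]) (use time_symbol_bounds[OF T] in auto)
  have \<theta> [measurable]: "?\<theta> \<in> borel_measurable borel" by measurable
  have \<Phi>: "\<Phi> = wave F ?\<theta>" by (simp add: \<Phi>_def F_def)
  show "\<forall>k. C_k k \<Phi>" unfolding \<Phi> by (intro allI wave_C_k F \<theta>)
  obtain M where M: "M \<ge> 0" and Md: "\<forall>t. 0 \<le> t \<longrightarrow> t \<le> T \<longrightarrow>
    decaying s M (wave (\<lambda>\<xi>. gaussian_symbol \<delta> \<xi> * exp (- t * full_symbol s \<xi>)) ?\<theta>)
     (\<lambda>y. wave (\<lambda>\<xi>. gaussian_symbol \<delta> \<xi> * (y \<bullet> \<xi>) * exp (- t * full_symbol s \<xi>)) (\<lambda>\<xi>. - (x0 \<bullet> \<xi>) + pi / 2))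
     (\<lambda>y z. wave (\<lambda>\<xi>. gaussian_symbol \<delta> \<xi> * (y \<bullet> \<xi>) * (z \<bullet> \<xi>) * exp (- t * full_symbol s \<xi>)) (\<lambda>\<xi>. - (x0 \<bullet> \<xi>) + pi / 2 + pi / 2))
    \<and> (\<forall>x. wave (\<lambda>\<xi>. gaussian_symbol \<delta> \<xi> * exp (- t * full_symbol s \<xi>)) ?\<theta> x \<ge> 0)"
    using regularised_flow_bounds[OF s \<delta> T, of x0] by (elim exE conjE) simp
  have nn: "wave (\<lambda>\<xi>. gaussian_symbol \<delta> \<xi> * exp (- t * full_symbol s \<xi>)) ?\<theta> x \<ge> 0" if "0 \<le> t" "t \<le> T" for t x
    using Md that by simp
  have reg: "wave (\<lambda>\<xi>. gaussian_symbol \<delta> \<xi> * exp (- t * full_symbol s \<xi>)) ?\<theta> x = reg_heat_kernel s \<delta> (x - x0) t" for t x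
    unfolding wave_phase reg_heat_kernel_def ..
  show "0 \<le> t \<Longrightarrow> t \<le> T \<Longrightarrow> reg_heat_kernel s \<delta> (x - x0) t \<ge> 0"
    using nn[of t x] unfolding reg by simp
  have wm: "(\<lambda>t. wave (\<lambda>\<xi>. Q \<xi> * exp (- t * full_symbol s \<xi>)) \<theta>' x) \<in> borel_measurable borel"
    if [measurable]: "Q \<in> borel_measurable borel" "\<theta>' \<in> borel_measurable borel" for Q \<theta>' and x :: 'a
    unfolding wave_def by measurable
  have b0: "\<bar>wave (\<lambda>\<xi>. gaussian_symbol \<delta> \<xi> * exp (- t * full_symbol s \<xi>)) ?\<theta> x\<bar> \<le> M * tail_weight s x"
    and b1: "\<bar>wave (\<lambda>\<xi>. gaussian_symbol \<delta> \<xi> * (y \<bullet> \<xi>) * exp (- t * full_symbol s \<xi>)) (\<lambda>\<xi>. - (x0 \<bullet> \<xi>) + pi / 2) x\<bar> \<le> M * norm y * tail_weight s x"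
    and b2: "\<bar>wave (\<lambda>\<xi>. gaussian_symbol \<delta> \<xi> * (y \<bullet> \<xi>) * (y \<bullet> \<xi>) * exp (- t * full_symbol s \<xi>)) (\<lambda>\<xi>. - (x0 \<bullet> \<xi>) + pi / 2 + pi / 2) x\<bar> \<le> M * (norm y)\<^sup>2 * tail_weight s x"
    if "0 \<le> t" "t \<le> T" for t x y
  proof -
    note D = Md[THEN spec, THEN mp, THEN mp, OF that, THEN conjunct1, unfolded decaying_def]
    show "\<bar>wave (\<lambda>\<xi>. gaussian_symbol \<delta> \<xi> * exp (- t * full_symbol s \<xi>)) ?\<theta> x\<bar> \<le> M * tail_weight s x"
      by (rule D[THEN conjunct1, THEN spec])
    show "\<bar>wave (\<lambda>\<xi>. gaussian_symbol \<delta> \<xi> * (y \<bullet> \<xi>) * exp (- t * full_symbol s \<xi>)) (\<lambda>\<xi>. - (x0 \<bullet> \<xi>) + pi / 2) x\<bar> \<le> M * norm y * tail_weight s x"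
      by (rule D[THEN conjunct2, THEN conjunct1, THEN spec, THEN spec])
    show "\<bar>wave (\<lambda>\<xi>. gaussian_symbol \<delta> \<xi> * (y \<bullet> \<xi>) * (y \<bullet> \<xi>) * exp (- t * full_symbol s \<xi>)) (\<lambda>\<xi>. - (x0 \<bullet> \<xi>) + pi / 2 + pi / 2) x\<bar> \<le> M * (norm y)\<^sup>2 * tail_weight s x"
      by (rule D[THEN conjunct2, THEN conjunct2, THEN spec, THEN spec])
  qed
  have C2: "C2_with \<Phi> (wave_D F (phase x0))
     (wave_D2 F (phase x0))"
    unfolding \<Phi> by (rule wave_C2_with[OF F \<theta>])
  have t0: "wave F ?\<theta> x = (LINT t|lborel. indicator {0..T} t * wave (\<lambda>\<xi>. gaussian_symbol \<delta> \<xi> * exp (- t * full_symbol s \<xi>)) ?\<theta> x)" for x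
    unfolding F_def by (rule wave_time_symbol[OF rapid_integrable[OF g] \<theta> T])
  have t1: "wave_D F (phase x0) y x
      = (LINT t|lborel. indicator {0..T} t * wave (\<lambda>\<xi>. gaussian_symbol \<delta> \<xi> * (y \<bullet> \<xi>) * exp (- t * full_symbol s \<xi>)) (\<lambda>\<xi>. - (x0 \<bullet> \<xi>) + pi / 2) x)" for x y
  proof -
    have "(\<lambda>\<xi>. F \<xi> * (y \<bullet> \<xi>)) = (\<lambda>\<xi>. (gaussian_symbol \<delta> \<xi> * (y \<bullet> \<xi>)) * time_symbol s T \<xi>)" by (simp add: F_def mult_ac)
    thus ?thesis by (simp only:) (subst wave_time_symbol[OF rapid_integrable[OF rapid_inner[OF g]] _ T]; simp)
  qed
  have t2: "wave_D2 F (phase x0) y y x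
      = (LINT t|lborel. indicator {0..T} t * wave (\<lambda>\<xi>. gaussian_symbol \<delta> \<xi> * (y \<bullet> \<xi>) * (y \<bullet> \<xi>) * exp (- t * full_symbol s \<xi>)) (\<lambda>\<xi>. - (x0 \<bullet> \<xi>) + pi / 2 + pi / 2) x)" for x y
  proof -
    have "(\<lambda>\<xi>. F \<xi> * (y \<bullet> \<xi>) * (y \<bullet> \<xi>)) = (\<lambda>\<xi>. (gaussian_symbol \<delta> \<xi> * (y \<bullet> \<xi>) * (y \<bullet> \<xi>)) * time_symbol s T \<xi>)" by (simp add: F_def mult_ac)
    thus ?thesis by (simp only:) (subst wave_time_symbol[OF rapid_integrable[OF rapid_inner[OF rapid_inner[OF g]]] _ T]; simp)
  qed
  have "decaying s (T * M) \<Phi> (wave_D F (phase x0))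
     (wave_D2 F (phase x0))"
    unfolding decaying_def \<Phi> t0 t1 t2
  proof (intro conjI allI)
    fix x y :: 'a
    show "\<bar>LINT t|lborel. indicator {0..T} t * wave (\<lambda>\<xi>. gaussian_symbol \<delta> \<xi> * exp (- t * full_symbol s \<xi>)) ?\<theta> x\<bar> \<le> T * M * tail_weight s x"
      unfolding mult.assoc[of T] by (rule Icc_integral_abs_le[OF wm b0 T]) measurable
    show "\<bar>LINT t|lborel. indicator {0..T} t * wave (\<lambda>\<xi>. gaussian_symbol \<delta> \<xi> * (y \<bullet> \<xi>) * exp (- t * full_symbol s \<xi>)) (\<lambda>\<xi>. - (x0 \<bullet> \<xi>) + pi / 2) x\<bar> \<le> T * M * norm y * tail_weight s x"
      unfolding mult.assoc[of T] mult.assoc[of T "M * _"] by (rule Icc_integral_abs_le[OF wm b1 T]) measurable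
    show "\<bar>LINT t|lborel. indicator {0..T} t * wave (\<lambda>\<xi>. gaussian_symbol \<delta> \<xi> * (y \<bullet> \<xi>) * (y \<bullet> \<xi>) * exp (- t * full_symbol s \<xi>)) (\<lambda>\<xi>. - (x0 \<bullet> \<xi>) + pi / 2 + pi / 2) x\<bar> \<le> T * M * (norm y)\<^sup>2 * tail_weight s x"
      unfolding mult.assoc[of T] mult.assoc[of T "M * _"] by (rule Icc_integral_abs_le[OF wm b2 T]) measurable
  qed
  with C2 show "\<exists>M \<Phi>1 \<Phi>2. C2_with \<Phi> \<Phi>1 \<Phi>2 \<and> decaying s M \<Phi> \<Phi>1 \<Phi>2"
    by (intro exI conjI)
  have int_t: "integrable lborel (\<lambda>t. indicator {0..T} t * wave (\<lambda>\<xi>. gaussian_symbol \<delta> \<xi> * exp (- t * full_symbol s \<xi>)) ?\<theta> x)" for x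
    by (rule integrable_Icc_bounded[OF wm b0]) measurable
  have ind_nn: "indicator {0..T} t * wave (\<lambda>\<xi>. gaussian_symbol \<delta> \<xi> * exp (- t * full_symbol s \<xi>)) ?\<theta> x \<ge> 0" for t x
    using nn[of t x] by (auto simp: indicator_def)
  show "\<Phi> x \<ge> 0" unfolding \<Phi> t0 by (intro Bochner_Integration.integral_nonneg ind_nn)
  show "ennreal (\<Phi> x) = (\<integral>\<^sup>+t. indicator {0..T} t * ennreal (reg_heat_kernel s \<delta> (x - x0) t) \<partial>lborel)"
  proof -
    have "ennreal (\<Phi> x) = (\<integral>\<^sup>+t. ennreal (indicator {0..T} t * wave (\<lambda>\<xi>. gaussian_symbol \<delta> \<xi> * exp (- t * full_symbol s \<xi>)) ?\<theta> x) \<partial>lborel)"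
      unfolding \<Phi> t0 using ind_nn by (intro nn_integral_eq_integral[symmetric] int_t) auto
    also have "\<dots> = (\<integral>\<^sup>+t. indicator {0..T} t * ennreal (reg_heat_kernel s \<delta> (x - x0) t) \<partial>lborel)"
      unfolding reg by (intro nn_integral_cong) (auto simp: indicator_def)
    finally show ?thesis .
  qed
  show "- laplacian \<Phi> x + frac_laplacian s \<Phi> x \<le> heat_gaussian \<delta> (x - x0)"
  proof -
    have Fm [measurable]: "F \<in> borel_measurable borel" using F by (simp add: rapid_def)
    have bF: "integrable lborel (\<lambda>\<xi>. F \<xi> * (norm \<xi>)\<^sup>2 * cos (x \<bullet> \<xi> + ?\<theta> \<xi>))"
    proof (intro integrable_wave \<theta>)
      have "integrable lborel (\<lambda>\<xi>. norm \<xi> ^ 2 * F \<xi>)" using F unfolding rapid_def by (elim conjE allE)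
      thus "integrable lborel (\<lambda>\<xi>. F \<xi> * (norm \<xi>)\<^sup>2)" by (simp add: mult.commute)
    qed
    have bG: "integrable lborel (\<lambda>\<xi>. (F \<xi> * full_symbol s \<xi>) * cos (x \<bullet> \<xi> + ?\<theta> \<xi>))"
      and gG: "F \<xi> * full_symbol s \<xi> = gaussian_symbol \<delta> \<xi> - gaussian_symbol \<delta> \<xi> * exp (- T * full_symbol s \<xi>)" for \<xi>
    proof -
      show gG: "F \<xi> * full_symbol s \<xi> = gaussian_symbol \<delta> \<xi> - gaussian_symbol \<delta> \<xi> * exp (- T * full_symbol s \<xi>)" for \<xi>
        unfolding F_def mult.assoc full_symbol_time_symbol[OF T] by (simp add: right_diff_distrib)
      have "integrable lborel (\<lambda>\<xi>::'a. gaussian_symbol \<delta> \<xi> * exp (- T * full_symbol s \<xi>))"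
        by (rule integrable_mult_bounded[OF rapid_integrable[OF g], of _ 1]) (use T in auto)
      thus "integrable lborel (\<lambda>\<xi>. (F \<xi> * full_symbol s \<xi>) * cos (x \<bullet> \<xi> + ?\<theta> \<xi>))"
        unfolding gG by (intro integrable_wave[OF Bochner_Integration.integrable_diff[OF rapid_integrable[OF g]] \<theta>])
    qed
    have bH: "integrable lborel (\<lambda>\<xi>. F \<xi> * norm \<xi> powr (2 * s) * cos (x \<bullet> \<xi> + ?\<theta> \<xi>))"
      using Bochner_Integration.integrable_diff[OF bG bF] by (simp add: full_symbol_def algebra_simps)
    have "- laplacian \<Phi> x + frac_laplacian s \<Phi> x = wave (\<lambda>\<xi>. F \<xi> * (norm \<xi>)\<^sup>2) ?\<theta> x + wave (\<lambda>\<xi>. F \<xi> * norm \<xi> powr (2 * s)) ?\<theta> x"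
      unfolding \<Phi> laplacian_wave[OF F \<theta>] frac_laplacian_wave[OF s F \<theta>] by simp
    also have "\<dots> = wave (\<lambda>\<xi>. F \<xi> * full_symbol s \<xi>) ?\<theta> x"
      unfolding wave_def Bochner_Integration.integral_add[OF bF bH, symmetric]
      by (simp add: full_symbol_def algebra_simps)
    also have "\<dots> = wave (gaussian_symbol \<delta>) ?\<theta> x - wave (\<lambda>\<xi>. gaussian_symbol \<delta> \<xi> * exp (- T * full_symbol s \<xi>)) ?\<theta> x"
    proof -
      have i1: "integrable lborel (\<lambda>\<xi>. gaussian_symbol \<delta> \<xi> * cos (x \<bullet> \<xi> + ?\<theta> \<xi>))"
        by (intro integrable_wave \<theta> rapid_integrable g)
      have "integrable lborel (\<lambda>\<xi>::'a. gaussian_symbol \<delta> \<xi> * exp (- T * full_symbol s \<xi>))"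
        by (rule integrable_mult_bounded[OF rapid_integrable[OF g], of _ 1]) (use T in auto)
      from integrable_wave[OF this \<theta>, of x]
      have i2: "integrable lborel (\<lambda>\<xi>. gaussian_symbol \<delta> \<xi> * exp (- T * full_symbol s \<xi>) * cos (x \<bullet> \<xi> + ?\<theta> \<xi>))" .
      show ?thesis unfolding wave_def Bochner_Integration.integral_diff[OF i1 i2, symmetric] gG left_diff_distrib ..
    qed
    also have "\<dots> \<le> wave (gaussian_symbol \<delta>) ?\<theta> x" using nn[of T x] T by simp
    also have "\<dots> = heat_gaussian \<delta> (x - x0)" by (rule wave_gaussian_symbol[OF \<delta>])
    finally show ?thesis .
  qed
qed

text \<open>
  The theorem with the point mass at \<open>x0\<close> replaced by a Gauss kernel and with finite time horizon.
\<close>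

lemma supersolution_potential_le:
  fixes u :: "'a::euclidean_space \<Rightarrow> real" and x0 :: 'a
  assumes s: "0 < s" "s < 1" and u: "nonneg_distr_supersolution s q u" and \<delta>: "0 < \<delta>" and T: "T \<ge> 0"
  shows "(\<integral>\<^sup>+x. ennreal (u x powr q) * (\<integral>\<^sup>+t. indicator {0..T} t * ennreal (reg_heat_kernel s \<delta> (x - x0) t) \<partial>lborel) \<partial>lebesgue)
     \<le> (\<integral>\<^sup>+x. ennreal (u x) * ennreal (heat_gaussian \<delta> (x - x0)) \<partial>lebesgue)"
proof -
  define \<Phi> where "\<Phi> = wave (\<lambda>\<xi>. gaussian_symbol \<delta> \<xi> * time_symbol s T \<xi>) (phase x0)"
  note P = potential_properties[OF s \<delta> T, where ?x0.0 = x0, folded \<Phi>_def]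
  obtain M \<Phi>1 \<Phi>2 where d: "C2_with \<Phi> \<Phi>1 \<Phi>2" "decaying s M \<Phi> \<Phi>1 \<Phi>2" using P(2) by (elim exE conjE)
  note t = supersolution_test_decaying[OF s u P(1) d P(3)]
  let ?L = "\<lambda>x. u x * (- laplacian \<Phi> x + frac_laplacian s \<Phi> x)"
  have "(\<integral>\<^sup>+x. ennreal (u x powr q) * (\<integral>\<^sup>+t. indicator {0..T} t * ennreal (reg_heat_kernel s \<delta> (x - x0) t) \<partial>lborel) \<partial>lebesgue)
     = (\<integral>\<^sup>+x. ennreal (u x powr q * \<Phi> x) \<partial>lebesgue)"
    unfolding P(5)[symmetric] by (intro nn_integral_cong) (simp add: ennreal_mult')
  also have "\<dots> \<le> ennreal (LINT x|lebesgue. ?L x)" by (rule t(1))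
  also have "\<dots> \<le> ennreal (LINT x|lebesgue. max 0 (?L x))"
    by (intro ennreal_leI integral_mono integrable_max t(2)) auto
  also have "\<dots> = (\<integral>\<^sup>+x. ennreal (max 0 (?L x)) \<partial>lebesgue)"
    by (intro nn_integral_eq_integral[symmetric] integrable_max t(2)) auto
  also have "\<dots> \<le> (\<integral>\<^sup>+x. ennreal (u x) * ennreal (heat_gaussian \<delta> (x - x0)) \<partial>lebesgue)"
  proof (rule nn_integral_mono_AE)
    have "AE x in lebesgue. u x \<ge> 0" using u by (simp add: nonneg_distr_supersolution_def)
    thus "AE x in lebesgue. ennreal (max 0 (?L x)) \<le> ennreal (u x) * ennreal (heat_gaussian \<delta> (x - x0))"
    proof eventually_elim
      case (elim x)
      have "?L x \<le> u x * heat_gaussian \<delta> (x - x0)" by (intro mult_left_mono P(4) elim)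
      moreover have "0 \<le> u x * heat_gaussian \<delta> (x - x0)" using elim by simp
      ultimately have "ennreal (max 0 (?L x)) \<le> ennreal (u x * heat_gaussian \<delta> (x - x0))" by (intro ennreal_leI) simp
      thus ?case using elim by (simp add: ennreal_mult')
    qed
  qed
  finally show ?thesis .
qed

section \<open>The heat kernel as a limit\<close>

lemma integrable_exp_full_symbol:
  assumes "t > 0"
  shows "integrable lborel (\<lambda>\<xi>::'a::euclidean_space. exp (- t * full_symbol s \<xi>))"
proof (rule Bochner_Integration.integrable_bound)
  show "integrable lborel (\<lambda>\<xi>::'a. exp (- t * (norm \<xi>)\<^sup>2))"
    by (rule rapid_integrable[OF rapid_gaussian[OF assms]])
  show "AE \<xi>::'a in lborel. norm (exp (- t * full_symbol s \<xi>)) \<le> norm (exp (- t * (norm \<xi>)\<^sup>2))"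
    using assms by (intro AE_I2) (simp add: full_symbol_def)
qed measurable

lemma heat_kernel_eq_wave:
  fixes z :: "'a::euclidean_space"
  assumes t: "t > 0"
  shows "heat_kernel s z t = wave (\<lambda>\<xi>. 1 / (2 * pi) ^ DIM('a) * exp (- t * full_symbol s \<xi>)) (\<lambda>_. 0) z"
proof -
  define f where "f = (\<lambda>\<xi>::'a. exp (complex_of_real (- t * ((norm \<xi>)\<^sup>2 + norm \<xi> powr (2 * s))) + \<i> * complex_of_real (z \<bullet> \<xi>)))"
  have f: "f \<xi> = complex_of_real (exp (- t * full_symbol s \<xi>)) * cis (z \<bullet> \<xi>)" for \<xi>
  proof -
    have "f \<xi> = exp (complex_of_real (- t * full_symbol s \<xi>)) * exp (\<i> * complex_of_real (z \<bullet> \<xi>))"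
      by (simp only: f_def full_symbol_def exp_add)
    thus ?thesis by (simp only: cis_conv_exp exp_of_real)
  qed
  have [measurable]: "f \<in> borel_measurable borel" unfolding f_def by measurable
  have int: "integrable lborel f"
  proof (rule Bochner_Integration.integrable_bound[OF integrable_exp_full_symbol[OF t]])
    show "AE \<xi> in lborel. norm (f \<xi>) \<le> norm (exp (- t * full_symbol s \<xi>))"
      by (intro AE_I2) (simp add: f norm_mult)
  qed measurable
  have "Re (integral\<^sup>L lborel f) = (LINT \<xi>|lborel. Re (f \<xi>))"
    by (rule integral_bounded_linear[OF bounded_linear_Re int, symmetric])
  also have "\<dots> = (LINT \<xi>|lborel. exp (- t * full_symbol s \<xi>) * cos (z \<bullet> \<xi>))"
    by (simp add: f)
  finally have R: "Re (integral\<^sup>L lborel f) = (LINT \<xi>|lborel. exp (- t * full_symbol s \<xi>) * cos (z \<bullet> \<xi>))" .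
  have c: "1 / (2 * complex_of_real pi) ^ DIM('a) = complex_of_real (1 / (2 * pi) ^ DIM('a))" by simp
  have "heat_kernel s z t = Re (complex_of_real (1 / (2 * pi) ^ DIM('a)) * integral\<^sup>L lebesgue f)"
    unfolding heat_kernel_def f_def c ..
  also have "\<dots> = 1 / (2 * pi) ^ DIM('a) * Re (integral\<^sup>L lborel f)"
    by (subst integral_completion) (simp_all add: Re_complex_of_real del: of_real_divide of_real_power)
  finally show ?thesis unfolding R by (simp add: wave_def mult.assoc)
qed

lemma reg_heat_kernel_tendsto:
  fixes z :: "'a::euclidean_space"
  assumes t: "t > 0"
  shows "(\<lambda>k. reg_heat_kernel s (1 / real (Suc k)) z t) \<longlonglongrightarrow> heat_kernel s z t"
  unfolding heat_kernel_eq_wave[OF t] reg_heat_kernel_def wave_def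
proof (rule integral_dominated_convergence[where w = "\<lambda>\<xi>. 1 / (2 * pi) ^ DIM('a) * exp (- t * full_symbol s \<xi>)"])
  show "integrable lborel (\<lambda>\<xi>::'a. 1 / (2 * pi) ^ DIM('a) * exp (- t * full_symbol s \<xi>))"
    by (intro integrable_mult_right integrable_exp_full_symbol t)
  show "AE \<xi>::'a in lborel. (\<lambda>k. gaussian_symbol (1 / real (Suc k)) \<xi> * exp (- t * full_symbol s \<xi>) * cos (z \<bullet> \<xi> + 0))
      \<longlonglongrightarrow> 1 / (2 * pi) ^ DIM('a) * exp (- t * full_symbol s \<xi>) * cos (z \<bullet> \<xi> + 0)"
  proof (intro AE_I2)
    fix \<xi> :: 'a
    have "(\<lambda>k. 1 / (2 * pi) ^ DIM('a) * exp (- inverse (real (Suc k)) * (norm \<xi>)\<^sup>2)) \<longlonglongrightarrow> 1 / (2 * pi) ^ DIM('a) * exp (- 0 * (norm \<xi>)\<^sup>2)"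
      by (intro tendsto_intros LIMSEQ_inverse_real_of_nat)
    hence "(\<lambda>k. gaussian_symbol (1 / real (Suc k)) \<xi>) \<longlonglongrightarrow> 1 / (2 * pi) ^ DIM('a)"
      by (simp add: gaussian_symbol_def inverse_eq_divide)
    thus "(\<lambda>k. gaussian_symbol (1 / real (Suc k)) \<xi> * exp (- t * full_symbol s \<xi>) * cos (z \<bullet> \<xi> + 0))
      \<longlonglongrightarrow> 1 / (2 * pi) ^ DIM('a) * exp (- t * full_symbol s \<xi>) * cos (z \<bullet> \<xi> + 0)"
      by (intro tendsto_mult tendsto_const)
  qed
  fix k :: nat
  show "AE \<xi>::'a in lborel. norm (gaussian_symbol (1 / real (Suc k)) \<xi> * exp (- t * full_symbol s \<xi>) * cos (z \<bullet> \<xi> + 0))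
      \<le> 1 / (2 * pi) ^ DIM('a) * exp (- t * full_symbol s \<xi>)"
  proof (intro AE_I2)
    fix \<xi> :: 'a
    have g: "gaussian_symbol (1 / real (Suc k)) \<xi> \<le> 1 / (2 * pi) ^ DIM('a) * 1"
      unfolding gaussian_symbol_def by (intro mult_left_mono) auto
    have "\<bar>gaussian_symbol (1 / real (Suc k)) \<xi>\<bar> * exp (- t * full_symbol s \<xi>) * \<bar>cos (z \<bullet> \<xi> + 0)\<bar>
       \<le> (1 / (2 * pi) ^ DIM('a) * 1) * exp (- t * full_symbol s \<xi>) * 1"
      using g less_imp_le[OF gaussian_symbol_pos[of "1 / real (Suc k)" \<xi>]] by (intro mult_mono) auto
    thus "norm (gaussian_symbol (1 / real (Suc k)) \<xi> * exp (- t * full_symbol s \<xi>) * cos (z \<bullet> \<xi> + 0))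
      \<le> 1 / (2 * pi) ^ DIM('a) * exp (- t * full_symbol s \<xi>)" by (simp add: abs_mult)
  qed
qed measurable

lemma fundamental_kernel_eq:
  fixes z :: "'a::euclidean_space"
  shows "fundamental_kernel s z = (\<integral>\<^sup>+t. indicator {0<..} t *
     ennreal (wave (\<lambda>\<xi>. 1 / (2 * pi) ^ DIM('a) * exp (- t * full_symbol s \<xi>)) (\<lambda>_. 0) z) \<partial>lborel)"
  unfolding fundamental_kernel_def nn_integral_completion
  by (intro nn_integral_cong) (auto simp: indicator_def heat_kernel_eq_wave)

lemma fundamental_kernel_measurable [measurable]: "fundamental_kernel s \<in> borel_measurable borel"
  unfolding fundamental_kernel_eq[abs_def] wave_def by measurable

lemma fundamental_kernel_minus: "fundamental_kernel s (- z) = fundamental_kernel s z"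
  by (simp add: fundamental_kernel_eq wave_def)

text \<open>
  The regularised kernels converge to the heat kernel at each positive time, and the time
  horizons exhaust the half-line, so Fatou's lemma applies.
\<close>

lemma fundamental_kernel_le_liminf:
  fixes z :: "'a::euclidean_space"
  shows "fundamental_kernel s z \<le> liminf (\<lambda>k. \<integral>\<^sup>+t. indicator {0..real k} t * ennreal (reg_heat_kernel s (1 / real (Suc k)) z t) \<partial>lborel)"
proof -
  have [measurable]: "reg_heat_kernel s \<delta> z \<in> borel_measurable borel" for \<delta>
    unfolding reg_heat_kernel_def[abs_def] wave_def by measurable
  have "fundamental_kernel s z \<le> (\<integral>\<^sup>+t. liminf (\<lambda>k. indicator {0..real k} t * ennreal (reg_heat_kernel s (1 / real (Suc k)) z t)) \<partial>lborel)"
    unfolding fundamental_kernel_eq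
  proof (intro nn_integral_mono)
    fix t :: real
    show "indicator {0<..} t * ennreal (wave (\<lambda>\<xi>. 1 / (2 * pi) ^ DIM('a) * exp (- t * full_symbol s \<xi>)) (\<lambda>_. 0) z)
        \<le> liminf (\<lambda>k. indicator {0..real k} t * ennreal (reg_heat_kernel s (1 / real (Suc k)) z t))"
    proof (cases "t > 0")
      case True
      have "(\<lambda>k. ennreal (reg_heat_kernel s (1 / real (Suc k)) z t)) \<longlonglongrightarrow> ennreal (heat_kernel s z t)"
        by (intro tendsto_ennrealI reg_heat_kernel_tendsto True)
      moreover have "eventually (\<lambda>k. ennreal (reg_heat_kernel s (1 / real (Suc k)) z t)
          = indicator {0..real k} t * ennreal (reg_heat_kernel s (1 / real (Suc k)) z t)) sequentially"
      proof -
        obtain k0 :: nat where "t \<le> real k0" using real_arch_simple by blast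
        thus ?thesis using True by (intro eventually_sequentiallyI[of k0]) (auto simp: indicator_def)
      qed
      ultimately have "(\<lambda>k. indicator {0..real k} t * ennreal (reg_heat_kernel s (1 / real (Suc k)) z t)) \<longlonglongrightarrow> ennreal (heat_kernel s z t)"
        by (rule Lim_transform_eventually)
      from lim_imp_Liminf[OF trivial_limit_sequentially this] show ?thesis
        using True by (simp add: heat_kernel_eq_wave)
    qed simp
  qed
  also have "\<dots> \<le> liminf (\<lambda>k. \<integral>\<^sup>+t. indicator {0..real k} t * ennreal (reg_heat_kernel s (1 / real (Suc k)) z t) \<partial>lborel)"
    by (intro nn_integral_liminf) measurable
  finally show ?thesis .
qed

lemma nn_integral_heat_gaussian:
  fixes x :: "'a::euclidean_space"
  assumes \<delta>: "\<delta> > 0"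
  shows "(\<integral>\<^sup>+z. ennreal (heat_gaussian \<delta> (x - z)) \<partial>lborel) = 1"
proof -
  define a where "a = 1 / (4 * \<delta>)"
  define c where "c = (1 / (2 * pi) ^ DIM('a)) * (pi / \<delta>) powr (real DIM('a) / 2)"
  have a: "a > 0" and c: "c \<ge> 0" using \<delta> by (auto simp: a_def c_def)
  have h: "heat_gaussian \<delta> z = c * exp (- a * (norm z)\<^sup>2)" for z :: 'a
    by (simp add: heat_gaussian_def c_def a_def)
  have i: "integrable lborel (\<lambda>z::'a. exp (- a * (norm z)\<^sup>2))"
    and v: "(LINT z|lborel. exp (- a * (norm (z::'a))\<^sup>2)) = (pi / a) powr (real DIM('a) / 2)"
    using gaussian_fourier[OF a, of "0::'a"] by auto
  have "c * (pi / a) powr (real DIM('a) / 2) = 1"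
  proof -
    have "(pi / \<delta>) powr (real DIM('a) / 2) * (pi / a) powr (real DIM('a) / 2) = ((2 * pi) powr 2) powr (real DIM('a) / 2)"
      using \<delta> by (simp add: a_def power2_eq_square mult_ac flip: powr_mult)
    also have "\<dots> = (2 * pi) powr real DIM('a)" unfolding powr_powr by simp
    also have "\<dots> = (2 * pi) ^ DIM('a)" by (simp add: powr_realpow)
    finally show ?thesis by (simp add: c_def)
  qed
  hence "(\<integral>\<^sup>+z. ennreal (heat_gaussian \<delta> (z::'a)) \<partial>lborel) = 1"
    unfolding h using c
    by (subst nn_integral_eq_integral[OF integrable_mult_right[OF i]]) (auto simp only: integral_mult_right_zero v ennreal_1 intro!: AE_I2 mult_nonneg_nonneg exp_ge_zero)
  moreover have "(\<integral>\<^sup>+z. ennreal (heat_gaussian \<delta> (x - z)) \<partial>lborel) = (\<integral>\<^sup>+z. ennreal (heat_gaussian \<delta> (x + z)) \<partial>lborel)"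
    using nn_integral_lborel_minus[of "\<lambda>z. ennreal (heat_gaussian \<delta> (x + z))"] by simp
  moreover have "(\<integral>\<^sup>+z. ennreal (heat_gaussian \<delta> (x + z)) \<partial>lborel) = (\<integral>\<^sup>+z. ennreal (heat_gaussian \<delta> (z::'a)) \<partial>lborel)"
    using nn_integral_lborel_translate[of "\<lambda>z. ennreal (heat_gaussian \<delta> z)" x] by simp
  ultimately show ?thesis by simp
qed

text \<open>
  Away from the origin the Gauss kernels tend to 0 as \<open>\<delta>\<close> does, and they are bounded by the tail of the
  jump kernel uniformly: with \<open>v = \<bar>z\<bar>\<^sup>2 / (4 \<delta>)\<close> and \<open>m = n/2 + s\<close>, the boundedness of
  \<open>v powr m * exp (-v)\<close> leaves exactly the power \<open>\<delta> powr s\<close>.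
\<close>

lemma heat_gaussian_offdiagonal:
  assumes s: "0 < s" "s < 1"
  shows "\<exists>C>0. \<forall>\<delta>>0. \<forall>z::'a::euclidean_space. z \<noteq> 0 \<longrightarrow> heat_gaussian \<delta> z \<le> C * \<delta> powr s / norm z powr (real DIM('a) + 2 * s)"
proof -
  define p where "p = real DIM('a) + 2 * s"
  have p: "p > 0" using s by (simp add: p_def add_nonneg_pos)
  define m where "m = p / 2"
  obtain M where M: "M > 0" "\<forall>v\<ge>1. v powr m * exp (- 1 * v) \<le> M"
    using powr_mult_exp_bounded[of 1 m] by auto
  have N: "v powr m * exp (- v) \<le> M + 1" if "v > 0" for v
  proof (cases "v \<ge> 1")
    case True
    have "v powr m * exp (- 1 * v) \<le> M" using M(2) True by blast
    thus ?thesis by simp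
  next
    case False
    have "v powr m * exp (- v) \<le> 1 * 1" using that False p by (intro mult_mono powr_le1) (auto simp: m_def)
    thus ?thesis using M(1) by simp
  qed
  define c0 where "c0 = 1 / (2 * pi) ^ DIM('a)"
  have c0: "c0 > 0" by (simp add: c0_def)
  define C where "C = c0 * pi powr (real DIM('a) / 2) * (M + 1) * 4 powr m"
  have C: "C > 0" using c0 M by (simp add: C_def)
  have "heat_gaussian \<delta> z \<le> C * \<delta> powr s / norm z powr p" if \<delta>: "\<delta> > 0" and z: "z \<noteq> 0" for \<delta> and z :: 'a
  proof -
    define v where "v = (norm z)\<^sup>2 / (4 * \<delta>)"
    have v: "v > 0" using \<delta> z by (simp add: v_def)
    have vm: "v powr m = norm z powr p / (4 powr m * \<delta> powr m)"
    proof -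
      have "((norm z)\<^sup>2) powr m = (norm z powr 2) powr m" using z by (simp add: powr_numeral)
      also have "\<dots> = norm z powr p" unfolding powr_powr by (simp add: m_def)
      finally show ?thesis using \<delta> by (simp add: v_def powr_divide powr_mult)
    qed
    have nz: "norm z powr p > 0" using z by simp
    have "exp (- v) * norm z powr p \<le> (M + 1) * (4 powr m * \<delta> powr m)"
      using N[OF v] \<delta> unfolding vm by (simp add: field_simps)
    hence e: "exp (- v) \<le> (M + 1) * (4 powr m * \<delta> powr m) / norm z powr p"
      using nz by (simp add: pos_le_divide_eq)
    have "heat_gaussian \<delta> z = c0 * ((pi / \<delta>) powr (real DIM('a) / 2) * exp (- v))"
      by (simp add: heat_gaussian_def c0_def v_def)
    also have "\<dots> \<le> c0 * ((pi / \<delta>) powr (real DIM('a) / 2) * ((M + 1) * (4 powr m * \<delta> powr m) / norm z powr p))"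
      using c0 by (intro mult_left_mono e) auto
    also have "\<dots> = C * \<delta> powr s / norm z powr p"
    proof -
      have "\<delta> powr m = \<delta> powr (real DIM('a) / 2) * \<delta> powr s" by (simp add: m_def p_def add_divide_distrib powr_add)
      thus ?thesis using \<delta> by (simp add: C_def powr_divide)
    qed
    finally show ?thesis .
  qed
  thus ?thesis using C unfolding p_def by blast
qed

text \<open>
  By the first two bounds the Gaussian averages of the indicator function of the closed set K have limit
  superior at most that indicator function; the third one provides an integrable majorant when
  the averages are multiplied by u.
\<close>

lemma gaussian_average_compact:
  fixes K :: "'a::euclidean_space set"
  assumes s: "0 < s" "s < 1" and K: "compact K"
  defines "h \<equiv> \<lambda>k x. \<integral>\<^sup>+z. indicator K z * ennreal (heat_gaussian (1 / real (Suc k)) (x - z)) \<partial>lborel"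
  shows "h k x \<le> 1"
    and "x \<notin> K \<Longrightarrow> (\<lambda>k. h k x) \<longlonglongrightarrow> 0"
    and "\<exists>C>0. \<forall>k x. h k x \<le> ennreal (C * tail_weight s x)"
proof -
  define p where "p = real DIM('a) + 2 * s"
  have p: "p > 0" using s by (simp add: p_def add_nonneg_pos)
  have le1: "h k x \<le> 1" for k x
  proof -
    have "h k x \<le> (\<integral>\<^sup>+z. ennreal (heat_gaussian (1 / real (Suc k)) (x - z)) \<partial>lborel)"
      unfolding h_def by (intro nn_integral_mono) (auto simp: indicator_def)
    thus ?thesis by (simp add: nn_integral_heat_gaussian)
  qed
  show "h k x \<le> 1" by (rule le1)
  obtain C where C: "C > 0" "\<forall>\<delta>>0. \<forall>z::'a. z \<noteq> 0 \<longrightarrow> heat_gaussian \<delta> z \<le> C * \<delta> powr s / norm z powr p"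
    using heat_gaussian_offdiagonal[OF s, where 'a='a, folded p_def] by (elim exE conjE) (rule that)
  have [measurable]: "K \<in> sets borel" using K by (simp add: compact_imp_closed)
  have Kfin: "emeasure lborel K < \<infinity>" by (rule emeasure_bounded_finite[OF compact_imp_bounded[OF K]])
  define \<mu> where "\<mu> = measure lborel K"
  have \<mu>: "emeasure lborel K = ennreal \<mu>" "\<mu> \<ge> 0" using Kfin by (auto simp: \<mu>_def emeasure_eq_ennreal_measure)
  have far: "h k x \<le> ennreal (C * (1 / real (Suc k)) powr s / d powr p * \<mu>)"
    if d: "d > 0" "\<And>z. z \<in> K \<Longrightarrow> d \<le> norm (x - z)" for k x d
  proof -
    have "h k x \<le> (\<integral>\<^sup>+z. ennreal (C * (1 / real (Suc k)) powr s / d powr p) * indicator K z \<partial>lborel)"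
      unfolding h_def
    proof (intro nn_integral_mono)
      fix z :: 'a
      show "indicator K z * ennreal (heat_gaussian (1 / real (Suc k)) (x - z)) \<le> ennreal (C * (1 / real (Suc k)) powr s / d powr p) * indicator K z"
      proof (cases "z \<in> K")
        case True
        have nz: "x - z \<noteq> 0" using d(1) d(2)[OF True] by auto
        have "heat_gaussian (1 / real (Suc k)) (x - z) \<le> C * (1 / real (Suc k)) powr s / norm (x - z) powr p"
          using C(2) nz by simp
        also have "\<dots> \<le> C * (1 / real (Suc k)) powr s / d powr p"
          using C(1) d(1) d(2)[OF True] p by (intro divide_left_mono powr_mono2 mult_pos_pos) auto
        finally show ?thesis using True by (simp add: ennreal_leI)
      qed simp
    qed
    also have "\<dots> = ennreal (C * (1 / real (Suc k)) powr s / d powr p) * ennreal \<mu>"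
      by (simp add: nn_integral_cmult_indicator \<mu>(1))
    also have "\<dots> = ennreal (C * (1 / real (Suc k)) powr s / d powr p * \<mu>)"
      using C(1) by (intro ennreal_mult'[symmetric]) auto
    finally show ?thesis .
  qed
  show "(\<lambda>k. h k x) \<longlonglongrightarrow> 0" if x: "x \<notin> K"
  proof -
    have "open (- K)" using K by (simp add: compact_imp_closed open_Compl)
    then obtain d where d: "d > 0" "ball x d \<subseteq> - K" using x unfolding open_contains_ball by blast
    have dd: "d \<le> norm (x - z)" if "z \<in> K" for z
    proof (rule ccontr)
      assume "\<not> d \<le> norm (x - z)"
      hence "z \<in> ball x d" by (simp add: dist_norm)
      thus False using d(2) that by blast
    qed
    have "(\<lambda>k. inverse (real (Suc k)) powr s) \<longlonglongrightarrow> 0"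
      by (rule tendsto_zero_powrI[OF LIMSEQ_inverse_real_of_nat tendsto_const]) (use s in auto)
    hence "(\<lambda>k. C * inverse (real (Suc k)) powr s / d powr p * \<mu>) \<longlonglongrightarrow> C * 0 / d powr p * \<mu>"
      using d(1) by (intro tendsto_intros) auto
    hence lim: "(\<lambda>k. ennreal (C * (1 / real (Suc k)) powr s / d powr p * \<mu>)) \<longlonglongrightarrow> 0"
      using tendsto_ennrealI[of "\<lambda>k. C * inverse (real (Suc k)) powr s / d powr p * \<mu>" 0 sequentially] by (simp add: inverse_eq_divide)
    show ?thesis
      by (rule tendsto_sandwich[OF _ _ tendsto_const lim]) (use far[OF d(1) dd] in auto)
  qed
  obtain R where R: "R \<ge> 1" "\<And>z. z \<in> K \<Longrightarrow> norm z \<le> R"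
  proof -
    obtain b where "\<forall>z\<in>K. norm z \<le> b" using compact_imp_bounded[OF K] unfolding bounded_iff by blast
    thus thesis by (intro that[of "max 1 b"]) (auto intro: order_trans)
  qed
  \<comment> \<open>The constant \<open>C1\<close> serves the ball of radius \<open>2 * R\<close>, where the average is at most 1. Outside
     it, \<open>\<bar>x - z\<bar> \<ge> \<bar>x\<bar> / 2\<close> for z in K, which costs \<open>2 powr p\<close>, and \<open>4 + \<bar>x\<bar>\<^sup>2 \<le> 2 \<bar>x\<bar>\<^sup>2\<close>, which
     costs \<open>2 powr (p / 2)\<close>; both enter \<open>C2\<close>.\<close>
  define C1 where "C1 = (4 + 4 * R\<^sup>2) powr (p / 2)"
  define C2 where "C2 = C * 2 powr p * 2 powr (p / 2)"
  have R4: "4 + 4 * R\<^sup>2 > 0" by (simp add: add_pos_nonneg)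
  have C12: "C1 > 0" "C2 > 0" using C(1) less_imp_neq[OF R4] by (auto simp: C1_def C2_def)
  have "h k x \<le> ennreal ((C1 + C2 * \<mu>) * tail_weight s x)" for k x
  proof (cases "norm x \<le> 2 * R")
    case True
    have "(norm x)\<^sup>2 \<le> (2 * R)\<^sup>2" using True by (intro power_mono) auto
    hence "(4 + 4 * R\<^sup>2) powr (- p / 2) \<le> tail_weight s x"
      unfolding weight_def p_def[symmetric] using p by (intro powr_mono2') (auto simp: power_mult_distrib)
    hence "C1 * (4 + 4 * R\<^sup>2) powr (- p / 2) \<le> C1 * tail_weight s x" using C12 by (intro mult_left_mono) auto
    moreover have "C1 * (4 + 4 * R\<^sup>2) powr (- p / 2) = 1"
      using R4 unfolding C1_def by (simp flip: powr_add)
    ultimately have "1 \<le> C1 * tail_weight s x" by simp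
    also have "\<dots> \<le> (C1 + C2 * \<mu>) * tail_weight s x" using C12 \<mu>(2) by (intro mult_right_mono) auto
    finally have "ennreal 1 \<le> ennreal ((C1 + C2 * \<mu>) * tail_weight s x)" by (rule ennreal_leI)
    thus ?thesis using le1[of k x] by (simp add: order_trans)
  next
    case False
    have x: "norm x > 2" using False R(1) by simp
    have dd: "norm x / 2 \<le> norm (x - z)" if "z \<in> K" for z
      using norm_triangle_ineq2[of x z] R(2)[OF that] False by linarith
    have "C * (1 / real (Suc k)) powr s / (norm x / 2) powr p \<le> C * 1 / (norm x / 2) powr p"
      using C(1) s x by (intro divide_right_mono mult_left_mono powr_le1) auto
    also have "\<dots> = C * 2 powr p * norm x powr (- p)" using x by (simp add: powr_divide powr_minus_divide)
    also have "\<dots> \<le> C * 2 powr p * (2 powr (p / 2) * tail_weight s x)"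
    proof (intro mult_left_mono)
      have "4 \<le> (norm x)\<^sup>2" using power_mono[of 2 "norm x" 2] x by simp
      hence "(2 * (norm x)\<^sup>2) powr (- p / 2) \<le> tail_weight s x"
        unfolding weight_def p_def[symmetric] using p by (intro powr_mono2') auto
      moreover have "((norm x)\<^sup>2) powr (- p / 2) = norm x powr (- p)"
      proof -
        have "((norm x)\<^sup>2) powr (- p / 2) = (norm x powr 2) powr (- p / 2)" using x by (simp add: powr_numeral)
        thus ?thesis unfolding powr_powr by simp
      qed
      ultimately have "2 powr (- p / 2) * norm x powr (- p) \<le> tail_weight s x" by (simp add: powr_mult)
      hence "2 powr (p / 2) * (2 powr (- p / 2) * norm x powr (- p)) \<le> 2 powr (p / 2) * tail_weight s x" by (intro mult_left_mono) auto
      thus "norm x powr (- p) \<le> 2 powr (p / 2) * tail_weight s x" by (simp add: mult.assoc[symmetric] flip: powr_add)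
    qed (use C(1) in auto)
    finally have "C * (1 / real (Suc k)) powr s / (norm x / 2) powr p \<le> C2 * tail_weight s x" by (simp add: C2_def mult.assoc)
    hence "C * (1 / real (Suc k)) powr s / (norm x / 2) powr p * \<mu> \<le> C2 * tail_weight s x * \<mu>"
      using \<mu>(2) by (intro mult_right_mono)
    also have "\<dots> \<le> (C1 + C2 * \<mu>) * tail_weight s x" using C12 by (simp add: algebra_simps)
    finally have "ennreal (C * (1 / real (Suc k)) powr s / (norm x / 2) powr p * \<mu>) \<le> ennreal ((C1 + C2 * \<mu>) * tail_weight s x)" by (rule ennreal_leI)
    moreover have "h k x \<le> ennreal (C * (1 / real (Suc k)) powr s / (norm x / 2) powr p * \<mu>)"
      by (rule far) (use x dd in auto)
    ultimately show ?thesis by (rule order_trans[rotated])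
  qed
  moreover have "C1 + C2 * \<mu> > 0" using C12 \<mu>(2) by (simp add: add_pos_nonneg)
  ultimately show "\<exists>C>0. \<forall>k x. h k x \<le> ennreal (C * tail_weight s x)" by (intro exI[of _ "C1 + C2 * \<mu>"] conjI allI)
qed

section \<open>Conclusion\<close>

lemma ennreal_liminf_cmult:
  fixes c :: ennreal
  assumes "c < top"
  shows "c * liminf X = liminf (\<lambda>k. c * X k)"
proof -
  have "mono (\<lambda>x. c * x)" by (intro monoI mult_left_mono) auto
  from Liminf_compose_continuous_mono[OF ennreal_continuous_on_cmult[OF assms continuous_on_id] this trivial_limit_sequentially, of X]
  show ?thesis by simp
qed

text \<open>
  If the set where \<open>V > v\<close> had positive measure, inner regularity would provide a compact subset of
  positive measure, and there the integrals would violate the hypothesis.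
\<close>

lemma AE_le_if_compact_integrals_le:
  fixes V v :: "'a::euclidean_space \<Rightarrow> ennreal"
  assumes [measurable]: "V \<in> borel_measurable borel" "v \<in> borel_measurable borel"
    and le: "\<And>K. compact K \<Longrightarrow> (\<integral>\<^sup>+x. indicator K x * V x \<partial>lborel) \<le> (\<integral>\<^sup>+x. indicator K x * v x \<partial>lborel)"
    and fin: "\<And>K. compact K \<Longrightarrow> (\<integral>\<^sup>+x. indicator K x * v x \<partial>lborel) < \<infinity>"
  shows "AE x in lborel. V x \<le> v x"
proof -
  define S where "S = {x. v x < V x}"
  have S [measurable]: "S \<in> sets borel" unfolding S_def by measurable
  have null: "emeasure lborel K = 0" if K: "compact K" "K \<subseteq> S" for K
  proof (rule ccontr)
    assume nz: "emeasure lborel K \<noteq> 0"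
    have [measurable]: "K \<in> sets borel" using K(1) by (simp add: compact_imp_closed)
    have "(\<integral>\<^sup>+x. indicator K x * v x \<partial>lborel) < (\<integral>\<^sup>+x. indicator K x * V x \<partial>lborel)"
    proof (rule nn_integral_less)
      show "(\<integral>\<^sup>+x. indicator K x * v x \<partial>lborel) \<noteq> \<infinity>" using fin[OF K(1)] by simp
      show "AE x in lborel. indicator K x * v x \<le> indicator K x * V x"
        using K(2) by (intro AE_I2) (auto simp: indicator_def S_def)
      show "\<not> (AE x in lborel. indicator K x * V x \<le> indicator K x * v x)"
      proof
        assume "AE x in lborel. indicator K x * V x \<le> indicator K x * v x"
        hence "AE x in lborel. x \<notin> K"
          by eventually_elim (use K(2) in \<open>auto simp: indicator_def S_def\<close>)
        hence "K \<in> null_sets lborel" by (subst AE_iff_null_sets) auto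
        hence "emeasure lborel K = 0" by (rule null_setsD1)
        thus False using nz by simp
      qed
    qed measurable
    thus False using le[OF K(1)] by simp
  qed
  have "emeasure lebesgue S \<le> 0"
  proof (rule ennreal_le_epsilon)
    fix e :: real assume e: "e > 0"
    have "S \<in> sets lebesgue" by simp
    then obtain T where T: "closed T" "T \<subseteq> S" "S - T \<in> lmeasurable" "emeasure lebesgue (S - T) < ennreal e"
      by (rule sets_lebesgue_inner_closed[OF _ e])
    have "T = (\<Union>k::nat. T \<inter> cball 0 (real k))"
    proof (intro equalityI subsetI)
      fix x assume "x \<in> T"
      moreover obtain k :: nat where "norm x \<le> real k" using real_arch_simple by blast
      ultimately show "x \<in> (\<Union>k::nat. T \<inter> cball 0 (real k))" by auto
    qed auto
    moreover have "T \<inter> cball 0 (real k) \<in> null_sets lborel" for k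
    proof -
      have "compact (T \<inter> cball 0 (real k))" using T(1) by (intro closed_Int_compact compact_cball)
      moreover have "T \<inter> cball 0 (real k) \<subseteq> S" using T(2) by blast
      ultimately have "emeasure lborel (T \<inter> cball 0 (real k)) = 0" by (rule null)
      moreover have "T \<inter> cball 0 (real k) \<in> sets lborel" using T(1) by simp
      ultimately show ?thesis by (simp add: null_sets_def)
    qed
    ultimately have "T \<in> null_sets lborel" using null_sets_UN[of "\<lambda>k::nat. T \<inter> cball 0 (real k)" lborel] by simp
    hence "emeasure lebesgue T = 0" by (simp add: null_sets_def)
    moreover have "emeasure lebesgue S \<le> emeasure lebesgue T + emeasure lebesgue (S - T)"
    proof -
      have "S = T \<union> (S - T)" using T(2) by blast
      moreover have "emeasure lebesgue (T \<union> (S - T)) \<le> emeasure lebesgue T + emeasure lebesgue (S - T)"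
        using T(1,3) by (intro emeasure_subadditive) (auto simp: fmeasurableD)
      ultimately show ?thesis by simp
    qed
    ultimately show "emeasure lebesgue S \<le> 0 + ennreal e" using T(4) by simp
  qed
  hence "S \<in> null_sets lborel" by (simp add: null_sets_def)
  hence "AE x in lborel. x \<notin> S" by (rule AE_not_in)
  thus ?thesis by eventually_elim (simp add: S_def not_less)
qed

theorem proposition2p3:
  fixes u :: "'a::euclidean_space \<Rightarrow> real" and s q :: real
  assumes "DIM('a) \<ge> 3"
    and "0 < s" and "s < 1"
    and "q > 1"
    and "nonneg_distr_supersolution s q u"
  shows "AE x in lebesgue.
           ennreal (u x) \<ge>
             (\<integral>\<^sup>+y. fundamental_kernel s (x - y) * ennreal (u y powr q) \<partial>lebesgue)"
proof -
  note s = \<open>0 < s\<close> \<open>s < 1\<close> and u = \<open>nonneg_distr_supersolution s q u\<close>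
  have um: "u \<in> borel_measurable lebesgue"
    using u by (simp add: nonneg_distr_supersolution_def Lq_loc_def)
  obtain v' where v'm [measurable]: "v' \<in> borel_measurable lborel" and v'e: "AE x in lborel. u x = v' x"
    using completion_ex_borel_measurable_real[OF um] by (elim bexE) (rule that)
  \<comment> \<open>A Borel version of u that is nonnegative everywhere: Tonelli's theorem below concerns
     the product of two copies of the Borel-Lebesgue measure.\<close>
  define v where "v = (\<lambda>x. max 0 (v' x))"
  have [measurable]: "v \<in> borel_measurable borel" unfolding v_def using v'm by simp
  have "AE x in lebesgue. u x \<ge> 0" using u by (simp add: nonneg_distr_supersolution_def)
  hence "AE x in lborel. u x \<ge> 0" by (simp only: AE_completion_iff)
  with v'e have uv: "AE x in lborel. u x = v x" by eventually_elim (simp add: v_def)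
  define V where "V = (\<lambda>x. \<integral>\<^sup>+y. fundamental_kernel s (x - y) * ennreal (v y powr q) \<partial>lborel)"
  have Vm [measurable]: "V \<in> borel_measurable borel" unfolding V_def by measurable
  define \<delta> where "\<delta> = (\<lambda>k::nat. 1 / real (Suc k))"
  define G where "G = (\<lambda>k x. \<integral>\<^sup>+y. ennreal (v y) * ennreal (heat_gaussian (\<delta> k) (y - x)) \<partial>lborel)"
  have Gm [measurable]: "G k \<in> borel_measurable borel" for k unfolding G_def by measurable
  have V_le: "V x \<le> liminf (\<lambda>k. G k x)" for x
  proof -
    define R where "R = (\<lambda>k y. \<integral>\<^sup>+t. indicator {0..real k} t * ennreal (reg_heat_kernel s (\<delta> k) (y - x) t) \<partial>lborel)"
    have [measurable]: "R k \<in> borel_measurable borel" for k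
      unfolding R_def reg_heat_kernel_def wave_def by measurable
    have "V x \<le> (\<integral>\<^sup>+y. liminf (\<lambda>k. ennreal (v y powr q) * R k y) \<partial>lborel)"
      unfolding V_def
    proof (intro nn_integral_mono)
      fix y
      have "fundamental_kernel s (x - y) = fundamental_kernel s (y - x)"
        using fundamental_kernel_minus[of s "y - x"] by simp
      also have "\<dots> \<le> liminf (\<lambda>k. R k y)" unfolding R_def \<delta>_def by (rule fundamental_kernel_le_liminf)
      finally have "ennreal (v y powr q) * fundamental_kernel s (x - y) \<le> ennreal (v y powr q) * liminf (\<lambda>k. R k y)"
        by (intro mult_left_mono) auto
      also have "\<dots> = liminf (\<lambda>k. ennreal (v y powr q) * R k y)" by (rule ennreal_liminf_cmult) simp
      finally show "fundamental_kernel s (x - y) * ennreal (v y powr q) \<le> liminf (\<lambda>k. ennreal (v y powr q) * R k y)"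
        by (simp add: mult.commute)
    qed
    also have "\<dots> \<le> liminf (\<lambda>k. \<integral>\<^sup>+y. ennreal (v y powr q) * R k y \<partial>lborel)"
      by (intro nn_integral_liminf) measurable
    also have "\<dots> \<le> liminf (\<lambda>k. G k x)"
    proof (intro Liminf_mono always_eventually allI)
      fix k
      have "(\<integral>\<^sup>+y. ennreal (v y powr q) * R k y \<partial>lborel) = (\<integral>\<^sup>+y. ennreal (u y powr q) * R k y \<partial>lebesgue)"
        unfolding nn_integral_completion by (rule nn_integral_cong_AE, rule AE_mp[OF uv], rule AE_I2, rule impI) simp
      also have "\<dots> \<le> (\<integral>\<^sup>+y. ennreal (u y) * ennreal (heat_gaussian (\<delta> k) (y - x)) \<partial>lebesgue)"
        unfolding R_def by (rule supersolution_potential_le[OF s u]) (auto simp: \<delta>_def)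
      also have "\<dots> = G k x"
        unfolding G_def nn_integral_completion by (rule nn_integral_cong_AE, rule AE_mp[OF uv], rule AE_I2, rule impI) simp
      finally show "(\<integral>\<^sup>+y. ennreal (v y powr q) * R k y \<partial>lborel) \<le> G k x" .
    qed
    finally show ?thesis .
  qed
  have vw: "(\<integral>\<^sup>+x. ennreal (v x * tail_weight s x) \<partial>lborel) < \<infinity>"
  proof -
    have "L_2s s u" using u by (simp add: nonneg_distr_supersolution_def)
    from L_2s_integrable_weight[OF s this um]
    have "(\<integral>\<^sup>+x. ennreal (norm (\<bar>u x\<bar> * tail_weight s x)) \<partial>lebesgue) < \<infinity>"
      by (simp only: integrable_iff_bounded)
    moreover have "(\<integral>\<^sup>+x. ennreal (norm (\<bar>u x\<bar> * tail_weight s x)) \<partial>lebesgue) = (\<integral>\<^sup>+x. ennreal (v x * tail_weight s x) \<partial>lborel)"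
      unfolding nn_integral_completion
      by (rule nn_integral_cong_AE, rule AE_mp[OF uv], rule AE_I2, rule impI) (simp add: abs_mult v_def)
    ultimately show ?thesis by simp
  qed
  have fin: "(\<integral>\<^sup>+x. indicator K x * ennreal (v x) \<partial>lborel) < \<infinity>" if K: "compact K" for K
  proof -
    have "L1_loc u" using u by (simp add: nonneg_distr_supersolution_def L_2s_def)
    hence "set_integrable lebesgue K u" using K by (simp add: L1_loc_def)
    hence "(\<integral>\<^sup>+x. ennreal (norm (indicator K x *\<^sub>R u x)) \<partial>lebesgue) < \<infinity>"
      by (simp only: set_integrable_def integrable_iff_bounded)
    moreover have "(\<integral>\<^sup>+x. ennreal (norm (indicator K x *\<^sub>R u x)) \<partial>lebesgue) = (\<integral>\<^sup>+x. indicator K x * ennreal (v x) \<partial>lborel)"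
      unfolding nn_integral_completion
      by (rule nn_integral_cong_AE, rule AE_mp[OF uv], rule AE_I2, rule impI) (auto simp: indicator_def v_def)
    ultimately show ?thesis by simp
  qed
  have compact_le: "(\<integral>\<^sup>+x. indicator K x * V x \<partial>lborel) \<le> (\<integral>\<^sup>+x. indicator K x * ennreal (v x) \<partial>lborel)"
    if K: "compact K" for K
  proof -
    have [measurable]: "K \<in> sets borel" using K by (simp add: compact_imp_closed)
    define h where "h = (\<lambda>k y. \<integral>\<^sup>+x. indicator K x * ennreal (heat_gaussian (\<delta> k) (y - x)) \<partial>lborel)"
    have hm [measurable]: "h k \<in> borel_measurable borel" for k unfolding h_def by measurable
    have H1: "h k y \<le> 1" for k y
      unfolding h_def \<delta>_def by (rule gaussian_average_compact(1)[OF s K])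
    have H2: "(\<lambda>k. h k y) \<longlonglongrightarrow> 0" if "y \<notin> K" for y
      unfolding h_def \<delta>_def by (rule gaussian_average_compact(2)[OF s K that])
    have H3: "\<exists>C>0. \<forall>k y. h k y \<le> ennreal (C * tail_weight s y)"
      unfolding h_def \<delta>_def by (rule gaussian_average_compact(3)[OF s K])
    obtain C where C: "C > 0" "\<forall>k y. h k y \<le> ennreal (C * tail_weight s y)"
      using H3 by (elim exE conjE) (rule that)
    have "(\<integral>\<^sup>+x. indicator K x * V x \<partial>lborel) \<le> (\<integral>\<^sup>+x. liminf (\<lambda>k. indicator K x * G k x) \<partial>lborel)"
    proof (intro nn_integral_mono)
      fix x
      show "indicator K x * V x \<le> liminf (\<lambda>k. indicator K x * G k x)"
        using V_le[of x] by (cases "x \<in> K") auto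
    qed
    also have "\<dots> \<le> liminf (\<lambda>k. \<integral>\<^sup>+x. indicator K x * G k x \<partial>lborel)"
      by (intro nn_integral_liminf) measurable
    also have "\<dots> = liminf (\<lambda>k. \<integral>\<^sup>+y. ennreal (v y) * h k y \<partial>lborel)"
    proof (intro arg_cong[of _ _ liminf] ext)
      fix k
      have "(\<integral>\<^sup>+x. indicator K x * G k x \<partial>lborel)
          = (\<integral>\<^sup>+x. \<integral>\<^sup>+y. indicator K x * (ennreal (v y) * ennreal (heat_gaussian (\<delta> k) (y - x))) \<partial>lborel \<partial>lborel)"
        unfolding G_def by (intro nn_integral_cong nn_integral_cmult[symmetric]) measurable
      also have "\<dots> = (\<integral>\<^sup>+y. \<integral>\<^sup>+x. indicator K x * (ennreal (v y) * ennreal (heat_gaussian (\<delta> k) (y - x))) \<partial>lborel \<partial>lborel)"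
        by (rule lborel_pair.Fubini') measurable
      also have "\<dots> = (\<integral>\<^sup>+y. \<integral>\<^sup>+x. ennreal (v y) * (indicator K x * ennreal (heat_gaussian (\<delta> k) (y - x))) \<partial>lborel \<partial>lborel)"
        by (simp only: mult.left_commute)
      also have "\<dots> = (\<integral>\<^sup>+y. ennreal (v y) * h k y \<partial>lborel)"
        unfolding h_def by (intro nn_integral_cong nn_integral_cmult) measurable
      finally show "(\<integral>\<^sup>+x. indicator K x * G k x \<partial>lborel) = (\<integral>\<^sup>+y. ennreal (v y) * h k y \<partial>lborel)" .
    qed
    also have "\<dots> \<le> limsup (\<lambda>k. \<integral>\<^sup>+y. ennreal (v y) * h k y \<partial>lborel)"
      by (rule Liminf_le_Limsup) simp
    also have "\<dots> \<le> (\<integral>\<^sup>+y. limsup (\<lambda>k. ennreal (v y) * h k y) \<partial>lborel)"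
    proof (rule nn_integral_limsup[where w = "\<lambda>y. ennreal C * ennreal (v y * tail_weight s y)"])
      show "AE y in lborel. ennreal (v y) * h k y \<le> ennreal C * ennreal (v y * tail_weight s y)" for k
      proof (intro AE_I2)
        fix y
        have "ennreal (v y) * h k y \<le> ennreal (v y) * ennreal (C * tail_weight s y)"
          using C(2) by (intro mult_left_mono) auto
        also have "\<dots> = ennreal C * ennreal (v y * tail_weight s y)"
        proof -
          have "ennreal (v y) * ennreal (C * tail_weight s y) = ennreal (v y * (C * tail_weight s y))"
            by (rule ennreal_mult'[symmetric]) (simp add: v_def)
          also have "\<dots> = ennreal (C * (v y * tail_weight s y))" by (simp only: mult.left_commute)
          also have "\<dots> = ennreal C * ennreal (v y * tail_weight s y)"
            by (rule ennreal_mult') (use C(1) in simp)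
          finally show ?thesis .
        qed
        finally show "ennreal (v y) * h k y \<le> ennreal C * ennreal (v y * tail_weight s y)" .
      qed
      show "(\<integral>\<^sup>+y. ennreal C * ennreal (v y * tail_weight s y) \<partial>lborel) < \<infinity>"
        using vw by (subst nn_integral_cmult) (auto simp: ennreal_mult_less_top)
    qed measurable
    also have "\<dots> \<le> (\<integral>\<^sup>+y. indicator K y * ennreal (v y) \<partial>lborel)"
    proof (intro nn_integral_mono)
      fix y
      show "limsup (\<lambda>k. ennreal (v y) * h k y) \<le> indicator K y * ennreal (v y)"
      proof (cases "y \<in> K")
        case True
        have "ennreal (v y) * h k y \<le> ennreal (v y) * 1" for k by (intro mult_left_mono H1) simp
        hence "limsup (\<lambda>k. ennreal (v y) * h k y) \<le> ennreal (v y)"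
          by (intro Limsup_bounded always_eventually allI) simp
        thus ?thesis using True by simp
      next
        case False
        have "(\<lambda>k. ennreal (v y) * h k y) \<longlonglongrightarrow> ennreal (v y) * 0"
          by (intro ennreal_tendsto_cmult H2 False) simp
        from lim_imp_Limsup[OF trivial_limit_sequentially this] show ?thesis by simp
      qed
    qed
    finally show ?thesis .
  qed
  have "AE x in lborel. V x \<le> ennreal (v x)"
    by (rule AE_le_if_compact_integrals_le) (use compact_le fin in auto)
  with uv have "AE x in lborel. V x \<le> ennreal (u x)" by eventually_elim simp
  moreover have "V x = (\<integral>\<^sup>+y. fundamental_kernel s (x - y) * ennreal (u y powr q) \<partial>lebesgue)" for x
    unfolding V_def nn_integral_completion by (rule nn_integral_cong_AE, rule AE_mp[OF uv], rule AE_I2, rule impI) simp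
  ultimately show ?thesis unfolding AE_completion_iff by simp
qed

end
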